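(* Let $G$ be a finite group acting on a monoidal triangulated category $\mathbf{K}$. Assume that $\mathbf{K}$ is $\Bbbk$-linear for some ring $\Bbbk$ with $|G|\neq 0$ in $\Bbbk$, and that $\mathbf{K}$ is the homotopy category of some stable model category (or, in particular, $\mathbf{K}$ admits a DG enhancement). Let $\mathbf{I}$ be a $G$-ideal of $\mathbf{K}$ and $\mathbf{J}$ a thick ideal of the equivariantization $\mathbf{K}^G$. Then: (1) $\mathbf{I}^G$ is a thick ideal of $\mathbf{K}^G$; (2) $\mathbf{J}\cap\mathbf{K}$ is a $G$-ideal of $\mathbf{K}$; (3) the maps given by (1) and (2) define a bijection between $G$-ideals of $\mathbf{K}$ and thick ideals of $\mathbf{K}^G$, that is, $(\mathbf{I}^G)\cap\mathbf{K}=\mathbf{I}$ and $(\mathbf{J}\cap\mathbf{K})^G=\mathbf{J}$; (4) a $G$-ideal $\mathbf{P}$ of $\mathbf{K}$ is a $G$-prime of $\mathbf{K}$ if and only if $\mathbf{P}^G$ is a prime ideal of $\mathbf{K}^G$; (5) the bijection from (3) restricts to a homeomorphism $\operatorname{Spc}\mathbf{K}^G\cong G\text{-}\operatorname{Spc}\mathbf{K}$.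
   Context: A monoidal triangulated category is a triangulated category $\mathbf{K}$ with a compatible monoidal structure $(\otimes,\mathbf{1})$, i.e. $\otimes$ is exact in each variable; no braiding is assumed. An action of a group $G$ on $\mathbf{K}$ consists of autoequivalences of monoidal triangulated categories $T_g:\mathbf{K}\to\mathbf{K}$ (monoidal and triangulated), $g\in G$, and natural isomorphisms (of monoidal triangulated functors) $\gamma_{g,h}:T_gT_h\cong T_{gh}$ with $\gamma_{g,hk}\circ T_g\gamma_{h,k}=\gamma_{gh,k}\circ\gamma_{g,h}T_k$ for all $g,h,k\in G$. All subcategories are full and closed under isomorphism. A thick ideal is a triangulated subcategory closed under direct summands and under $\otimes$ on both sides with arbitrary objects. A prime ideal is a proper thick ideal $\mathbf{P}$ such that $\mathbf{I}\otimes\mathbf{J}\subseteq\mathbf{P}$ implies $\mathbf{I}\subseteq\mathbf{P}$ or $\mathbf{J}\subseteq\mathbf{P}$ for all thick ideals $\mathbf{I},\mathbf{J}$. $\operatorname{Spc}$ of a monoidal triangulated category is the set of its prime ideals, with closed sets $V(\mathbf{S})=\{\mathbf{P}:\mathbf{S}\cap\mathbf{P}=\varnothing\}$ for collections $\mathbf{S}$ of objects. A $G$-ideal of $\mathbf{K}$ is a thick ideal $\mathbf{I}$ with $T_g\mathbf{I}\subseteq\mathbf{I}$ for all $g\in G$, where $T_g\mathbf{I}=\{T_gA:A\in\mathbf{I}\}$. A $G$-prime is a proper $G$-ideal $\mathbf{Q}$ such that for all $G$-ideals $\mathbf{I},\mathbf{J}$, $\mathbf{I}\otimes\mathbf{J}\subseteq\mathbf{Q}$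 implies $\mathbf{I}\subseteq\mathbf{Q}$ or $\mathbf{J}\subseteq\mathbf{Q}$. $G\text{-}\operatorname{Spc}\mathbf{K}$ is the set of $G$-primes with closed sets $V^G(\mathbf{S})=\{\mathbf{Q}:\mathbf{S}\cap\mathbf{Q}=\varnothing\}$ for collections $\mathbf{S}$ of objects. Equivariantization: objects of $\mathbf{K}^G$ are pairs $(A,\phi)$ with $A\in\mathbf{K}$ and $\phi=\{\phi_g:T_gA\xrightarrow{\cong}A\}_{g\in G}$ such that $\phi_{gh}\circ\gamma_{g,h}^A=\phi_g\circ T_g\phi_h$ for all $g,h$; morphisms $(A,\phi)\to(B,\psi)$ are morphisms $A\to B$ commuting with the equivariant structures; the monoidal product is inherited from $\mathbf{K}$. The forgetful functor is $\operatorname{For}:\mathbf{K}^G\to\mathbf{K}$, $(A,\phi)\mapsto A$, and $\operatorname{Ind}:\mathbf{K}\to\mathbf{K}^G$ is $A\mapsto\left(\bigoplus_{g\in G}T_gA,\tau^A\right)$ with $\tau^A_h=\bigoplus_{g\in G}\gamma^A_{h,h^{-1}g}:T_h\left(\bigoplus_gT_gA\right)\xrightarrow{\cong}\bigoplus_gT_gA$. Under the stated hypotheses, $\mathbf{K}^G$ is regarded (citing results of Elagin and Balmer) as a monoidal triangulated category in which a triangle is distinguished if and only if its image under $\operatorname{For}$ is distinguished in $\mathbf{K}$. For a $G$-ideal $\mathbf{I}$ of $\mathbf{K}$, $\mathbf{I}^G=\{(A,\phi)\in\mathbf{K}^G:A\in\mathbf{I}\}$. For a thick ideal $\mathbf{J}$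 of $\mathbf{K}^G$, $\mathbf{J}\cap\mathbf{K}=\{A\in\mathbf{K}:\operatorname{Ind}(A)\in\mathbf{J}\}$. *)

theory Defs
  imports "HOL-Algebra.Group" "HOL-Analysis.Abstract_Topology"
begin

section \<open>Categories, functors, natural isomorphisms\<close>

record ('o, 'm) cat =
  Ob :: "'o set"
  Ar :: "'m set"
  Dom :: "'m \<Rightarrow> 'o"
  Cod :: "'m \<Rightarrow> 'o"
  Ide :: "'o \<Rightarrow> 'm"
  Cmp :: "'m \<Rightarrow> 'm \<Rightarrow> 'm"  (infixl "\<cdot>\<index>" 70)

definition Hom :: "('o, 'm, 'x) cat_scheme \<Rightarrow> 'o \<Rightarrow> 'o \<Rightarrow> 'm set" where
  "Hom C X Y = {f \<in> Ar C. Dom C f = X \<and> Cod C f = Y}"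

locale category =
  fixes C :: "('o, 'm, 'x) cat_scheme" (structure)
  assumes Dom_Ob: "f \<in> Ar C \<Longrightarrow> Dom C f \<in> Ob C"
    and Cod_Ob: "f \<in> Ar C \<Longrightarrow> Cod C f \<in> Ob C"
    and Ide_Hom: "X \<in> Ob C \<Longrightarrow> Ide C X \<in> Hom C X X"
    and Cmp_Hom: "\<lbrakk>f \<in> Hom C X Y; g \<in> Hom C Y Z\<rbrakk> \<Longrightarrow> g \<cdot> f \<in> Hom C X Z"
    and Cmp_Ide: "f \<in> Hom C X Y \<Longrightarrow> f \<cdot> Ide C X = f"
    and Ide_Cmp: "f \<in> Hom C X Y \<Longrightarrow> Ide C Y \<cdot> f = f"
    and Cmp_assoc: "\<lbrakk>f \<in> Hom C X Y; g \<in> Hom C Y Z; h \<in> Hom C Z U\<rbrakk>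
                    \<Longrightarrow> (h \<cdot> g) \<cdot> f = h \<cdot> (g \<cdot> f)"

definition inverse_arrows :: "('o, 'm, 'x) cat_scheme \<Rightarrow> 'm \<Rightarrow> 'm \<Rightarrow> bool" where
  "inverse_arrows C f g \<longleftrightarrow> f \<in> Ar C \<and> g \<in> Hom C (Cod C f) (Dom C f) \<and>
     g \<cdot>\<^bsub>C\<^esub> f = Ide C (Dom C f) \<and> f \<cdot>\<^bsub>C\<^esub> g = Ide C (Cod C f)"

definition is_iso :: "('o, 'm, 'x) cat_scheme \<Rightarrow> 'm \<Rightarrow> bool" where
  "is_iso C f \<longleftrightarrow> (\<exists>g. inverse_arrows C f g)"

definition inv_ar :: "('o, 'm, 'x) cat_scheme \<Rightarrow> 'm \<Rightarrow> 'm" where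
  "inv_ar C f = (THE g. inverse_arrows C f g)"

definition isomorphic :: "('o, 'm, 'x) cat_scheme \<Rightarrow> 'o \<Rightarrow> 'o \<Rightarrow> bool" where
  "isomorphic C X Y \<longleftrightarrow> (\<exists>f \<in> Hom C X Y. is_iso C f)"

record ('o, 'm, 'p, 'n) funct =
  FO :: "'o \<Rightarrow> 'p"
  FA :: "'m \<Rightarrow> 'n"

definition id_funct :: "('o, 'm, 'o, 'm) funct" where
  "id_funct = \<lparr>FO = (\<lambda>X. X), FA = (\<lambda>f. f)\<rparr>"

definition comp_funct ::
  "('p, 'n, 'q, 'l) funct \<Rightarrow> ('o, 'm, 'p, 'n) funct \<Rightarrow> ('o, 'm, 'q, 'l) funct" where
  "comp_funct F H = \<lparr>FO = (\<lambda>X. FO F (FO H X)), FA = (\<lambda>f. FA F (FA H f))\<rparr>"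

locale cat_functor =
  fixes C :: "('o, 'm, 'x) cat_scheme" and D :: "('p, 'n, 'y) cat_scheme"
    and F :: "('o, 'm, 'p, 'n) funct"
  assumes FO_Ob: "X \<in> Ob C \<Longrightarrow> FO F X \<in> Ob D"
    and FA_Hom: "f \<in> Hom C X Y \<Longrightarrow> FA F f \<in> Hom D (FO F X) (FO F Y)"
    and FA_Ide: "X \<in> Ob C \<Longrightarrow> FA F (Ide C X) = Ide D (FO F X)"
    and FA_Cmp: "\<lbrakk>f \<in> Hom C X Y; g \<in> Hom C Y Z\<rbrakk>
                 \<Longrightarrow> FA F (g \<cdot>\<^bsub>C\<^esub> f) = FA F g \<cdot>\<^bsub>D\<^esub> FA F f"

definition nat_iso :: "('o, 'm, 'x) cat_scheme \<Rightarrow> ('p, 'n, 'y) cat_scheme \<Rightarrow>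
    ('o, 'm, 'p, 'n) funct \<Rightarrow> ('o, 'm, 'p, 'n) funct \<Rightarrow> ('o \<Rightarrow> 'n) \<Rightarrow> bool" where
  "nat_iso C D F H \<alpha> \<longleftrightarrow>
     (\<forall>X \<in> Ob C. \<alpha> X \<in> Hom D (FO F X) (FO H X) \<and> is_iso D (\<alpha> X)) \<and>
     (\<forall>f \<in> Ar C. \<alpha> (Cod C f) \<cdot>\<^bsub>D\<^esub> FA F f = FA H f \<cdot>\<^bsub>D\<^esub> \<alpha> (Dom C f))"

definition cat_equivalence :: "('o, 'm, 'x) cat_scheme \<Rightarrow> ('p, 'n, 'y) cat_scheme \<Rightarrow>
    ('o, 'm, 'p, 'n) funct \<Rightarrow> bool" where
  "cat_equivalence C D F \<longleftrightarrow> cat_functor C D F \<and>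
     (\<exists>H \<eta> \<epsilon>. cat_functor D C H \<and>
        nat_iso C C id_funct (comp_funct H F) \<eta> \<and> nat_iso D D (comp_funct F H) id_funct \<epsilon>)"

definition is_initial :: "('o, 'm, 'x) cat_scheme \<Rightarrow> 'o \<Rightarrow> bool" where
  "is_initial C Z \<longleftrightarrow> Z \<in> Ob C \<and> (\<forall>X \<in> Ob C. \<exists>!f. f \<in> Hom C Z X)"

definition is_terminal :: "('o, 'm, 'x) cat_scheme \<Rightarrow> 'o \<Rightarrow> bool" where
  "is_terminal C Z \<longleftrightarrow> Z \<in> Ob C \<and> (\<forall>X \<in> Ob C. \<exists>!f. f \<in> Hom C X Z)"

definition is_zero :: "('o, 'm, 'x) cat_scheme \<Rightarrow> 'o \<Rightarrow> bool" where
  "is_zero C Z \<longleftrightarrow> is_initial C Z \<and> is_terminal C Z"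


section \<open>Triangulated categories\<close>

text \<open>A triangle \<open>X \<rightarrow> Y \<rightarrow> Z \<rightarrow> \<Sigma>X\<close> is recorded as the triple of its arrows.  The shift \<open>Sh\<close>
  is an autoequivalence, not necessarily an automorphism.\<close>

record ('o, 'm) scat = "('o, 'm) cat" +
  Sh :: "('o, 'm, 'o, 'm) funct"
  Tri :: "('m \<times> 'm \<times> 'm) set"

record ('o, 'm) tcat = "('o, 'm) scat" +
  Zer :: "'o \<Rightarrow> 'o \<Rightarrow> 'm"
  Add :: "'m \<Rightarrow> 'm \<Rightarrow> 'm"  (infixl "\<oplus>\<^sub>a\<index>" 65)

definition is_triangle :: "('o, 'm, 'x) cat_scheme \<Rightarrow> ('o, 'm, 'o, 'm) funct \<Rightarrow>
    'm \<times> 'm \<times> 'm \<Rightarrow> bool" where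
  "is_triangle C S = (\<lambda>(f, g, h). f \<in> Ar C \<and> g \<in> Ar C \<and> h \<in> Ar C \<and>
     Cod C f = Dom C g \<and> Cod C g = Dom C h \<and> Cod C h = FO S (Dom C f))"

definition iso_triangles :: "('o, 'm, 'x) cat_scheme \<Rightarrow> ('o, 'm, 'o, 'm) funct \<Rightarrow>
    'm \<times> 'm \<times> 'm \<Rightarrow> 'm \<times> 'm \<times> 'm \<Rightarrow> bool" where
  "iso_triangles C S = (\<lambda>(f, g, h) (f', g', h').
     \<exists>a \<in> Hom C (Dom C f) (Dom C f'). \<exists>b \<in> Hom C (Cod C f) (Cod C f').
     \<exists>c \<in> Hom C (Cod C g) (Cod C g').
       is_iso C a \<and> is_iso C b \<and> is_iso C c \<and>
       b \<cdot>\<^bsub>C\<^esub> f = f' \<cdot>\<^bsub>C\<^esub> a \<and> c \<cdot>\<^bsub>C\<^esub> g = g' \<cdot>\<^bsub>C\<^esub> b \<and> FA S a \<cdot>\<^bsub>C\<^esub> h = h' \<cdot>\<^bsub>C\<^esub> c)"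

definition hom_group :: "('o, 'm, 'x) tcat_scheme \<Rightarrow> 'o \<Rightarrow> 'o \<Rightarrow> 'm monoid" where
  "hom_group C X Y = \<lparr>carrier = Hom C X Y, mult = Add C, one = Zer C X Y\<rparr>"

definition neg_ar :: "('o, 'm, 'x) tcat_scheme \<Rightarrow> 'm \<Rightarrow> 'm" where
  "neg_ar C f = inv\<^bsub>hom_group C (Dom C f) (Cod C f)\<^esub> f"

definition is_biproduct2 :: "('o, 'm, 'x) tcat_scheme \<Rightarrow> 'o \<Rightarrow> 'o \<Rightarrow> 'o \<Rightarrow>
    'm \<Rightarrow> 'm \<Rightarrow> 'm \<Rightarrow> 'm \<Rightarrow> bool" where
  "is_biproduct2 C A B S i1 i2 p1 p2 \<longleftrightarrow>
     A \<in> Ob C \<and> B \<in> Ob C \<and> S \<in> Ob C \<and>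
     i1 \<in> Hom C A S \<and> i2 \<in> Hom C B S \<and> p1 \<in> Hom C S A \<and> p2 \<in> Hom C S B \<and>
     p1 \<cdot>\<^bsub>C\<^esub> i1 = Ide C A \<and> p2 \<cdot>\<^bsub>C\<^esub> i2 = Ide C B \<and>
     p2 \<cdot>\<^bsub>C\<^esub> i1 = Zer C A B \<and> p1 \<cdot>\<^bsub>C\<^esub> i2 = Zer C B A \<and>
     (i1 \<cdot>\<^bsub>C\<^esub> p1) \<oplus>\<^sub>a\<^bsub>C\<^esub> (i2 \<cdot>\<^bsub>C\<^esub> p2) = Ide C S"

definition direct_summand :: "('o, 'm, 'x) tcat_scheme \<Rightarrow> 'o \<Rightarrow> 'o \<Rightarrow> bool" where
  "direct_summand C A S \<longleftrightarrow> (\<exists>B i1 i2 p1 p2. is_biproduct2 C A B S i1 i2 p1 p2)"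

locale additive_category = category C
  for C :: "('o, 'm, 'x) tcat_scheme" (structure) +
  assumes hom_comm_group: "\<lbrakk>X \<in> Ob C; Y \<in> Ob C\<rbrakk> \<Longrightarrow> comm_group (hom_group C X Y)"
    and Cmp_Add_right: "\<lbrakk>f \<in> Hom C X Y; f' \<in> Hom C X Y; g \<in> Hom C Y Z\<rbrakk>
                        \<Longrightarrow> g \<cdot> (f \<oplus>\<^sub>a f') = (g \<cdot> f) \<oplus>\<^sub>a (g \<cdot> f')"
    and Cmp_Add_left: "\<lbrakk>f \<in> Hom C X Y; g \<in> Hom C Y Z; g' \<in> Hom C Y Z\<rbrakk>
                       \<Longrightarrow> (g \<oplus>\<^sub>a g') \<cdot> f = (g \<cdot> f) \<oplus>\<^sub>a (g' \<cdot> f)"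
    and zero_object: "\<exists>Z. is_zero C Z"
    and biproducts: "\<lbrakk>A \<in> Ob C; B \<in> Ob C\<rbrakk>
                     \<Longrightarrow> \<exists>S i1 i2 p1 p2. is_biproduct2 C A B S i1 i2 p1 p2"

definition additive_functor :: "('o, 'm, 'x) tcat_scheme \<Rightarrow> ('p, 'n, 'y) tcat_scheme \<Rightarrow>
    ('o, 'm, 'p, 'n) funct \<Rightarrow> bool" where
  "additive_functor C D F \<longleftrightarrow> cat_functor C D F \<and>
     (\<forall>X \<in> Ob C. \<forall>Y \<in> Ob C. \<forall>f \<in> Hom C X Y. \<forall>g \<in> Hom C X Y.
        FA F (f \<oplus>\<^sub>a\<^bsub>C\<^esub> g) = FA F f \<oplus>\<^sub>a\<^bsub>D\<^esub> FA F g)"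

locale triangulated_category = additive_category C
  for C :: "('o, 'm, 'x) tcat_scheme" (structure) +
  assumes shift_equivalence: "cat_equivalence C C (Sh C)"
    and shift_additive: "additive_functor C C (Sh C)"
    and Tri_triangle: "t \<in> Tri C \<Longrightarrow> is_triangle C (Sh C) t"
    and TR0: "\<lbrakk>t \<in> Tri C; is_triangle C (Sh C) t'; iso_triangles C (Sh C) t t'\<rbrakk> \<Longrightarrow> t' \<in> Tri C"
    and TR1_id: "\<lbrakk>X \<in> Ob C; is_zero C Z\<rbrakk> \<Longrightarrow> (Ide C X, Zer C X Z, Zer C Z (FO (Sh C) X)) \<in> Tri C"
    and TR1_cone: "f \<in> Ar C \<Longrightarrow> \<exists>g h. (f, g, h) \<in> Tri C"
    and TR2: "is_triangle C (Sh C) (f, g, h)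
              \<Longrightarrow> (f, g, h) \<in> Tri C \<longleftrightarrow> (g, h, neg_ar C (FA (Sh C) f)) \<in> Tri C"
    and TR3: "\<lbrakk>(f, g, h) \<in> Tri C; (f', g', h') \<in> Tri C;
               a \<in> Hom C (Dom C f) (Dom C f'); b \<in> Hom C (Cod C f) (Cod C f'); b \<cdot> f = f' \<cdot> a\<rbrakk>
              \<Longrightarrow> \<exists>c \<in> Hom C (Cod C g) (Cod C g'). c \<cdot> g = g' \<cdot> b \<and> FA (Sh C) a \<cdot> h = h' \<cdot> c"
    and TR4: "\<lbrakk>(f, i, i') \<in> Tri C; (g, j, j') \<in> Tri C; Cod C f = Dom C g; (g \<cdot> f, k, k') \<in> Tri C\<rbrakk>
              \<Longrightarrow> \<exists>u v. (u, v, FA (Sh C) i \<cdot> j') \<in> Tri C \<and>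
                    u \<in> Hom C (Cod C i) (Cod C k) \<and> v \<in> Hom C (Cod C k) (Cod C j) \<and>
                    u \<cdot> i = k \<cdot> g \<and> k' \<cdot> u = i' \<and> v \<cdot> k = j \<and> j' \<cdot> v = FA (Sh C) f \<cdot> k'"

text \<open>An exact (triangulated) functor is \<open>F\<close> together with a natural isomorphism
  \<open>\<theta> : F \<Sigma> \<cong> \<Sigma> F\<close>.\<close>

definition exact_functor :: "('o, 'm, 'x) tcat_scheme \<Rightarrow> ('p, 'n, 'y) tcat_scheme \<Rightarrow>
    ('o, 'm, 'p, 'n) funct \<Rightarrow> ('o \<Rightarrow> 'n) \<Rightarrow> bool" where
  "exact_functor C D F \<theta> \<longleftrightarrow> additive_functor C D F \<and>
     nat_iso C D (comp_funct F (Sh C)) (comp_funct (Sh D) F) \<theta> \<and>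
     (\<forall>f g h. (f, g, h) \<in> Tri C \<longrightarrow> (FA F f, FA F g, \<theta> (Dom C f) \<cdot>\<^bsub>D\<^esub> FA F h) \<in> Tri D)"

text \<open>No additivity is needed here: an equivalence of additive categories is additive.\<close>

definition triangle_equivalence :: "('o, 'm, 'x) scat_scheme \<Rightarrow> ('p, 'n, 'y) scat_scheme \<Rightarrow>
    ('o, 'm, 'p, 'n) funct \<Rightarrow> ('o \<Rightarrow> 'n) \<Rightarrow> bool" where
  "triangle_equivalence C D F \<theta> \<longleftrightarrow> cat_equivalence C D F \<and>
     nat_iso C D (comp_funct F (Sh C)) (comp_funct (Sh D) F) \<theta> \<and>
     (\<forall>f g h. is_triangle C (Sh C) (f, g, h) \<longrightarrow>
        ((f, g, h) \<in> Tri C \<longleftrightarrow> (FA F f, FA F g, \<theta> (Dom C f) \<cdot>\<^bsub>D\<^esub> FA F h) \<in> Tri D))"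


section \<open>Monoidal triangulated categories\<close>

record ('o, 'm) mtcat = "('o, 'm) tcat" +
  TO :: "'o \<Rightarrow> 'o \<Rightarrow> 'o"
  TA :: "'m \<Rightarrow> 'm \<Rightarrow> 'm"
  Unt :: "'o"
  Asc :: "'o \<Rightarrow> 'o \<Rightarrow> 'o \<Rightarrow> 'm"
  Lun :: "'o \<Rightarrow> 'm"
  Run :: "'o \<Rightarrow> 'm"

definition tensor_left :: "('o, 'm, 'x) mtcat_scheme \<Rightarrow> 'o \<Rightarrow> ('o, 'm, 'o, 'm) funct" where
  "tensor_left K A = \<lparr>FO = TO K A, FA = TA K (Ide K A)\<rparr>"

definition tensor_right :: "('o, 'm, 'x) mtcat_scheme \<Rightarrow> 'o \<Rightarrow> ('o, 'm, 'o, 'm) funct" where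
  "tensor_right K B = \<lparr>FO = (\<lambda>A. TO K A B), FA = (\<lambda>f. TA K f (Ide K B))\<rparr>"

locale monoidal_category = category K
  for K :: "('o, 'm, 'x) mtcat_scheme" (structure) +
  assumes TO_Ob: "\<lbrakk>A \<in> Ob K; B \<in> Ob K\<rbrakk> \<Longrightarrow> TO K A B \<in> Ob K"
    and TA_Hom: "\<lbrakk>f \<in> Hom K A A'; g \<in> Hom K B B'\<rbrakk> \<Longrightarrow> TA K f g \<in> Hom K (TO K A B) (TO K A' B')"
    and TA_Ide: "\<lbrakk>A \<in> Ob K; B \<in> Ob K\<rbrakk> \<Longrightarrow> TA K (Ide K A) (Ide K B) = Ide K (TO K A B)"
    and TA_Cmp: "\<lbrakk>f \<in> Hom K A A'; f' \<in> Hom K A' A''; g \<in> Hom K B B'; g' \<in> Hom K B' B''\<rbrakk>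
                 \<Longrightarrow> TA K (f' \<cdot> f) (g' \<cdot> g) = TA K f' g' \<cdot> TA K f g"
    and Unt_Ob: "Unt K \<in> Ob K"
    and Asc_iso: "\<lbrakk>A \<in> Ob K; B \<in> Ob K; D \<in> Ob K\<rbrakk>
                  \<Longrightarrow> Asc K A B D \<in> Hom K (TO K (TO K A B) D) (TO K A (TO K B D)) \<and>
                      is_iso K (Asc K A B D)"
    and Lun_iso: "A \<in> Ob K \<Longrightarrow> Lun K A \<in> Hom K (TO K (Unt K) A) A \<and> is_iso K (Lun K A)"
    and Run_iso: "A \<in> Ob K \<Longrightarrow> Run K A \<in> Hom K (TO K A (Unt K)) A \<and> is_iso K (Run K A)"
    and Asc_nat: "\<lbrakk>f \<in> Hom K A A'; g \<in> Hom K B B'; h \<in> Hom K D D'\<rbrakk>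
                  \<Longrightarrow> Asc K A' B' D' \<cdot> TA K (TA K f g) h = TA K f (TA K g h) \<cdot> Asc K A B D"
    and Lun_nat: "f \<in> Hom K A A' \<Longrightarrow> Lun K A' \<cdot> TA K (Ide K (Unt K)) f = f \<cdot> Lun K A"
    and Run_nat: "f \<in> Hom K A A' \<Longrightarrow> Run K A' \<cdot> TA K f (Ide K (Unt K)) = f \<cdot> Run K A"
    and pentagon: "\<lbrakk>A \<in> Ob K; B \<in> Ob K; D \<in> Ob K; E \<in> Ob K\<rbrakk>
                   \<Longrightarrow> Asc K A B (TO K D E) \<cdot> Asc K (TO K A B) D E =
                       TA K (Ide K A) (Asc K B D E) \<cdot> Asc K A (TO K B D) E \<cdot>
                         TA K (Asc K A B D) (Ide K E)"
    and triangle: "\<lbrakk>A \<in> Ob K; B \<in> Ob K\<rbrakk>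
                   \<Longrightarrow> TA K (Ide K A) (Lun K B) \<cdot> Asc K A (Unt K) B = TA K (Run K A) (Ide K B)"

locale monoidal_triangulated_category = triangulated_category K + monoidal_category K
  for K :: "('o, 'm, 'x) mtcat_scheme" (structure) +
  assumes exact_left: "A \<in> Ob K \<Longrightarrow> \<exists>\<theta>. exact_functor K K (tensor_left K A) \<theta>"
    and exact_right: "B \<in> Ob K \<Longrightarrow> \<exists>\<theta>. exact_functor K K (tensor_right K B) \<theta>"

definition linear_category ::
  "('o, 'm, 'x) tcat_scheme \<Rightarrow> ('k::ring_1 \<Rightarrow> 'm \<Rightarrow> 'm) \<Rightarrow> bool" where
  "linear_category C s \<longleftrightarrow>
     (\<forall>X \<in> Ob C. \<forall>Y \<in> Ob C. \<forall>f \<in> Hom C X Y.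
        s 1 f = f \<and>
        (\<forall>a. s a f \<in> Hom C X Y) \<and>
        (\<forall>a. \<forall>g \<in> Hom C X Y. s a (f \<oplus>\<^sub>a\<^bsub>C\<^esub> g) = s a f \<oplus>\<^sub>a\<^bsub>C\<^esub> s a g) \<and>
        (\<forall>a b. s (a + b) f = s a f \<oplus>\<^sub>a\<^bsub>C\<^esub> s b f \<and> s (a * b) f = s a (s b f)) \<and>
        (\<forall>Z \<in> Ob C. \<forall>g \<in> Hom C Y Z. \<forall>a.
           s a (g \<cdot>\<^bsub>C\<^esub> f) = s a g \<cdot>\<^bsub>C\<^esub> f \<and> s a (g \<cdot>\<^bsub>C\<^esub> f) = g \<cdot>\<^bsub>C\<^esub> s a f))"


section \<open>Thick ideals, prime ideals and the spectrum\<close>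

text \<open>These notions only refer to the structure maps, so that they also make sense for the
  equivariantization below, whose triangles are defined through the forgetful functor.
  Full subcategories closed under isomorphism are identified with sets of objects.\<close>

definition triangulated_subcategory :: "('o, 'm, 'x) tcat_scheme \<Rightarrow> 'o set \<Rightarrow> bool" where
  "triangulated_subcategory K I \<longleftrightarrow> I \<subseteq> Ob K \<and>
     (\<forall>A \<in> I. \<forall>B \<in> Ob K. isomorphic K A B \<longrightarrow> B \<in> I) \<and>
     (\<forall>Z. is_zero K Z \<longrightarrow> Z \<in> I) \<and> I \<noteq> {} \<and>
     (\<forall>A \<in> Ob K. A \<in> I \<longleftrightarrow> FO (Sh K) A \<in> I) \<and>
     (\<forall>f g h. (f, g, h) \<in> Tri K \<longrightarrow> Dom K f \<in> I \<longrightarrow> Cod K f \<in> I \<longrightarrow> Cod K g \<in> I)"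

definition thick_ideal :: "('o, 'm, 'x) mtcat_scheme \<Rightarrow> 'o set \<Rightarrow> bool" where
  "thick_ideal K I \<longleftrightarrow> triangulated_subcategory K I \<and>
     (\<forall>S \<in> I. \<forall>A \<in> Ob K. direct_summand K A S \<longrightarrow> A \<in> I) \<and>
     (\<forall>A \<in> I. \<forall>B \<in> Ob K. TO K A B \<in> I \<and> TO K B A \<in> I)"

definition tensor_set :: "('o, 'm, 'x) mtcat_scheme \<Rightarrow> 'o set \<Rightarrow> 'o set \<Rightarrow> 'o set" where
  "tensor_set K I J = {TO K A B | A B. A \<in> I \<and> B \<in> J}"

definition prime_ideal :: "('o, 'm, 'x) mtcat_scheme \<Rightarrow> 'o set \<Rightarrow> bool" where
  "prime_ideal K P \<longleftrightarrow> thick_ideal K P \<and> P \<noteq> Ob K \<and>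
     (\<forall>I J. thick_ideal K I \<longrightarrow> thick_ideal K J \<longrightarrow> tensor_set K I J \<subseteq> P \<longrightarrow> I \<subseteq> P \<or> J \<subseteq> P)"

definition Spc :: "('o, 'm, 'x) mtcat_scheme \<Rightarrow> 'o set set" where
  "Spc K = {P. prime_ideal K P}"

text \<open>The topology on a set \<open>X\<close> of sets of objects whose closed sets are the
  \<open>{P \<in> X. S \<inter> P = {}}\<close>, where \<open>S\<close> ranges over all collections of objects.\<close>

definition zariski_topology :: "'o set \<Rightarrow> 'o set set \<Rightarrow> 'o set topology" where
  "zariski_topology Obj X =
     topology (\<lambda>U. U \<subseteq> X \<and> (\<exists>S \<subseteq> Obj. X - U = {P \<in> X. S \<inter> P = {}}))"

definition Spc_topology :: "('o, 'm, 'x) mtcat_scheme \<Rightarrow> 'o set topology" where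
  "Spc_topology K = zariski_topology (Ob K) (Spc K)"


section \<open>Group actions and equivariantization\<close>

text \<open>Strong monoidal structure \<open>\<mu> A B : F A \<otimes> F B \<cong> F (A \<otimes> B)\<close>, \<open>\<epsilon> : 1 \<cong> F 1\<close>.\<close>

definition monoidal_functor :: "('o, 'm, 'x) mtcat_scheme \<Rightarrow> ('p, 'n, 'y) mtcat_scheme \<Rightarrow>
    ('o, 'm, 'p, 'n) funct \<Rightarrow> ('o \<Rightarrow> 'o \<Rightarrow> 'n) \<Rightarrow> 'n \<Rightarrow> bool" where
  "monoidal_functor K L F \<mu> \<epsilon> \<longleftrightarrow> cat_functor K L F \<and>
     (\<forall>A \<in> Ob K. \<forall>B \<in> Ob K.
        \<mu> A B \<in> Hom L (TO L (FO F A) (FO F B)) (FO F (TO K A B)) \<and> is_iso L (\<mu> A B)) \<and>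
     \<epsilon> \<in> Hom L (Unt L) (FO F (Unt K)) \<and> is_iso L \<epsilon> \<and>
     (\<forall>f \<in> Ar K. \<forall>g \<in> Ar K.
        \<mu> (Cod K f) (Cod K g) \<cdot>\<^bsub>L\<^esub> TA L (FA F f) (FA F g) =
        FA F (TA K f g) \<cdot>\<^bsub>L\<^esub> \<mu> (Dom K f) (Dom K g)) \<and>
     (\<forall>A \<in> Ob K. \<forall>B \<in> Ob K. \<forall>D \<in> Ob K.
        FA F (Asc K A B D) \<cdot>\<^bsub>L\<^esub> \<mu> (TO K A B) D \<cdot>\<^bsub>L\<^esub> TA L (\<mu> A B) (Ide L (FO F D)) =
        \<mu> A (TO K B D) \<cdot>\<^bsub>L\<^esub> TA L (Ide L (FO F A)) (\<mu> B D) \<cdot>\<^bsub>L\<^esub>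
          Asc L (FO F A) (FO F B) (FO F D)) \<and>
     (\<forall>A \<in> Ob K.
        FA F (Lun K A) \<cdot>\<^bsub>L\<^esub> \<mu> (Unt K) A \<cdot>\<^bsub>L\<^esub> TA L \<epsilon> (Ide L (FO F A)) = Lun L (FO F A) \<and>
        FA F (Run K A) \<cdot>\<^bsub>L\<^esub> \<mu> A (Unt K) \<cdot>\<^bsub>L\<^esub> TA L (Ide L (FO F A)) \<epsilon> = Run L (FO F A))"

text \<open>Data of an action: the functors \<open>T g\<close> with their monoidal structure \<open>mu g\<close>, \<open>eps g\<close>,
  their compatibility \<open>xi g A : T g (\<Sigma> A) \<cong> \<Sigma> (T g A)\<close> with the shift, and
  \<open>gam g h A : T g (T h A) \<cong> T (g h) A\<close>.\<close>

record ('g, 'o, 'm) act =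
  T :: "'g \<Rightarrow> ('o, 'm, 'o, 'm) funct"
  mu :: "'g \<Rightarrow> 'o \<Rightarrow> 'o \<Rightarrow> 'm"
  eps :: "'g \<Rightarrow> 'm"
  xi :: "'g \<Rightarrow> 'o \<Rightarrow> 'm"
  gam :: "'g \<Rightarrow> 'g \<Rightarrow> 'o \<Rightarrow> 'm"

locale mt_action =
  group G + monoidal_triangulated_category K
  for G :: "('g, 'z) monoid_scheme" and K :: "('o, 'm, 'x) mtcat_scheme" +
  fixes \<T> :: "('g, 'o, 'm) act"
  assumes T_equivalence: "g \<in> carrier G \<Longrightarrow> cat_equivalence K K (T \<T> g)"
    and T_monoidal: "g \<in> carrier G \<Longrightarrow> monoidal_functor K K (T \<T> g) (mu \<T> g) (eps \<T> g)"
    and T_exact: "g \<in> carrier G \<Longrightarrow> exact_functor K K (T \<T> g) (xi \<T> g)"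
    and gam_nat_iso: "\<lbrakk>g \<in> carrier G; h \<in> carrier G\<rbrakk>
          \<Longrightarrow> nat_iso K K (comp_funct (T \<T> g) (T \<T> h)) (T \<T> (g \<otimes>\<^bsub>G\<^esub> h)) (gam \<T> g h)"
    and gam_mu: "\<lbrakk>g \<in> carrier G; h \<in> carrier G; A \<in> Ob K; B \<in> Ob K\<rbrakk>
          \<Longrightarrow> gam \<T> g h (TO K A B) \<cdot>\<^bsub>K\<^esub> FA (T \<T> g) (mu \<T> h A B) \<cdot>\<^bsub>K\<^esub>
                mu \<T> g (FO (T \<T> h) A) (FO (T \<T> h) B) =
              mu \<T> (g \<otimes>\<^bsub>G\<^esub> h) A B \<cdot>\<^bsub>K\<^esub> TA K (gam \<T> g h A) (gam \<T> g h B)"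
    and gam_eps: "\<lbrakk>g \<in> carrier G; h \<in> carrier G\<rbrakk>
          \<Longrightarrow> gam \<T> g h (Unt K) \<cdot>\<^bsub>K\<^esub> FA (T \<T> g) (eps \<T> h) \<cdot>\<^bsub>K\<^esub> eps \<T> g = eps \<T> (g \<otimes>\<^bsub>G\<^esub> h)"
    and gam_xi: "\<lbrakk>g \<in> carrier G; h \<in> carrier G; A \<in> Ob K\<rbrakk>
          \<Longrightarrow> xi \<T> (g \<otimes>\<^bsub>G\<^esub> h) A \<cdot>\<^bsub>K\<^esub> gam \<T> g h (FO (Sh K) A) =
              FA (Sh K) (gam \<T> g h A) \<cdot>\<^bsub>K\<^esub> xi \<T> g (FO (T \<T> h) A) \<cdot>\<^bsub>K\<^esub> FA (T \<T> g) (xi \<T> h A)"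
    and gam_cocycle: "\<lbrakk>g \<in> carrier G; h \<in> carrier G; k \<in> carrier G; A \<in> Ob K\<rbrakk>
          \<Longrightarrow> gam \<T> g (h \<otimes>\<^bsub>G\<^esub> k) A \<cdot>\<^bsub>K\<^esub> FA (T \<T> g) (gam \<T> h k A) =
              gam \<T> (g \<otimes>\<^bsub>G\<^esub> h) k A \<cdot>\<^bsub>K\<^esub> gam \<T> g h (FO (T \<T> k) A)"

definition G_ideal :: "('g, 'z) monoid_scheme \<Rightarrow> ('o, 'm, 'x) mtcat_scheme \<Rightarrow>
    ('g, 'o, 'm) act \<Rightarrow> 'o set \<Rightarrow> bool" where
  "G_ideal G K \<T> I \<longleftrightarrow> thick_ideal K I \<and> (\<forall>g \<in> carrier G. FO (T \<T> g) ` I \<subseteq> I)"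

definition G_prime :: "('g, 'z) monoid_scheme \<Rightarrow> ('o, 'm, 'x) mtcat_scheme \<Rightarrow>
    ('g, 'o, 'm) act \<Rightarrow> 'o set \<Rightarrow> bool" where
  "G_prime G K \<T> Q \<longleftrightarrow> G_ideal G K \<T> Q \<and> Q \<noteq> Ob K \<and>
     (\<forall>I J. G_ideal G K \<T> I \<longrightarrow> G_ideal G K \<T> J \<longrightarrow> tensor_set K I J \<subseteq> Q \<longrightarrow> I \<subseteq> Q \<or> J \<subseteq> Q)"

definition G_Spc :: "('g, 'z) monoid_scheme \<Rightarrow> ('o, 'm, 'x) mtcat_scheme \<Rightarrow>
    ('g, 'o, 'm) act \<Rightarrow> 'o set set" where
  "G_Spc G K \<T> = {Q. G_prime G K \<T> Q}"

definition G_Spc_topology :: "('g, 'z) monoid_scheme \<Rightarrow> ('o, 'm, 'x) mtcat_scheme \<Rightarrow>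
    ('g, 'o, 'm) act \<Rightarrow> 'o set topology" where
  "G_Spc_topology G K \<T> = zariski_topology (Ob K) (G_Spc G K \<T>)"

text \<open>Equivariant structures are extensional functions on the carrier of \<open>G\<close>, so that equality
  of objects of the equivariantization is the intended one.\<close>

definition equivariant_objects :: "('g, 'z) monoid_scheme \<Rightarrow> ('o, 'm, 'x) mtcat_scheme \<Rightarrow>
    ('g, 'o, 'm) act \<Rightarrow> ('o \<times> ('g \<Rightarrow> 'm)) set" where
  "equivariant_objects G K \<T> = {(A, \<phi>). A \<in> Ob K \<and> \<phi> \<in> extensional (carrier G) \<and>
     (\<forall>g \<in> carrier G. \<phi> g \<in> Hom K (FO (T \<T> g) A) A \<and> is_iso K (\<phi> g)) \<and>
     (\<forall>g \<in> carrier G. \<forall>h \<in> carrier G.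
        \<phi> (g \<otimes>\<^bsub>G\<^esub> h) \<cdot>\<^bsub>K\<^esub> gam \<T> g h A = \<phi> g \<cdot>\<^bsub>K\<^esub> FA (T \<T> g) (\<phi> h))}"

text \<open>An arrow of the equivariantization is a triple consisting of its domain, its codomain and
  the underlying arrow of \<open>K\<close>.\<close>

type_synonym ('g, 'o, 'm) eq_ob = "'o \<times> ('g \<Rightarrow> 'm)"
type_synonym ('g, 'o, 'm) eq_ar = "('g, 'o, 'm) eq_ob \<times> ('g, 'o, 'm) eq_ob \<times> 'm"

abbreviation For_ar :: "('g, 'o, 'm) eq_ar \<Rightarrow> 'm" where
  "For_ar f \<equiv> snd (snd f)"

definition eq_arrows :: "('g, 'z) monoid_scheme \<Rightarrow> ('o, 'm, 'x) mtcat_scheme \<Rightarrow>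
    ('g, 'o, 'm) act \<Rightarrow> ('g, 'o, 'm) eq_ar set" where
  "eq_arrows G K \<T> = {((A, \<phi>), (B, \<psi>), f).
     (A, \<phi>) \<in> equivariant_objects G K \<T> \<and> (B, \<psi>) \<in> equivariant_objects G K \<T> \<and>
     f \<in> Hom K A B \<and> (\<forall>g \<in> carrier G. f \<cdot>\<^bsub>K\<^esub> \<phi> g = \<psi> g \<cdot>\<^bsub>K\<^esub> FA (T \<T> g) f)}"

definition eq_shift :: "('g, 'z) monoid_scheme \<Rightarrow> ('o, 'm, 'x) mtcat_scheme \<Rightarrow>
    ('g, 'o, 'm) act \<Rightarrow> ('g, 'o, 'm) eq_ob \<Rightarrow> ('g, 'o, 'm) eq_ob" where
  "eq_shift G K \<T> = (\<lambda>(A, \<phi>).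
     (FO (Sh K) A, \<lambda>g \<in> carrier G. FA (Sh K) (\<phi> g) \<cdot>\<^bsub>K\<^esub> xi \<T> g A))"

definition eq_tensor :: "('g, 'z) monoid_scheme \<Rightarrow> ('o, 'm, 'x) mtcat_scheme \<Rightarrow>
    ('g, 'o, 'm) act \<Rightarrow> ('g, 'o, 'm) eq_ob \<Rightarrow> ('g, 'o, 'm) eq_ob \<Rightarrow> ('g, 'o, 'm) eq_ob" where
  "eq_tensor G K \<T> = (\<lambda>(A, \<phi>) (B, \<psi>).
     (TO K A B, \<lambda>g \<in> carrier G. TA K (\<phi> g) (\<psi> g) \<cdot>\<^bsub>K\<^esub> inv_ar K (mu \<T> g A B)))"

definition eq_unit :: "('g, 'z) monoid_scheme \<Rightarrow> ('o, 'm, 'x) mtcat_scheme \<Rightarrow>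
    ('g, 'o, 'm) act \<Rightarrow> ('g, 'o, 'm) eq_ob" where
  "eq_unit G K \<T> = (Unt K, \<lambda>g \<in> carrier G. inv_ar K (eps \<T> g))"

definition equivariantization :: "('g, 'z) monoid_scheme \<Rightarrow> ('o, 'm, 'x) mtcat_scheme \<Rightarrow>
    ('g, 'o, 'm) act \<Rightarrow> (('g, 'o, 'm) eq_ob, ('g, 'o, 'm) eq_ar) mtcat" where
  "equivariantization G K \<T> =
    (let sh = eq_shift G K \<T>; ten = eq_tensor G K \<T>; un = eq_unit G K \<T> in
     \<lparr>Ob = equivariant_objects G K \<T>,
      Ar = eq_arrows G K \<T>,
      Dom = (\<lambda>(X, Y, f). X),
      Cod = (\<lambda>(X, Y, f). Y),
      Ide = (\<lambda>X. (X, X, Ide K (fst X))),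
      Cmp = (\<lambda>(Y', Z, g) (X, Y, f). (X, Z, g \<cdot>\<^bsub>K\<^esub> f)),
      Sh = \<lparr>FO = sh, FA = (\<lambda>(X, Y, f). (sh X, sh Y, FA (Sh K) f))\<rparr>,
      Tri = {(f, g, h). f \<in> eq_arrows G K \<T> \<and> g \<in> eq_arrows G K \<T> \<and> h \<in> eq_arrows G K \<T> \<and>
               fst (snd f) = fst g \<and> fst (snd g) = fst h \<and> fst (snd h) = sh (fst f) \<and>
               (For_ar f, For_ar g, For_ar h) \<in> Tri K},
      Zer = (\<lambda>X Y. (X, Y, Zer K (fst X) (fst Y))),
      Add = (\<lambda>(X, Y, f) (X', Y', g). (X, Y, f \<oplus>\<^sub>a\<^bsub>K\<^esub> g)),
      TO = ten,
      TA = (\<lambda>(X, Y, f) (X', Y', g). (ten X X', ten Y Y', TA K f g)),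
      Unt = un,
      Asc = (\<lambda>X Y Z. (ten (ten X Y) Z, ten X (ten Y Z), Asc K (fst X) (fst Y) (fst Z))),
      Lun = (\<lambda>X. (ten un X, X, Lun K (fst X))),
      Run = (\<lambda>X. (ten X un, X, Run K (fst X)))\<rparr>)"

text \<open>Finite direct sums are both product and coproduct; \<open>\<iota>\<close> and \<open>\<pi>\<close> are the structural
  injections and projections.\<close>

definition is_direct_sum :: "('o, 'm, 'x) tcat_scheme \<Rightarrow> 'i set \<Rightarrow> ('i \<Rightarrow> 'o) \<Rightarrow>
    'o \<Rightarrow> ('i \<Rightarrow> 'm) \<Rightarrow> ('i \<Rightarrow> 'm) \<Rightarrow> bool" where
  "is_direct_sum C N A S \<iota> \<pi> \<longleftrightarrow> S \<in> Ob C \<and>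
     (\<forall>n \<in> N. A n \<in> Ob C \<and> \<iota> n \<in> Hom C (A n) S \<and> \<pi> n \<in> Hom C S (A n)) \<and>
     (\<forall>n \<in> N. \<forall>k \<in> N. \<pi> k \<cdot>\<^bsub>C\<^esub> \<iota> n = (if n = k then Ide C (A n) else Zer C (A n) (A k))) \<and>
     (\<forall>X \<in> Ob C. \<forall>f. (\<forall>n \<in> N. f n \<in> Hom C X (A n)) \<longrightarrow>
        (\<exists>!u. u \<in> Hom C X S \<and> (\<forall>n \<in> N. \<pi> n \<cdot>\<^bsub>C\<^esub> u = f n))) \<and>
     (\<forall>X \<in> Ob C. \<forall>f. (\<forall>n \<in> N. f n \<in> Hom C (A n) X) \<longrightarrow>
        (\<exists>!u. u \<in> Hom C S X \<and> (\<forall>n \<in> N. u \<cdot>\<^bsub>C\<^esub> \<iota> n = f n)))"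

definition direct_sum :: "('o, 'm, 'x) tcat_scheme \<Rightarrow> 'i set \<Rightarrow> ('i \<Rightarrow> 'o) \<Rightarrow>
    'o \<times> ('i \<Rightarrow> 'm) \<times> ('i \<Rightarrow> 'm)" where
  "direct_sum C N A = (SOME (S, \<iota>, \<pi>). is_direct_sum C N A S \<iota> \<pi>)"

text \<open>The equivariant structure \<open>\<tau> h\<close> of \<open>Ind A\<close> is the arrow
  \<open>T h (\<Oplus>g. T g A) \<rightarrow> (\<Oplus>g. T g A)\<close> that carries the summand \<open>T h (T (h\<inverse> g) A)\<close> to the
  summand \<open>T g A\<close> by \<open>gam h (h\<inverse> g) A\<close>.\<close>

definition Ind :: "('g, 'z) monoid_scheme \<Rightarrow> ('o, 'm, 'x) mtcat_scheme \<Rightarrow>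
    ('g, 'o, 'm) act \<Rightarrow> 'o \<Rightarrow> ('g, 'o, 'm) eq_ob" where
  "Ind G K \<T> A =
    (let (S, \<iota>, \<pi>) = direct_sum K (carrier G) (\<lambda>g. FO (T \<T> g) A) in
     (S, \<lambda>h \<in> carrier G. THE t. t \<in> Hom K (FO (T \<T> h) S) S \<and>
           (\<forall>g \<in> carrier G. \<pi> g \<cdot>\<^bsub>K\<^esub> t =
              gam \<T> h (inv\<^bsub>G\<^esub> h \<otimes>\<^bsub>G\<^esub> g) A \<cdot>\<^bsub>K\<^esub> FA (T \<T> h) (\<pi> (inv\<^bsub>G\<^esub> h \<otimes>\<^bsub>G\<^esub> g)))))"

definition equivariant_ideal :: "('g, 'z) monoid_scheme \<Rightarrow> ('o, 'm, 'x) mtcat_scheme \<Rightarrow>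
    ('g, 'o, 'm) act \<Rightarrow> 'o set \<Rightarrow> ('g, 'o, 'm) eq_ob set" where
  "equivariant_ideal G K \<T> I = {X \<in> Ob (equivariantization G K \<T>). fst X \<in> I}"

definition restricted_ideal :: "('g, 'z) monoid_scheme \<Rightarrow> ('o, 'm, 'x) mtcat_scheme \<Rightarrow>
    ('g, 'o, 'm) act \<Rightarrow> ('g, 'o, 'm) eq_ob set \<Rightarrow> 'o set" where
  "restricted_ideal G K \<T> J = {A \<in> Ob K. Ind G K \<T> A \<in> J}"


section \<open>Localization of categories\<close>

text \<open>The localization of \<open>C\<close> at \<open>W\<close>: arrows are classes of zigzags, a zigzag being a list of
  steps, in order of travel, along arrows of \<open>C\<close> or backwards along arrows of \<open>W\<close>.\<close>

datatype 'm step = Fw 'm | Bw 'm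

inductive zigzag :: "('o, 'm, 'x) cat_scheme \<Rightarrow> 'm set \<Rightarrow> 'o \<Rightarrow> 'm step list \<Rightarrow> 'o \<Rightarrow> bool"
  for C W where
  zz_nil: "X \<in> Ob C \<Longrightarrow> zigzag C W X [] X"
| zz_fw: "\<lbrakk>f \<in> Hom C X Y; zigzag C W Y p Z\<rbrakk> \<Longrightarrow> zigzag C W X (Fw f # p) Z"
| zz_bw: "\<lbrakk>w \<in> W; w \<in> Hom C Y X; zigzag C W Y p Z\<rbrakk> \<Longrightarrow> zigzag C W X (Bw w # p) Z"

inductive zz_relation :: "('o, 'm, 'x) cat_scheme \<Rightarrow> 'm set \<Rightarrow> 'm step list \<Rightarrow> 'm step list \<Rightarrow> bool"
  for C W where
  "X \<in> Ob C \<Longrightarrow> zz_relation C W [Fw (Ide C X)] []"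
| "\<lbrakk>f \<in> Hom C X Y; g \<in> Hom C Y Z\<rbrakk> \<Longrightarrow> zz_relation C W [Fw f, Fw g] [Fw (g \<cdot>\<^bsub>C\<^esub> f)]"
| "\<lbrakk>w \<in> W; w \<in> Ar C\<rbrakk> \<Longrightarrow> zz_relation C W [Fw w, Bw w] []"
| "\<lbrakk>w \<in> W; w \<in> Ar C\<rbrakk> \<Longrightarrow> zz_relation C W [Bw w, Fw w] []"

definition zz_step :: "('o, 'm, 'x) cat_scheme \<Rightarrow> 'm set \<Rightarrow> 'o \<Rightarrow> 'o \<Rightarrow>
    'm step list \<Rightarrow> 'm step list \<Rightarrow> bool" where
  "zz_step C W X Y p q \<longleftrightarrow> zigzag C W X p Y \<and> zigzag C W X q Y \<and>
     (\<exists>r s a b. zz_relation C W a b \<and> p = r @ a @ s \<and> q = r @ b @ s)"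

definition zz_class :: "('o, 'm, 'x) cat_scheme \<Rightarrow> 'm set \<Rightarrow> 'o \<Rightarrow> 'o \<Rightarrow>
    'm step list \<Rightarrow> 'm step list set" where
  "zz_class C W X Y p = {q. equivclp (zz_step C W X Y) p q}"

type_synonym ('o, 'm) loc_ar = "'o \<times> 'm step list set \<times> 'o"

definition localization :: "('o, 'm, 'x) cat_scheme \<Rightarrow> 'm set \<Rightarrow> ('o, ('o, 'm) loc_ar) cat" where
  "localization C W =
     \<lparr>Ob = Ob C,
      Ar = {(X, c, Y). \<exists>p. zigzag C W X p Y \<and> c = zz_class C W X Y p},
      Dom = (\<lambda>(X, c, Y). X),
      Cod = (\<lambda>(X, c, Y). Y),
      Ide = (\<lambda>X. (X, zz_class C W X X [], X)),
      Cmp = (\<lambda>(Y', d, Z) (X, c, Y). (X, zz_class C W X Z ((SOME p. p \<in> c) @ (SOME q. q \<in> d)), Z))\<rparr>"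

definition loc_map :: "('o, 'm, 'x) cat_scheme \<Rightarrow> 'm set \<Rightarrow> 'm \<Rightarrow> ('o, 'm) loc_ar" where
  "loc_map C W f = (Dom C f, zz_class C W (Dom C f) (Cod C f) [Fw f], Cod C f)"


section \<open>Stable model categories\<close>

definition is_pushout :: "('o, 'm, 'x) cat_scheme \<Rightarrow> 'm \<Rightarrow> 'm \<Rightarrow> 'm \<Rightarrow> 'm \<Rightarrow> bool" where
  "is_pushout C f g b c \<longleftrightarrow> f \<in> Ar C \<and> g \<in> Ar C \<and> b \<in> Ar C \<and> c \<in> Ar C \<and>
     Dom C f = Dom C g \<and> Dom C b = Cod C f \<and> Dom C c = Cod C g \<and> Cod C b = Cod C c \<and>
     b \<cdot>\<^bsub>C\<^esub> f = c \<cdot>\<^bsub>C\<^esub> g \<and>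
     (\<forall>X. \<forall>s \<in> Hom C (Cod C f) X. \<forall>t \<in> Hom C (Cod C g) X. s \<cdot>\<^bsub>C\<^esub> f = t \<cdot>\<^bsub>C\<^esub> g \<longrightarrow>
        (\<exists>!u. u \<in> Hom C (Cod C b) X \<and> u \<cdot>\<^bsub>C\<^esub> b = s \<and> u \<cdot>\<^bsub>C\<^esub> c = t))"

definition is_pullback :: "('o, 'm, 'x) cat_scheme \<Rightarrow> 'm \<Rightarrow> 'm \<Rightarrow> 'm \<Rightarrow> 'm \<Rightarrow> bool" where
  "is_pullback C f g b c \<longleftrightarrow> f \<in> Ar C \<and> g \<in> Ar C \<and> b \<in> Ar C \<and> c \<in> Ar C \<and>
     Cod C f = Cod C g \<and> Cod C b = Dom C f \<and> Cod C c = Dom C g \<and> Dom C b = Dom C c \<and>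
     f \<cdot>\<^bsub>C\<^esub> b = g \<cdot>\<^bsub>C\<^esub> c \<and>
     (\<forall>X. \<forall>s \<in> Hom C X (Dom C f). \<forall>t \<in> Hom C X (Dom C g). f \<cdot>\<^bsub>C\<^esub> s = g \<cdot>\<^bsub>C\<^esub> t \<longrightarrow>
        (\<exists>!u. u \<in> Hom C X (Dom C b) \<and> b \<cdot>\<^bsub>C\<^esub> u = s \<and> c \<cdot>\<^bsub>C\<^esub> u = t))"

definition is_retract :: "('o, 'm, 'x) cat_scheme \<Rightarrow> 'm \<Rightarrow> 'm \<Rightarrow> bool" where
  "is_retract C f g \<longleftrightarrow> f \<in> Ar C \<and> g \<in> Ar C \<and>
     (\<exists>a \<in> Hom C (Dom C f) (Dom C g). \<exists>r \<in> Hom C (Dom C g) (Dom C f).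
      \<exists>b \<in> Hom C (Cod C f) (Cod C g). \<exists>s \<in> Hom C (Cod C g) (Cod C f).
        r \<cdot>\<^bsub>C\<^esub> a = Ide C (Dom C f) \<and> s \<cdot>\<^bsub>C\<^esub> b = Ide C (Cod C f) \<and>
        g \<cdot>\<^bsub>C\<^esub> a = b \<cdot>\<^bsub>C\<^esub> f \<and> f \<cdot>\<^bsub>C\<^esub> r = s \<cdot>\<^bsub>C\<^esub> g)"

record ('o, 'm) mcat = "('o, 'm) cat" +
  Weq :: "'m set"
  Cof :: "'m set"
  Fib :: "'m set"

text \<open>Quillen's closed model categories.  As in Quillen's definition only finite limits and
  colimits are required (given by initial and terminal objects, pushouts and pullbacks) and
  factorizations need not be functorial; all later variants are instances.\<close>

locale model_category = category M
  for M :: "('o, 'm, 'x) mcat_scheme" (structure) +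
  assumes classes: "Weq M \<subseteq> Ar M" "Cof M \<subseteq> Ar M" "Fib M \<subseteq> Ar M"
    and initial: "\<exists>Z. is_initial M Z"
    and terminal: "\<exists>Z. is_terminal M Z"
    and pushouts: "\<lbrakk>f \<in> Hom M A X; g \<in> Hom M A Y\<rbrakk> \<Longrightarrow> \<exists>b c. is_pushout M f g b c"
    and pullbacks: "\<lbrakk>f \<in> Hom M X A; g \<in> Hom M Y A\<rbrakk> \<Longrightarrow> \<exists>b c. is_pullback M f g b c"
    and two_of_three: "\<lbrakk>f \<in> Hom M X Y; g \<in> Hom M Y Z\<rbrakk> \<Longrightarrow>
          (f \<in> Weq M \<and> g \<in> Weq M \<longrightarrow> g \<cdot> f \<in> Weq M) \<and>
          (f \<in> Weq M \<and> g \<cdot> f \<in> Weq M \<longrightarrow> g \<in> Weq M) \<and>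
          (g \<in> Weq M \<and> g \<cdot> f \<in> Weq M \<longrightarrow> f \<in> Weq M)"
    and retracts: "is_retract M f g \<Longrightarrow>
          (g \<in> Weq M \<longrightarrow> f \<in> Weq M) \<and> (g \<in> Cof M \<longrightarrow> f \<in> Cof M) \<and> (g \<in> Fib M \<longrightarrow> f \<in> Fib M)"
    and lifting: "\<lbrakk>i \<in> Cof M; p \<in> Fib M; i \<in> Weq M \<or> p \<in> Weq M;
          u \<in> Hom M (Dom M i) (Dom M p); v \<in> Hom M (Cod M i) (Cod M p); p \<cdot> u = v \<cdot> i\<rbrakk>
          \<Longrightarrow> \<exists>h \<in> Hom M (Cod M i) (Dom M p). h \<cdot> i = u \<and> p \<cdot> h = v"
    and factorization_1: "f \<in> Ar M \<Longrightarrow>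
          \<exists>i p. i \<in> Cof M \<inter> Weq M \<and> p \<in> Fib M \<and> Cod M i = Dom M p \<and> f = p \<cdot> i"
    and factorization_2: "f \<in> Ar M \<Longrightarrow>
          \<exists>i p. i \<in> Cof M \<and> p \<in> Fib M \<inter> Weq M \<and> Cod M i = Dom M p \<and> f = p \<cdot> i"

locale pointed_model_category = model_category M
  for M :: "('o, 'm, 'x) mcat_scheme" (structure) +
  assumes pointed: "\<exists>Z. is_zero M Z"

definition zero_ar :: "('o, 'm, 'x) cat_scheme \<Rightarrow> 'm \<Rightarrow> bool" where
  "zero_ar C f \<longleftrightarrow> (\<exists>Z a b. is_zero C Z \<and> a \<in> Hom C (Dom C f) Z \<and> b \<in> Hom C Z (Cod C f) \<and>
     f = b \<cdot>\<^bsub>C\<^esub> a)"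

definition is_cokernel :: "('o, 'm, 'x) cat_scheme \<Rightarrow> 'm \<Rightarrow> 'm \<Rightarrow> bool" where
  "is_cokernel C i q \<longleftrightarrow> i \<in> Ar C \<and> q \<in> Ar C \<and> Cod C i = Dom C q \<and> zero_ar C (q \<cdot>\<^bsub>C\<^esub> i) \<and>
     (\<forall>t \<in> Ar C. Dom C t = Cod C i \<longrightarrow> zero_ar C (t \<cdot>\<^bsub>C\<^esub> i) \<longrightarrow>
        (\<exists>!u. u \<in> Hom C (Cod C q) (Cod C t) \<and> u \<cdot>\<^bsub>C\<^esub> q = t))"

definition cofibrant :: "('o, 'm, 'x) mcat_scheme \<Rightarrow> 'o \<Rightarrow> bool" where
  "cofibrant M A \<longleftrightarrow> A \<in> Ob M \<and> (\<forall>Z. is_initial M Z \<longrightarrow> Hom M Z A \<subseteq> Cof M)"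

text \<open>\<open>cofiber M i q\<close>: \<open>i : A \<rightarrow> B\<close> is a cofibration with cofibrant source and
  \<open>q : B \<rightarrow> B/A\<close> its quotient; \<open>cone M i q\<close>: moreover \<open>B\<close> is weakly contractible, so that
  \<open>B/A\<close> is a suspension of \<open>A\<close>.\<close>

definition cofiber :: "('o, 'm, 'x) mcat_scheme \<Rightarrow> 'm \<Rightarrow> 'm \<Rightarrow> bool" where
  "cofiber M i q \<longleftrightarrow> i \<in> Cof M \<and> cofibrant M (Dom M i) \<and> is_cokernel M i q"

definition cone :: "('o, 'm, 'x) mcat_scheme \<Rightarrow> 'm \<Rightarrow> 'm \<Rightarrow> bool" where
  "cone M i q \<longleftrightarrow> cofiber M i q \<and> (\<forall>Z. is_terminal M Z \<longrightarrow> Hom M (Cod M i) Z \<subseteq> Weq M)"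

abbreviation Ho :: "('o, 'm, 'x) mcat_scheme \<Rightarrow> ('o, ('o, 'm) loc_ar) cat" where
  "Ho M \<equiv> localization M (Weq M)"

abbreviation to_Ho :: "('o, 'm, 'x) mcat_scheme \<Rightarrow> 'm \<Rightarrow> ('o, 'm) loc_ar" where
  "to_Ho M \<equiv> loc_map M (Weq M)"

text \<open>\<open>S\<close> is the suspension functor on the homotopy category: it comes with isomorphisms
  \<open>\<sigma> i q : S A \<cong> CA/A\<close> for all cones \<open>i : A \<rightarrow> CA\<close> with quotient \<open>q\<close>, natural in the
  cone.  Since every map of cofibrant objects extends to a map of suitable cones, this determines
  \<open>S\<close> up to unique compatible isomorphism.\<close>

definition suspension :: "('o, 'm, 'x) mcat_scheme \<Rightarrow>
    ('o, ('o, 'm) loc_ar, 'o, ('o, 'm) loc_ar) funct \<Rightarrow> ('m \<Rightarrow> 'm \<Rightarrow> ('o, 'm) loc_ar) \<Rightarrow> bool" where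
  "suspension M S \<sigma> \<longleftrightarrow> cat_functor (Ho M) (Ho M) S \<and>
     (\<forall>i q. cone M i q \<longrightarrow>
        \<sigma> i q \<in> Hom (Ho M) (FO S (Dom M i)) (Cod M q) \<and> is_iso (Ho M) (\<sigma> i q)) \<and>
     (\<forall>i q i' q' a c s. cone M i q \<and> cone M i' q' \<and>
        a \<in> Hom M (Dom M i) (Dom M i') \<and> c \<in> Hom M (Cod M i) (Cod M i') \<and>
        s \<in> Hom M (Cod M q) (Cod M q') \<and>
        c \<cdot>\<^bsub>M\<^esub> i = i' \<cdot>\<^bsub>M\<^esub> a \<and> s \<cdot>\<^bsub>M\<^esub> q = q' \<cdot>\<^bsub>M\<^esub> c \<longrightarrow>
        to_Ho M s \<cdot>\<^bsub>Ho M\<^esub> \<sigma> i q = \<sigma> i' q' \<cdot>\<^bsub>Ho M\<^esub> FA S (to_Ho M a))"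

text \<open>Stability: the suspension functor is an equivalence of the homotopy category.\<close>

definition stable_model_category :: "('o, 'm, 'x) mcat_scheme \<Rightarrow>
    ('o, ('o, 'm) loc_ar, 'o, ('o, 'm) loc_ar) funct \<Rightarrow> ('m \<Rightarrow> 'm \<Rightarrow> ('o, 'm) loc_ar) \<Rightarrow> bool" where
  "stable_model_category M S \<sigma> \<longleftrightarrow> pointed_model_category M \<and> suspension M S \<sigma> \<and>
     cat_equivalence (Ho M) (Ho M) S"

text \<open>The triangle of a cofibration \<open>i : A \<rightarrow> B\<close> between cofibrant objects with quotient
  \<open>q : B \<rightarrow> B/A\<close>.  With a cone \<open>j : A \<rightarrow> CA\<close>, \<open>r : CA \<rightarrow> CA/A\<close> and the mapping cone
  \<open>P\<close>, the pushout of \<open>i\<close> and \<open>j\<close>, the connecting arrow \<open>h : B/A \<rightarrow> S A\<close> is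
  \<open>B/A \<leftarrow> P \<rightarrow> CA/A \<cong> S A\<close>, where \<open>u : P \<rightarrow> B/A\<close> (a weak equivalence) collapses \<open>CA\<close>
  and \<open>v : P \<rightarrow> CA/A\<close> collapses \<open>B\<close>.  Other sign conventions for \<open>h\<close> give an equivalent
  triangulated category.\<close>

definition cofiber_triangle :: "('o, 'm, 'x) mcat_scheme \<Rightarrow>
    ('o, ('o, 'm) loc_ar, 'o, ('o, 'm) loc_ar) funct \<Rightarrow> ('m \<Rightarrow> 'm \<Rightarrow> ('o, 'm) loc_ar) \<Rightarrow>
    ('o, 'm) loc_ar \<times> ('o, 'm) loc_ar \<times> ('o, 'm) loc_ar \<Rightarrow> bool" where
  "cofiber_triangle M S \<sigma> t \<longleftrightarrow>
     (\<exists>i q j r b c u v h. t = (to_Ho M i, to_Ho M q, h) \<and>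
        cofiber M i q \<and> cone M j r \<and> is_pushout M i j b c \<and>
        u \<in> Hom M (Cod M b) (Cod M q) \<and> u \<cdot>\<^bsub>M\<^esub> b = q \<and> zero_ar M (u \<cdot>\<^bsub>M\<^esub> c) \<and>
        v \<in> Hom M (Cod M b) (Cod M r) \<and> zero_ar M (v \<cdot>\<^bsub>M\<^esub> b) \<and> v \<cdot>\<^bsub>M\<^esub> c = r \<and>
        h \<in> Hom (Ho M) (Cod M q) (FO S (Dom M i)) \<and>
        \<sigma> j r \<cdot>\<^bsub>Ho M\<^esub> (h \<cdot>\<^bsub>Ho M\<^esub> to_Ho M u) = to_Ho M v)"

definition triangulated_Ho :: "('o, 'm, 'x) mcat_scheme \<Rightarrow>
    ('o, ('o, 'm) loc_ar, 'o, ('o, 'm) loc_ar) funct \<Rightarrow> ('m \<Rightarrow> 'm \<Rightarrow> ('o, 'm) loc_ar) \<Rightarrow>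
    ('o, ('o, 'm) loc_ar) scat" where
  "triangulated_Ho M S \<sigma> = cat.extend (Ho M)
     \<lparr>Sh = S,
      Tri = {t. is_triangle (Ho M) S t \<and>
               (\<exists>t'. cofiber_triangle M S \<sigma> t' \<and> iso_triangles (Ho M) S t' t)}\<rparr>"

definition homotopy_category_of_stable_model_category ::
    "('p, 'n, 'y) scat_scheme \<Rightarrow> ('o, 'm, 'x) mcat_scheme \<Rightarrow> bool" where
  "homotopy_category_of_stable_model_category K M \<longleftrightarrow>
     (\<exists>S \<sigma> F \<theta>. stable_model_category M S \<sigma> \<and> triangle_equivalence (triangulated_Ho M S \<sigma>) K F \<theta>)"


section \<open>DG enhancements\<close>

text \<open>DG categories over the integers (forgetting scalars, any DG category is one), with
  cohomological grading: \<open>DHom D n X Y\<close> is the degree \<open>n\<close> part of the Hom complex.\<close>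

record ('d, 'n) dgcat =
  DOb :: "'d set"
  DHom :: "int \<Rightarrow> 'd \<Rightarrow> 'd \<Rightarrow> 'n set"
  DZer :: "int \<Rightarrow> 'd \<Rightarrow> 'd \<Rightarrow> 'n"
  DAdd :: "'n \<Rightarrow> 'n \<Rightarrow> 'n"  (infixl "\<oplus>\<^sub>d\<index>" 65)
  Dif :: "'n \<Rightarrow> 'n"
  DIde :: "'d \<Rightarrow> 'n"
  DCmp :: "'n \<Rightarrow> 'n \<Rightarrow> 'n"  (infixl "\<star>\<index>" 70)

definition dg_group :: "('d, 'n, 'x) dgcat_scheme \<Rightarrow> int \<Rightarrow> 'd \<Rightarrow> 'd \<Rightarrow> 'n monoid" where
  "dg_group D n X Y = \<lparr>carrier = DHom D n X Y, mult = DAdd D, one = DZer D n X Y\<rparr>"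

definition closed_hom :: "('d, 'n, 'x) dgcat_scheme \<Rightarrow> int \<Rightarrow> 'd \<Rightarrow> 'd \<Rightarrow> 'n set" where
  "closed_hom D n X Y = {f \<in> DHom D n X Y. Dif D f = DZer D (n + 1) X Y}"

locale dg_category =
  fixes D :: "('d, 'n, 'x) dgcat_scheme" (structure)
  assumes dg_comm_group: "\<lbrakk>X \<in> DOb D; Y \<in> DOb D\<rbrakk> \<Longrightarrow> comm_group (dg_group D n X Y)"
    and DIde_Hom: "X \<in> DOb D \<Longrightarrow> DIde D X \<in> DHom D 0 X X"
    and DCmp_Hom: "\<lbrakk>X \<in> DOb D; Y \<in> DOb D; Z \<in> DOb D; f \<in> DHom D n X Y; g \<in> DHom D m Y Z\<rbrakk>
          \<Longrightarrow> g \<star> f \<in> DHom D (m + n) X Z"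
    and DCmp_DIde: "\<lbrakk>X \<in> DOb D; Y \<in> DOb D; f \<in> DHom D n X Y\<rbrakk> \<Longrightarrow> f \<star> DIde D X = f"
    and DIde_DCmp: "\<lbrakk>X \<in> DOb D; Y \<in> DOb D; f \<in> DHom D n X Y\<rbrakk> \<Longrightarrow> DIde D Y \<star> f = f"
    and DCmp_assoc: "\<lbrakk>X \<in> DOb D; Y \<in> DOb D; Z \<in> DOb D; U \<in> DOb D;
            f \<in> DHom D n X Y; g \<in> DHom D m Y Z; h \<in> DHom D l Z U\<rbrakk>
          \<Longrightarrow> (h \<star> g) \<star> f = h \<star> (g \<star> f)"
    and DCmp_DAdd_right: "\<lbrakk>X \<in> DOb D; Y \<in> DOb D; Z \<in> DOb D;
            f \<in> DHom D n X Y; f' \<in> DHom D n X Y; g \<in> DHom D m Y Z\<rbrakk>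
          \<Longrightarrow> g \<star> (f \<oplus>\<^sub>d f') = (g \<star> f) \<oplus>\<^sub>d (g \<star> f')"
    and DCmp_DAdd_left: "\<lbrakk>X \<in> DOb D; Y \<in> DOb D; Z \<in> DOb D;
            f \<in> DHom D n X Y; g \<in> DHom D m Y Z; g' \<in> DHom D m Y Z\<rbrakk>
          \<Longrightarrow> (g \<oplus>\<^sub>d g') \<star> f = (g \<star> f) \<oplus>\<^sub>d (g' \<star> f)"
    and Dif_Hom: "\<lbrakk>X \<in> DOb D; Y \<in> DOb D; f \<in> DHom D n X Y\<rbrakk> \<Longrightarrow> Dif D f \<in> DHom D (n + 1) X Y"
    and Dif_DAdd: "\<lbrakk>X \<in> DOb D; Y \<in> DOb D; f \<in> DHom D n X Y; f' \<in> DHom D n X Y\<rbrakk>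
          \<Longrightarrow> Dif D (f \<oplus>\<^sub>d f') = Dif D f \<oplus>\<^sub>d Dif D f'"
    and Dif_Dif: "\<lbrakk>X \<in> DOb D; Y \<in> DOb D; f \<in> DHom D n X Y\<rbrakk>
          \<Longrightarrow> Dif D (Dif D f) = DZer D (n + 2) X Y"
    and Leibniz: "\<lbrakk>X \<in> DOb D; Y \<in> DOb D; Z \<in> DOb D; f \<in> DHom D n X Y; g \<in> DHom D m Y Z\<rbrakk>
          \<Longrightarrow> Dif D (g \<star> f) = (Dif D g \<star> f) \<oplus>\<^sub>d
                (if even m then g \<star> Dif D f else inv\<^bsub>dg_group D (m + n + 1) X Z\<^esub> (g \<star> Dif D f))"

text \<open>\<open>dg_shift_of D X Y u v\<close>: \<open>Y = X[1]\<close>, via the closed degree \<open>1\<close> isomorphism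
  \<open>u : Y \<rightarrow> X\<close> with inverse \<open>v\<close>.\<close>

definition dg_shift_of :: "('d, 'n, 'x) dgcat_scheme \<Rightarrow> 'd \<Rightarrow> 'd \<Rightarrow> 'n \<Rightarrow> 'n \<Rightarrow> bool" where
  "dg_shift_of D X Y u v \<longleftrightarrow> X \<in> DOb D \<and> Y \<in> DOb D \<and>
     u \<in> closed_hom D 1 Y X \<and> v \<in> closed_hom D (-1) X Y \<and>
     u \<star>\<^bsub>D\<^esub> v = DIde D X \<and> v \<star>\<^bsub>D\<^esub> u = DIde D Y"

text \<open>\<open>E\<close> is the cone of \<open>f : X \<rightarrow> Y\<close>, that is, \<open>X[1] \<oplus> Y\<close> with the differential twisted by
  \<open>f\<close>: here \<open>i : Y \<rightarrow> E\<close>, \<open>s : E \<rightarrow> Y\<close> have degree \<open>0\<close>, and \<open>p : E \<rightarrow> X\<close>,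
  \<open>j : X \<rightarrow> E\<close> have degree \<open>1\<close> and \<open>-1\<close>.\<close>

definition dg_cone :: "('d, 'n, 'x) dgcat_scheme \<Rightarrow> 'd \<Rightarrow> 'd \<Rightarrow> 'n \<Rightarrow> 'd \<Rightarrow>
    'n \<Rightarrow> 'n \<Rightarrow> 'n \<Rightarrow> 'n \<Rightarrow> bool" where
  "dg_cone D X Y f E i s p j \<longleftrightarrow> X \<in> DOb D \<and> Y \<in> DOb D \<and> E \<in> DOb D \<and>
     f \<in> closed_hom D 0 X Y \<and>
     i \<in> closed_hom D 0 Y E \<and> p \<in> closed_hom D 1 E X \<and>
     s \<in> DHom D 0 E Y \<and> j \<in> DHom D (-1) X E \<and>
     p \<star>\<^bsub>D\<^esub> j = DIde D X \<and> s \<star>\<^bsub>D\<^esub> i = DIde D Y \<and>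
     p \<star>\<^bsub>D\<^esub> i = DZer D 1 Y X \<and> s \<star>\<^bsub>D\<^esub> j = DZer D (-1) X Y \<and>
     (j \<star>\<^bsub>D\<^esub> p) \<oplus>\<^sub>d\<^bsub>D\<^esub> (i \<star>\<^bsub>D\<^esub> s) = DIde D E \<and>
     Dif D j = i \<star>\<^bsub>D\<^esub> f \<and> Dif D s = inv\<^bsub>dg_group D 1 E Y\<^esub> (f \<star>\<^bsub>D\<^esub> p)"

locale pretriangulated_dg_category = dg_category D
  for D :: "('d, 'n, 'x) dgcat_scheme" (structure) +
  assumes nonempty: "DOb D \<noteq> {}"
    and shifts: "X \<in> DOb D \<Longrightarrow> \<exists>Y u v. dg_shift_of D X Y u v"
    and unshifts: "Y \<in> DOb D \<Longrightarrow> \<exists>X u v. dg_shift_of D X Y u v"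
    and cones: "\<lbrakk>X \<in> DOb D; Y \<in> DOb D; f \<in> closed_hom D 0 X Y\<rbrakk>
          \<Longrightarrow> \<exists>E i s p j. dg_cone D X Y f E i s p j"

definition dg_class :: "('d, 'n, 'x) dgcat_scheme \<Rightarrow> 'd \<Rightarrow> 'd \<Rightarrow> 'n \<Rightarrow> 'n set" where
  "dg_class D X Y f = {f \<oplus>\<^sub>d\<^bsub>D\<^esub> Dif D h | h. h \<in> DHom D (-1) X Y}"

definition H0 :: "('d, 'n, 'x) dgcat_scheme \<Rightarrow> ('d, 'd \<times> 'n set \<times> 'd) cat" where
  "H0 D =
     \<lparr>Ob = DOb D,
      Ar = {(X, c, Y). X \<in> DOb D \<and> Y \<in> DOb D \<and> (\<exists>f \<in> closed_hom D 0 X Y. c = dg_class D X Y f)},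
      Dom = (\<lambda>(X, c, Y). X),
      Cod = (\<lambda>(X, c, Y). Y),
      Ide = (\<lambda>X. (X, dg_class D X X (DIde D X), X)),
      Cmp = (\<lambda>(Y', d, Z) (X, c, Y). (X, dg_class D X Z ((SOME g. g \<in> d) \<star>\<^bsub>D\<^esub> (SOME f. f \<in> c)), Z))\<rparr>"

text \<open>The triangulated structure of the homotopy category of \<open>D\<close> for a choice \<open>X \<mapsto> s X\<close> of
  shifts, with \<open>u X : s X \<rightarrow> X\<close> and \<open>v X : X \<rightarrow> s X\<close>.\<close>

definition H0_shift :: "('d, 'n, 'x) dgcat_scheme \<Rightarrow> ('d \<Rightarrow> 'd) \<Rightarrow> ('d \<Rightarrow> 'n) \<Rightarrow> ('d \<Rightarrow> 'n) \<Rightarrow>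
    ('d, 'd \<times> 'n set \<times> 'd, 'd, 'd \<times> 'n set \<times> 'd) funct" where
  "H0_shift D s u v =
     \<lparr>FO = s,
      FA = (\<lambda>(X, c, Y). (s X, dg_class D (s X) (s Y) (v Y \<star>\<^bsub>D\<^esub> (SOME f. f \<in> c) \<star>\<^bsub>D\<^esub> u X), s Y))\<rparr>"

definition triangulated_H0 :: "('d, 'n, 'x) dgcat_scheme \<Rightarrow> ('d \<Rightarrow> 'd) \<Rightarrow> ('d \<Rightarrow> 'n) \<Rightarrow> ('d \<Rightarrow> 'n) \<Rightarrow>
    ('d, 'd \<times> 'n set \<times> 'd) scat" where
  "triangulated_H0 D s u v = cat.extend (H0 D)
     \<lparr>Sh = H0_shift D s u v,
      Tri = {t. is_triangle (H0 D) (H0_shift D s u v) t \<and>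
               (\<exists>X Y f E i r p j. dg_cone D X Y f E i r p j \<and>
                  iso_triangles (H0 D) (H0_shift D s u v)
                    ((X, dg_class D X Y f, Y), (Y, dg_class D Y E i, E),
                     (E, dg_class D E (s X) (v X \<star>\<^bsub>D\<^esub> p), s X)) t)}\<rparr>"

definition dg_enhancement :: "('p, 'n, 'y) scat_scheme \<Rightarrow> ('d, 'l, 'x) dgcat_scheme \<Rightarrow> bool" where
  "dg_enhancement K D \<longleftrightarrow> pretriangulated_dg_category D \<and>
     (\<exists>s u v F \<theta>. (\<forall>X \<in> DOb D. dg_shift_of D X (s X) (u X) (v X)) \<and>
        triangle_equivalence (triangulated_H0 D s u v) K F \<theta>)"

end

theory Submission
  imports Defs
begin

text \<open>An object \<open>X = (A, \<phi>)\<close> of \<open>K\<^sup>G\<close> comes with equivariant arrows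
  \<open>\<epsilon> : Ind A \<rightarrow> X\<close> and \<open>\<eta> : X \<rightarrow> Ind A\<close>, the counit and the unit of the two adjunctions
  between \<open>Ind\<close> and the forgetful functor. The heart of the matter is that a thick ideal \<open>J\<close> of
  \<open>K\<^sup>G\<close> contains \<open>X\<close> if and only if it contains \<open>Ind A\<close>; this is
  \<open>(J \<inter> K)\<^sup>G = J\<close>.

  If \<open>X \<in> J\<close>, then \<open>Ind A \<in> J\<close> by the projection formula: \<open>Ind A\<close> is a direct summand
  of \<open>X \<otimes> Ind 1\<close>.

  The converse is \<open>mem_if_induced_mem\<close>. The arrows \<open>\<epsilon>\<close> and \<open>\<eta>\<close> split in \<open>K\<close>, but in
  general not in \<open>K\<^sup>G\<close>. The kernel \<open>N\<close> of \<open>\<epsilon>\<close> and the cokernel \<open>C\<close> of \<open>\<eta>\<close>, formed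
  in \<open>K\<close>, inherit equivariant structures, and \<open>N \<rightarrow> Ind A \<rightarrow> X \<rightarrow> \<Sigma>N\<close> with last arrow zero is a
  triangle of \<open>K\<^sup>G\<close>, because triangles are detected in \<open>K\<close>. By the octahedral axiom the composite
  \<open>\<eta> \<epsilon> : Ind A \<rightarrow> Ind A\<close> has cone \<open>\<Sigma>N \<oplus> C\<close> in \<open>K\<close>, in such a way that all arrows of the
  triangle are equivariant. So \<open>\<Sigma>N\<close> is a direct summand, in \<open>K\<^sup>G\<close>, of a cone of an arrow between
  objects of \<open>J\<close>. Hence \<open>N \<in> J\<close>, and therefore \<open>X \<in> J\<close>.

  That \<open>J \<inter> K\<close> is a \<open>G\<close>-ideal rests on three facts. \<open>Ind\<close> is exact, since a finite direct sum of
  triangles is a triangle (\<open>direct_sum_triangle\<close>). The underlying object of every object of \<open>J\<close> lies in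
  \<open>J \<inter> K\<close>, by the projection formula; for \<open>A \<in> J \<inter> K\<close> this gives \<open>T g A \<in> J \<inter> K\<close>, since
  \<open>T g A\<close> is a summand of the object underlying \<open>Ind A\<close>. And \<open>Ind (A \<otimes> B)\<close> is a direct summand
  of \<open>Ind A \<otimes> Ind B\<close>. Summands of this kind are produced by \<open>induced_retract\<close> from families of arrows
  \<open>T g B \<rightarrow> Y\<close> and \<open>Y \<rightarrow> T g B\<close>, and a retract in \<open>K\<^sup>G\<close> is a direct summand because its
  complement in \<open>K\<close> is equivariant (\<open>eq_retract_direct_summand\<close>).

  The equality \<open>I\<^sup>G \<inter> K = I\<close> says that a \<open>G\<close>-ideal contains \<open>A\<close> if and only if it contains
  the sum of all \<open>T g A\<close>, of which \<open>A\<close> is a direct summand. The bijection preserves and reflects inclusions, and also inclusions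
  \<open>I \<otimes> I' \<subseteq> P\<close> because \<open>Ind A \<otimes> Ind B\<close> has the summand \<open>Ind (A \<otimes> B)\<close>; so primes
  correspond to primes. It is a homeomorphism because \<open>A \<in> J \<inter> K\<close> means \<open>Ind A \<in> J\<close> and
  \<open>(A, \<phi>) \<in> I\<^sup>G\<close> means \<open>A \<in> I\<close>: the preimage of the closed set of a collection of objects is the
  closed set of its image under \<open>Ind\<close> or under the forgetful functor.\<close>

section \<open>Arrows, isomorphisms and equivalences\<close>

text \<open>Typing of arrows is handled by rewriting: with domain and codomain equations as simplification
  rules, composites are brought into right-nested form without exhibiting Hom sets.\<close>

context category
begin

lemma Ar_Hom: "f \<in> Ar C \<Longrightarrow> f \<in> Hom C (Dom C f) (Cod C f)"
  by (simp add: Hom_def)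

lemma Cmp_typing [simp]:
  assumes "f \<in> Ar C" "g \<in> Ar C" "Dom C g = Cod C f"
  shows "g \<cdot> f \<in> Ar C" "Dom C (g \<cdot> f) = Dom C f" "Cod C (g \<cdot> f) = Cod C g"
  using Cmp_Hom[of f "Dom C f" "Cod C f" g "Cod C g"] assms by (auto simp: Hom_def)

lemma Ide_typing [simp]:
  assumes "X \<in> Ob C"
  shows "Ide C X \<in> Ar C" "Dom C (Ide C X) = X" "Cod C (Ide C X) = X"
  using Ide_Hom[OF assms] by (auto simp: Hom_def)

lemma Dom_Ob' [simp]: "f \<in> Ar C \<Longrightarrow> Dom C f \<in> Ob C"
  and Cod_Ob' [simp]: "f \<in> Ar C \<Longrightarrow> Cod C f \<in> Ob C"
  by (simp_all add: Dom_Ob Cod_Ob)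

lemma Cmp_Ide' [simp]: "f \<in> Ar C \<Longrightarrow> Dom C f = X \<Longrightarrow> f \<cdot> Ide C X = f"
  and Ide_Cmp' [simp]: "f \<in> Ar C \<Longrightarrow> Cod C f = X \<Longrightarrow> Ide C X \<cdot> f = f"
  by (metis Ar_Hom Cmp_Ide) (metis Ar_Hom Ide_Cmp)

lemma Cmp_assoc' [simp]:
  assumes "f \<in> Ar C" "g \<in> Ar C" "h \<in> Ar C" "Dom C g = Cod C f" "Dom C h = Cod C g"
  shows "(h \<cdot> g) \<cdot> f = h \<cdot> (g \<cdot> f)"
  using assms by (metis Ar_Hom Cmp_assoc)

lemma Hom_Ob: "f \<in> Hom C X Y \<Longrightarrow> X \<in> Ob C \<and> Y \<in> Ob C"
  by (auto simp: Hom_def)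

lemma Hom_rules:
  assumes "f \<in> Hom C X Y"
  shows "f \<in> Ar C" "Dom C f = X" "Cod C f = Y"
  using assms by (auto simp: Hom_def)

lemma Cmp_rewrite:
  assumes "f \<cdot> g = h" and "f \<in> Ar C" "g \<in> Ar C" "Dom C f = Cod C g"
    and "x \<in> Ar C" "Cod C x = Dom C g"
  shows "f \<cdot> (g \<cdot> x) = h \<cdot> x"
  using assms by (metis Cmp_assoc')

lemma is_iso_iff:
  "is_iso C f \<longleftrightarrow> f \<in> Ar C \<and> (\<exists>g \<in> Ar C. Dom C g = Cod C f \<and> Cod C g = Dom C f \<and>
     g \<cdot> f = Ide C (Dom C f) \<and> f \<cdot> g = Ide C (Cod C f))"
  by (auto simp: is_iso_def inverse_arrows_def Hom_def)

lemma is_isoI: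
  assumes "f \<in> Hom C X Y" "g \<in> Hom C Y X" "g \<cdot> f = Ide C X" "f \<cdot> g = Ide C Y"
  shows "is_iso C f"
  using assms by (auto simp: is_iso_iff Hom_def)

lemma is_iso_Ar: "is_iso C f \<Longrightarrow> f \<in> Ar C"
  by (simp add: is_iso_iff)

lemma inverse_unique:
  assumes "inverse_arrows C f g" "inverse_arrows C f h"
  shows "g = h"
proof -
  have t: "f \<in> Ar C" "g \<in> Ar C" "h \<in> Ar C" "Dom C g = Cod C f" "Cod C g = Dom C f"
    "Dom C h = Cod C f" "Cod C h = Dom C f" "g \<cdot> f = Ide C (Dom C f)" "f \<cdot> h = Ide C (Cod C f)"
    using assms by (auto simp: inverse_arrows_def Hom_def)
  have "g = g \<cdot> (f \<cdot> h)" using t by simp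
  also have "\<dots> = (g \<cdot> f) \<cdot> h" using t(1-7) by simp
  also have "\<dots> = h" using t by simp
  finally show ?thesis .
qed

lemma inverse_arrows_inv: "is_iso C f \<Longrightarrow> inverse_arrows C f (inv_ar C f)"
  unfolding inv_ar_def is_iso_def by (metis inverse_unique theI)

lemma inv_typing [simp]:
  assumes "is_iso C f"
  shows "inv_ar C f \<in> Ar C" "Dom C (inv_ar C f) = Cod C f" "Cod C (inv_ar C f) = Dom C f"
    "inv_ar C f \<cdot> f = Ide C (Dom C f)" "f \<cdot> inv_ar C f = Ide C (Cod C f)"
  using inverse_arrows_inv[OF assms] by (auto simp: inverse_arrows_def Hom_def)

lemma inv_cancel [simp]:
  assumes "is_iso C f" "x \<in> Ar C"
  shows "Cod C x = Dom C f \<Longrightarrow> inv_ar C f \<cdot> (f \<cdot> x) = x"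
    and "Cod C x = Cod C f \<Longrightarrow> f \<cdot> (inv_ar C f \<cdot> x) = x"
  using assms is_iso_Ar[OF assms(1)] by (metis Cmp_assoc' Ide_Cmp' inv_typing)+

lemma is_iso_inv [simp]: "is_iso C f \<Longrightarrow> is_iso C (inv_ar C f)"
  using is_iso_Ar[of f] by (auto simp: is_iso_iff[of "inv_ar C f"] intro!: bexI[of _ f])

lemma is_iso_Ide [simp]: "X \<in> Ob C \<Longrightarrow> is_iso C (Ide C X)"
  by (auto simp: is_iso_iff intro!: bexI[of _ "Ide C X"])

lemma is_iso_Cmp [simp]:
  assumes "is_iso C f" "is_iso C g" "Dom C g = Cod C f"
  shows "is_iso C (g \<cdot> f)"
  using assms is_iso_Ar[OF assms(1)] is_iso_Ar[OF assms(2)]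
  by (auto simp: is_iso_iff[of "g \<cdot> f"] intro!: bexI[of _ "inv_ar C f \<cdot> inv_ar C g"])

lemma iso_cancel_left:
  assumes "is_iso C f" "f \<cdot> x = f \<cdot> y" "x \<in> Ar C" "y \<in> Ar C" "Cod C x = Dom C f" "Cod C y = Dom C f"
  shows "x = y"
  using assms by (metis inv_cancel(1))

lemma iso_cancel_right:
  assumes "is_iso C f" "x \<cdot> f = y \<cdot> f" "x \<in> Ar C" "y \<in> Ar C" "Dom C x = Cod C f" "Dom C y = Cod C f"
  shows "x = y"
proof -
  have "(x \<cdot> f) \<cdot> inv_ar C f = (y \<cdot> f) \<cdot> inv_ar C f" using assms by simp
  then show ?thesis using assms(1,3-6) is_iso_Ar[OF assms(1)] by simp
qed

lemma split_mono_epi_iso: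
  assumes f: "f \<in> Hom C X Y" and g: "g \<in> Hom C Y X" "g \<cdot> f = Ide C X"
    and h: "h \<in> Hom C Y X" "f \<cdot> h = Ide C Y"
  shows "is_iso C f"
proof -
  have t: "f \<in> Ar C" "g \<in> Ar C" "h \<in> Ar C" "Dom C f = X" "Cod C f = Y"
    "Dom C g = Y" "Cod C g = X" "Dom C h = Y" "Cod C h = X"
    using assms by (auto simp: Hom_def)
  have "g = g \<cdot> (f \<cdot> h)" using t h(2) by simp
  also have "\<dots> = (g \<cdot> f) \<cdot> h" using t by simp
  also have "\<dots> = h" using t g(2) by simp
  finally have "g = h" .
  then show ?thesis using is_isoI[OF f g] h(2) by simp
qed

end

context cat_functor
begin

lemma FA_typing:
  assumes "category C" "f \<in> Ar C"
  shows "FA F f \<in> Ar D" "Dom D (FA F f) = FO F (Dom C f)" "Cod D (FA F f) = FO F (Cod C f)"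
  using FA_Hom[of f "Dom C f" "Cod C f"] assms(2) by (auto simp: Hom_def)

lemma FA_Cmp':
  assumes "f \<in> Ar C" "g \<in> Ar C" "Dom C g = Cod C f"
  shows "FA F (g \<cdot>\<^bsub>C\<^esub> f) = FA F g \<cdot>\<^bsub>D\<^esub> FA F f"
  using FA_Cmp[of f "Dom C f" "Cod C f" g "Cod C g"] assms by (auto simp: Hom_def)

lemma FA_inverse_arrows:
  assumes "category C" "inverse_arrows C f g"
  shows "inverse_arrows D (FA F f) (FA F g)"
proof -
  interpret category C by fact
  have t: "f \<in> Ar C" "g \<in> Ar C" "Dom C g = Cod C f" "Cod C g = Dom C f"
     "g \<cdot>\<^bsub>C\<^esub> f = Ide C (Dom C f)" "f \<cdot>\<^bsub>C\<^esub> g = Ide C (Cod C f)"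
    using assms(2) by (auto simp: inverse_arrows_def Hom_def)
  show ?thesis
    using FA_Cmp'[of f g] FA_Cmp'[of g f] t
    by (simp add: inverse_arrows_def Hom_def FA_typing[OF assms(1)] FA_Ide)
qed

lemma FA_is_iso: "category C \<Longrightarrow> is_iso C f \<Longrightarrow> is_iso D (FA F f)"
  by (meson FA_inverse_arrows is_iso_def)

lemma FA_inv:
  assumes "category C" "category D" "is_iso C f"
  shows "FA F (inv_ar C f) = inv_ar D (FA F f)"
  using category.inverse_arrows_inv[OF assms(1,3)] FA_inverse_arrows[OF assms(1)]
    category.inverse_unique[OF assms(2)] category.inverse_arrows_inv[OF assms(2)] FA_is_iso[OF assms(1,3)]
  by metis

end

text \<open>Half of the data of an equivalence already makes a functor faithful.\<close>

lemma left_inverse_faithful: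
  assumes "category C" "cat_functor C D F" "cat_functor D C H"
    and \<eta>: "nat_iso C C id_funct (comp_funct H F) \<eta>"
    and f: "f \<in> Hom C X Y" "f' \<in> Hom C X Y" "FA F f = FA F f'"
  shows "f = f'"
proof -
  interpret category C by fact
  have t: "f \<in> Ar C" "f' \<in> Ar C" "Dom C f = X" "Cod C f = Y" "Dom C f' = X" "Cod C f' = Y"
    using f by (auto simp: Hom_def)
  have "\<eta> Y \<cdot>\<^bsub>C\<^esub> f = \<eta> Y \<cdot>\<^bsub>C\<^esub> f'" "is_iso C (\<eta> Y)" "Dom C (\<eta> Y) = Y"
    using \<eta> t f(3) Hom_Ob[OF f(1)]
    by (simp_all add: nat_iso_def id_funct_def comp_funct_def Hom_def) metis
  then show ?thesis using iso_cancel_left t by metis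
qed

lemma right_inverse_faithful:
  assumes "category D" "cat_functor C D F" "cat_functor D C H"
    and \<epsilon>: "nat_iso D D (comp_funct F H) id_funct \<epsilon>"
    and f: "f \<in> Hom D X Y" "f' \<in> Hom D X Y" "FA H f = FA H f'"
  shows "f = f'"
proof -
  interpret category D by fact
  have t: "f \<in> Ar D" "f' \<in> Ar D" "Dom D f = X" "Cod D f = Y" "Dom D f' = X" "Cod D f' = Y"
    using f by (auto simp: Hom_def)
  have "f \<cdot>\<^bsub>D\<^esub> \<epsilon> X = f' \<cdot>\<^bsub>D\<^esub> \<epsilon> X" "is_iso D (\<epsilon> X)" "Cod D (\<epsilon> X) = X"
    using \<epsilon> t f(3) Hom_Ob[OF f(1)]
    by (simp_all add: nat_iso_def id_funct_def comp_funct_def Hom_def) metis+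
  then show ?thesis using iso_cancel_right t by metis
qed

lemma equivalence_faithful:
  assumes "category C" "cat_equivalence C D F"
    and "f \<in> Hom C X Y" "f' \<in> Hom C X Y" "FA F f = FA F f'"
  shows "f = f'"
  using assms left_inverse_faithful unfolding cat_equivalence_def by metis

text \<open>The preimage of \<open>k\<close> is the conjugate of \<open>H k\<close> by \<open>\<eta>\<close>, for a quasi-inverse \<open>H\<close>; that
  its image is \<open>k\<close> can be checked after applying \<open>H\<close>, which is faithful.\<close>

lemma equivalence_full:
  assumes "category C" "category D" "cat_equivalence C D F"
    and X: "X \<in> Ob C" "Y \<in> Ob C" and k: "k \<in> Hom D (FO F X) (FO F Y)"
  shows "\<exists>f \<in> Hom C X Y. FA F f = k"
proof -
  obtain H \<eta> \<epsilon> where F: "cat_functor C D F" and H: "cat_functor D C H"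
    and \<eta>: "nat_iso C C id_funct (comp_funct H F) \<eta>"
    and \<epsilon>: "nat_iso D D (comp_funct F H) id_funct \<epsilon>"
    using assms(3) by (auto simp: cat_equivalence_def)
  interpret C: category C by fact
  interpret F: cat_functor C D F by fact
  interpret H: cat_functor D C H by fact
  have e: "is_iso C (\<eta> X)" "is_iso C (\<eta> Y)" "\<eta> X \<in> Ar C" "\<eta> Y \<in> Ar C"
    "Dom C (\<eta> X) = X" "Dom C (\<eta> Y) = Y"
    "Cod C (\<eta> X) = FO H (FO F X)" "Cod C (\<eta> Y) = FO H (FO F Y)"
    using \<eta> X by (auto simp: nat_iso_def id_funct_def comp_funct_def Hom_def)
  have Hk: "FA H k \<in> Ar C" "Dom C (FA H k) = FO H (FO F X)" "Cod C (FA H k) = FO H (FO F Y)"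
    using H.FA_Hom[OF k] by (auto simp: Hom_def)
  define f where "f = inv_ar C (\<eta> Y) \<cdot>\<^bsub>C\<^esub> (FA H k \<cdot>\<^bsub>C\<^esub> \<eta> X)"
  have f: "f \<in> Ar C" "Dom C f = X" "Cod C f = Y"
    using e Hk by (simp_all add: f_def)
  have "\<eta> Y \<cdot>\<^bsub>C\<^esub> f = FA H (FA F f) \<cdot>\<^bsub>C\<^esub> \<eta> X"
    using \<eta> f by (auto simp: nat_iso_def id_funct_def comp_funct_def)
  moreover have "\<eta> Y \<cdot>\<^bsub>C\<^esub> f = FA H k \<cdot>\<^bsub>C\<^esub> \<eta> X"
    using e Hk by (simp add: f_def)
  moreover have Ff: "FA F f \<in> Hom D (FO F X) (FO F Y)"
    using F.FA_Hom f by (simp add: Hom_def)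
  ultimately have "FA H (FA F f) \<cdot>\<^bsub>C\<^esub> \<eta> X = FA H k \<cdot>\<^bsub>C\<^esub> \<eta> X"
    by simp
  then have "FA H (FA F f) = FA H k"
    by (rule C.iso_cancel_right[OF e(1)]) (use e Hk H.FA_Hom[OF Ff] in \<open>simp_all add: Hom_def\<close>)
  then have "FA F f = k"
    using right_inverse_faithful[OF assms(2) F H \<epsilon> Ff k] by simp
  then show ?thesis using f by (auto simp: Hom_def)
qed

lemma equivalence_essentially_surjective:
  assumes "cat_equivalence C D F" "Y \<in> Ob D"
  shows "\<exists>X \<in> Ob C. \<exists>a \<in> Hom D (FO F X) Y. is_iso D a"
proof -
  obtain H \<epsilon> where H: "cat_functor D C H" and \<epsilon>: "nat_iso D D (comp_funct F H) id_funct \<epsilon>"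
    using assms(1) by (auto simp: cat_equivalence_def)
  then show ?thesis
    using assms(2) cat_functor.FO_Ob[OF H]
    by (auto simp: nat_iso_def id_funct_def comp_funct_def intro!: bexI[of _ "FO H Y"] bexI[of _ "\<epsilon> Y"])
qed

text \<open>An equivalence preserves jointly monic families; for the projections of direct sums this replaces a
  computation with finite sums of arrows.\<close>

lemma equivalence_jointly_monic:
  assumes "category C" "category D" "cat_equivalence C D F"
    and S: "S \<in> Ob C" and p: "\<And>n. n \<in> N \<Longrightarrow> p n \<in> Ar C \<and> Dom C (p n) = S"
    and mono: "\<And>W u v. \<lbrakk>u \<in> Hom C W S; v \<in> Hom C W S; \<And>n. n \<in> N \<Longrightarrow> p n \<cdot>\<^bsub>C\<^esub> u = p n \<cdot>\<^bsub>C\<^esub> v\<rbrakk> \<Longrightarrow> u = v"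
    and u: "u \<in> Hom D W (FO F S)" "v \<in> Hom D W (FO F S)"
    and eq: "\<And>n. n \<in> N \<Longrightarrow> FA F (p n) \<cdot>\<^bsub>D\<^esub> u = FA F (p n) \<cdot>\<^bsub>D\<^esub> v"
  shows "u = v"
proof -
  interpret C: category C by fact
  interpret D: category D by fact
  interpret F: cat_functor C D F using assms(3) by (simp add: cat_equivalence_def)
  have W: "W \<in> Ob D" using D.Hom_Ob[OF u(1)] by simp
  obtain X a where X: "X \<in> Ob C" and a: "a \<in> Hom D (FO F X) W" "is_iso D a"
    using equivalence_essentially_surjective[OF assms(3) W] by blast
  have ua: "u \<cdot>\<^bsub>D\<^esub> a \<in> Hom D (FO F X) (FO F S)" "v \<cdot>\<^bsub>D\<^esub> a \<in> Hom D (FO F X) (FO F S)"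
    using a u by (auto simp: Hom_def)
  obtain u' v' where u': "u' \<in> Hom C X S" "FA F u' = u \<cdot>\<^bsub>D\<^esub> a" and v': "v' \<in> Hom C X S" "FA F v' = v \<cdot>\<^bsub>D\<^esub> a"
    using equivalence_full[OF assms(1-3) X S ua(1)] equivalence_full[OF assms(1-3) X S ua(2)] by blast
  have "p n \<cdot>\<^bsub>C\<^esub> u' = p n \<cdot>\<^bsub>C\<^esub> v'" if n: "n \<in> N" for n
  proof (rule equivalence_faithful[OF assms(1,3)])
    show "p n \<cdot>\<^bsub>C\<^esub> u' \<in> Hom C X (Cod C (p n))" "p n \<cdot>\<^bsub>C\<^esub> v' \<in> Hom C X (Cod C (p n))"
      using p[OF n] u' v' by (auto simp: Hom_def)
    have t: "FA F (p n) \<in> Ar D" "Dom D (FA F (p n)) = FO F S"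
      using F.FA_typing[OF assms(1), of "p n"] p[OF n] by auto
    have "FA F (p n) \<cdot>\<^bsub>D\<^esub> (u \<cdot>\<^bsub>D\<^esub> a) = (FA F (p n) \<cdot>\<^bsub>D\<^esub> u) \<cdot>\<^bsub>D\<^esub> a"
      "FA F (p n) \<cdot>\<^bsub>D\<^esub> (v \<cdot>\<^bsub>D\<^esub> a) = (FA F (p n) \<cdot>\<^bsub>D\<^esub> v) \<cdot>\<^bsub>D\<^esub> a"
      using t a(1) u by (simp_all add: Hom_def)
    moreover have "FA F (p n \<cdot>\<^bsub>C\<^esub> u') = FA F (p n) \<cdot>\<^bsub>D\<^esub> (u \<cdot>\<^bsub>D\<^esub> a)"
      "FA F (p n \<cdot>\<^bsub>C\<^esub> v') = FA F (p n) \<cdot>\<^bsub>D\<^esub> (v \<cdot>\<^bsub>D\<^esub> a)"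
      using p[OF n] u' v' F.FA_Cmp'[of u' "p n"] F.FA_Cmp'[of v' "p n"] by (simp_all add: Hom_def)
    ultimately show "FA F (p n \<cdot>\<^bsub>C\<^esub> u') = FA F (p n \<cdot>\<^bsub>C\<^esub> v')"
      using eq[OF n] by metis
  qed
  then have "u' = v'" using mono u' v' by blast
  then have "u \<cdot>\<^bsub>D\<^esub> a = v \<cdot>\<^bsub>D\<^esub> a" using u' v' by simp
  then show ?thesis
    by (rule D.iso_cancel_right[OF a(2)]) (use a u in \<open>simp_all add: Hom_def\<close>)
qed

section \<open>Additive categories and finite direct sums\<close>

context additive_category
begin

lemma Add_typing [simp]:
  assumes "f \<in> Ar C" "g \<in> Ar C" "Dom C g = Dom C f" "Cod C g = Cod C f"
  shows "f \<oplus>\<^sub>a g \<in> Ar C" "Dom C (f \<oplus>\<^sub>a g) = Dom C f" "Cod C (f \<oplus>\<^sub>a g) = Cod C f"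
proof -
  interpret comm_group "hom_group C (Dom C f) (Cod C f)"
    using hom_comm_group assms by simp
  have "f \<oplus>\<^sub>a g \<in> Hom C (Dom C f) (Cod C f)"
    using m_closed[of f g] assms by (simp add: hom_group_def Hom_def)
  then show "f \<oplus>\<^sub>a g \<in> Ar C" "Dom C (f \<oplus>\<^sub>a g) = Dom C f" "Cod C (f \<oplus>\<^sub>a g) = Cod C f"
    by (auto simp: Hom_def)
qed

lemma Zer_typing [simp]:
  assumes "X \<in> Ob C" "Y \<in> Ob C"
  shows "Zer C X Y \<in> Ar C" "Dom C (Zer C X Y) = X" "Cod C (Zer C X Y) = Y"
proof -
  interpret comm_group "hom_group C X Y"
    using hom_comm_group assms by simp
  have "Zer C X Y \<in> Hom C X Y"
    using one_closed by (simp add: hom_group_def)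
  then show "Zer C X Y \<in> Ar C" "Dom C (Zer C X Y) = X" "Cod C (Zer C X Y) = Y"
    by (auto simp: Hom_def)
qed

lemma neg_typing [simp]:
  assumes "f \<in> Ar C"
  shows "neg_ar C f \<in> Ar C" "Dom C (neg_ar C f) = Dom C f" "Cod C (neg_ar C f) = Cod C f"
proof -
  interpret comm_group "hom_group C (Dom C f) (Cod C f)"
    using hom_comm_group assms by simp
  have "neg_ar C f \<in> Hom C (Dom C f) (Cod C f)"
    using inv_closed[of f] assms by (simp add: hom_group_def Hom_def neg_ar_def)
  then show "neg_ar C f \<in> Ar C" "Dom C (neg_ar C f) = Dom C f" "Cod C (neg_ar C f) = Cod C f"
    by (auto simp: Hom_def)
qed

lemma Add_group:
  assumes "f \<in> Ar C" "g \<in> Ar C" "h \<in> Ar C" "Dom C f = X" "Cod C f = Y"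
    "Dom C g = X" "Cod C g = Y" "Dom C h = X" "Cod C h = Y"
  shows Add_assoc: "(f \<oplus>\<^sub>a g) \<oplus>\<^sub>a h = f \<oplus>\<^sub>a (g \<oplus>\<^sub>a h)"
    and Add_comm: "f \<oplus>\<^sub>a g = g \<oplus>\<^sub>a f"
    and Add_cancel: "f \<oplus>\<^sub>a g = f \<oplus>\<^sub>a h \<Longrightarrow> g = h"
proof -
  interpret comm_group "hom_group C X Y"
    using hom_comm_group assms by auto
  have c: "f \<in> carrier (hom_group C X Y)" "g \<in> carrier (hom_group C X Y)" "h \<in> carrier (hom_group C X Y)"
    using assms by (auto simp: hom_group_def Hom_def)
  show "(f \<oplus>\<^sub>a g) \<oplus>\<^sub>a h = f \<oplus>\<^sub>a (g \<oplus>\<^sub>a h)"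
    using m_assoc[OF c] by (simp add: hom_group_def)
  show "f \<oplus>\<^sub>a g = g \<oplus>\<^sub>a f"
    using m_comm[OF c(1,2)] by (simp add: hom_group_def)
  show "f \<oplus>\<^sub>a g = f \<oplus>\<^sub>a h \<Longrightarrow> g = h"
    using Units_l_cancel[OF _ c(2,3), of f] c(1) Units_eq by (simp add: hom_group_def)
qed

lemma Add_Zer [simp]:
  assumes "f \<in> Ar C" "Dom C f = X" "Cod C f = Y"
  shows "f \<oplus>\<^sub>a Zer C X Y = f" "Zer C X Y \<oplus>\<^sub>a f = f"
proof -
  interpret comm_group "hom_group C X Y"
    using hom_comm_group assms by auto
  have c: "f \<in> carrier (hom_group C X Y)"
    using assms by (auto simp: hom_group_def Hom_def)
  show "f \<oplus>\<^sub>a Zer C X Y = f" "Zer C X Y \<oplus>\<^sub>a f = f"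
    using r_one[OF c] l_one[OF c] by (simp_all add: hom_group_def)
qed

lemma Add_neg [simp]:
  assumes "f \<in> Ar C"
  shows "f \<oplus>\<^sub>a neg_ar C f = Zer C (Dom C f) (Cod C f)" "neg_ar C f \<oplus>\<^sub>a f = Zer C (Dom C f) (Cod C f)"
proof -
  interpret comm_group "hom_group C (Dom C f) (Cod C f)"
    using hom_comm_group assms by auto
  have c: "f \<in> carrier (hom_group C (Dom C f) (Cod C f))"
    using assms by (auto simp: hom_group_def Hom_def)
  show "f \<oplus>\<^sub>a neg_ar C f = Zer C (Dom C f) (Cod C f)" "neg_ar C f \<oplus>\<^sub>a f = Zer C (Dom C f) (Cod C f)"
    using r_inv[OF c] l_inv[OF c] by (simp_all add: hom_group_def neg_ar_def)
qed

lemma Cmp_Add [simp]: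
  assumes "f \<in> Ar C" "f' \<in> Ar C" "Dom C f' = Dom C f" "Cod C f' = Cod C f" "g \<in> Ar C"
  shows "Dom C g = Cod C f \<Longrightarrow> g \<cdot> (f \<oplus>\<^sub>a f') = (g \<cdot> f) \<oplus>\<^sub>a (g \<cdot> f')"
    and "Cod C g = Dom C f \<Longrightarrow> (f \<oplus>\<^sub>a f') \<cdot> g = (f \<cdot> g) \<oplus>\<^sub>a (f' \<cdot> g)"
  using Cmp_Add_right[of f "Dom C f" "Cod C f" f' g "Cod C g"]
    Cmp_Add_left[of g "Dom C g" "Dom C f" f "Cod C f" f'] assms by (simp_all add: Hom_def)

lemma Add_self_Zer:
  assumes "f \<in> Ar C" "f \<oplus>\<^sub>a f = f"
  shows "f = Zer C (Dom C f) (Cod C f)"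
  using Add_cancel[of f f "Zer C (Dom C f) (Cod C f)"] assms by auto

lemma Cmp_Zer [simp]:
  assumes "g \<in> Ar C" "X \<in> Ob C"
  shows "Dom C g = Y \<Longrightarrow> g \<cdot> Zer C X Y = Zer C X (Cod C g)"
    and "Cod C g = Y \<Longrightarrow> Zer C Y X \<cdot> g = Zer C (Dom C g) X"
proof -
  assume Y: "Dom C g = Y"
  then have Y': "Y \<in> Ob C" using assms by auto
  have "g \<cdot> Zer C X Y \<oplus>\<^sub>a g \<cdot> Zer C X Y = g \<cdot> (Zer C X Y \<oplus>\<^sub>a Zer C X Y)"
    using assms Y Y' by (subst Cmp_Add) simp_all
  then have "g \<cdot> Zer C X Y \<oplus>\<^sub>a g \<cdot> Zer C X Y = g \<cdot> Zer C X Y"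
    using assms Y Y' by (metis Add_Zer(1) Zer_typing)
  from Add_self_Zer[OF _ this] show "g \<cdot> Zer C X Y = Zer C X (Cod C g)"
    using assms Y Y' by simp
next
  assume Y: "Cod C g = Y"
  then have Y': "Y \<in> Ob C" using assms by auto
  have "Zer C Y X \<cdot> g \<oplus>\<^sub>a Zer C Y X \<cdot> g = (Zer C Y X \<oplus>\<^sub>a Zer C Y X) \<cdot> g"
    using assms Y Y' by (subst Cmp_Add) simp_all
  then have "Zer C Y X \<cdot> g \<oplus>\<^sub>a Zer C Y X \<cdot> g = Zer C Y X \<cdot> g"
    using assms Y Y' by (metis Add_Zer(1) Zer_typing)
  from Add_self_Zer[OF _ this] show "Zer C Y X \<cdot> g = Zer C (Dom C g) X"
    using assms Y Y' by simp
qed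

lemma neg_eqI:
  assumes "f \<in> Ar C" "g \<in> Ar C" "Dom C g = Dom C f" "Cod C g = Cod C f"
    and "f \<oplus>\<^sub>a g = Zer C (Dom C f) (Cod C f)"
  shows "g = neg_ar C f"
  using Add_cancel[of f g "neg_ar C f"] assms by simp

lemma Cmp_neg [simp]:
  assumes "f \<in> Ar C" "g \<in> Ar C" "Dom C g = Cod C f"
  shows "g \<cdot> neg_ar C f = neg_ar C (g \<cdot> f)" "neg_ar C g \<cdot> f = neg_ar C (g \<cdot> f)"
proof -
  have "g \<cdot> f \<oplus>\<^sub>a g \<cdot> neg_ar C f = g \<cdot> (f \<oplus>\<^sub>a neg_ar C f)"
    using assms by (subst Cmp_Add) simp_all
  then show "g \<cdot> neg_ar C f = neg_ar C (g \<cdot> f)"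
    using assms by (intro neg_eqI) simp_all
  have "g \<cdot> f \<oplus>\<^sub>a neg_ar C g \<cdot> f = (g \<oplus>\<^sub>a neg_ar C g) \<cdot> f"
    using assms by (subst Cmp_Add) simp_all
  then show "neg_ar C g \<cdot> f = neg_ar C (g \<cdot> f)"
    using assms by (intro neg_eqI) simp_all
qed

lemma neg_neg [simp]: "f \<in> Ar C \<Longrightarrow> neg_ar C (neg_ar C f) = f"
  using neg_eqI[of "neg_ar C f" f] by simp

lemma neg_Zer [simp]: "X \<in> Ob C \<Longrightarrow> Y \<in> Ob C \<Longrightarrow> neg_ar C (Zer C X Y) = Zer C X Y"
  using neg_eqI[of "Zer C X Y" "Zer C X Y"] by simp

lemma eq_if_diff_Zer:
  assumes "f \<in> Ar C" "g \<in> Ar C" "Dom C g = Dom C f" "Cod C g = Cod C f"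
    and "f \<oplus>\<^sub>a neg_ar C g = Zer C (Dom C f) (Cod C f)"
  shows "f = g"
proof -
  have "neg_ar C g = neg_ar C f" using assms by (intro neg_eqI) simp_all
  then show ?thesis using assms neg_neg by metis
qed

lemma diff_add_cancel:
  assumes "f \<in> Ar C" "g \<in> Ar C" "Dom C g = Dom C f" "Cod C g = Cod C f"
  shows "(f \<oplus>\<^sub>a neg_ar C g) \<oplus>\<^sub>a g = f" "g \<oplus>\<^sub>a (f \<oplus>\<^sub>a neg_ar C g) = f"
proof -
  show 1: "(f \<oplus>\<^sub>a neg_ar C g) \<oplus>\<^sub>a g = f"
    using assms by (simp add: Add_assoc[of f "neg_ar C g" g "Dom C f" "Cod C f"])
  show "g \<oplus>\<^sub>a (f \<oplus>\<^sub>a neg_ar C g) = f"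
    using 1 Add_comm[of "f \<oplus>\<^sub>a neg_ar C g" g g "Dom C f" "Cod C f"] assms by simp
qed

lemma is_zero_typing: "is_zero C Z \<Longrightarrow> Z \<in> Ob C"
  by (simp add: is_zero_def is_initial_def)

lemma is_zero_arrows:
  assumes "is_zero C Z" "f \<in> Ar C"
  shows "Dom C f = Z \<Longrightarrow> f = Zer C Z (Cod C f)" and "Cod C f = Z \<Longrightarrow> f = Zer C (Dom C f) Z"
proof -
  have Z: "Z \<in> Ob C" using assms(1) by (rule is_zero_typing)
  have "\<exists>!g. g \<in> Hom C Z (Cod C f)" "\<exists>!g. g \<in> Hom C (Dom C f) Z"
    using assms by (auto simp: is_zero_def is_initial_def is_terminal_def)
  then show "Dom C f = Z \<Longrightarrow> f = Zer C Z (Cod C f)" "Cod C f = Z \<Longrightarrow> f = Zer C (Dom C f) Z"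
    using assms(2) Z by (auto simp: Hom_def dest: ex1E)
qed

lemma is_zero_iff: "is_zero C Z \<longleftrightarrow> Z \<in> Ob C \<and> Ide C Z = Zer C Z Z"
proof
  assume "is_zero C Z"
  then show "Z \<in> Ob C \<and> Ide C Z = Zer C Z Z"
    using is_zero_typing is_zero_arrows(1)[of Z "Ide C Z"] by simp
next
  assume Z: "Z \<in> Ob C \<and> Ide C Z = Zer C Z Z"
  have "f = Zer C Z X" if "f \<in> Hom C Z X" for f X
    using that Z Cmp_Ide'[of f Z] Cmp_Zer(1)[of f Z Z] by (simp add: Hom_def)
  moreover have "f = Zer C X Z" if "f \<in> Hom C X Z" for f X
    using that Z Ide_Cmp'[of f Z] Cmp_Zer(2)[of f Z Z] by (simp add: Hom_def)
  moreover have "Zer C Z X \<in> Hom C Z X" "Zer C X Z \<in> Hom C X Z" if "X \<in> Ob C" for X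
    using that Z by (simp_all add: Hom_def)
  ultimately show "is_zero C Z"
    using Z unfolding is_zero_def is_initial_def is_terminal_def by metis
qed

lemma biproduct_typing:
  assumes "is_biproduct2 C A B S i1 i2 p1 p2"
  shows "A \<in> Ob C" "B \<in> Ob C" "S \<in> Ob C"
    "i1 \<in> Ar C" "Dom C i1 = A" "Cod C i1 = S" "i2 \<in> Ar C" "Dom C i2 = B" "Cod C i2 = S"
    "p1 \<in> Ar C" "Dom C p1 = S" "Cod C p1 = A" "p2 \<in> Ar C" "Dom C p2 = S" "Cod C p2 = B"
  using assms by (auto simp: is_biproduct2_def Hom_def)

lemma biproduct_rules:
  assumes "is_biproduct2 C A B S i1 i2 p1 p2"
  shows "p1 \<cdot> i1 = Ide C A" "p2 \<cdot> i2 = Ide C B" "p2 \<cdot> i1 = Zer C A B" "p1 \<cdot> i2 = Zer C B A"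
    "i1 \<cdot> p1 \<oplus>\<^sub>a i2 \<cdot> p2 = Ide C S"
  using assms by (auto simp: is_biproduct2_def)

lemma biproduct_cancel:
  assumes b: "is_biproduct2 C A B S i1 i2 p1 p2" and x: "x \<in> Ar C"
  shows "Cod C x = A \<Longrightarrow> p1 \<cdot> (i1 \<cdot> x) = x" "Cod C x = B \<Longrightarrow> p2 \<cdot> (i2 \<cdot> x) = x"
    "Cod C x = A \<Longrightarrow> p2 \<cdot> (i1 \<cdot> x) = Zer C (Dom C x) B"
    "Cod C x = B \<Longrightarrow> p1 \<cdot> (i2 \<cdot> x) = Zer C (Dom C x) A"
  using Cmp_rewrite[OF biproduct_rules(1)[OF b], of x] Cmp_rewrite[OF biproduct_rules(2)[OF b], of x]
    Cmp_rewrite[OF biproduct_rules(3)[OF b], of x] Cmp_rewrite[OF biproduct_rules(4)[OF b], of x]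
    biproduct_typing[OF b] x by simp_all

lemma biproduct_decompose:
  assumes b: "is_biproduct2 C A B S i1 i2 p1 p2" and x: "x \<in> Ar C"
  shows "Cod C x = S \<Longrightarrow> i1 \<cdot> (p1 \<cdot> x) \<oplus>\<^sub>a i2 \<cdot> (p2 \<cdot> x) = x"
    and "Dom C x = S \<Longrightarrow> (x \<cdot> i1) \<cdot> p1 \<oplus>\<^sub>a (x \<cdot> i2) \<cdot> p2 = x"
proof -
  note t = biproduct_typing[OF b] x
  show "i1 \<cdot> (p1 \<cdot> x) \<oplus>\<^sub>a i2 \<cdot> (p2 \<cdot> x) = x" if "Cod C x = S"
  proof -
    have "(i1 \<cdot> p1 \<oplus>\<^sub>a i2 \<cdot> p2) \<cdot> x = x" using biproduct_rules(5)[OF b] that x by simp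
    then show ?thesis using t that by simp
  qed
  show "(x \<cdot> i1) \<cdot> p1 \<oplus>\<^sub>a (x \<cdot> i2) \<cdot> p2 = x" if "Dom C x = S"
  proof -
    have "x \<cdot> (i1 \<cdot> p1 \<oplus>\<^sub>a i2 \<cdot> p2) = x" using biproduct_rules(5)[OF b] that x by simp
    then show ?thesis using t that by simp
  qed
qed

lemma biproduct_jointly_monic:
  assumes b: "is_biproduct2 C A B S i1 i2 p1 p2"
    and "u \<in> Ar C" "v \<in> Ar C" "Cod C u = S" "Cod C v = S" "p1 \<cdot> u = p1 \<cdot> v" "p2 \<cdot> u = p2 \<cdot> v"
  shows "u = v"
  using biproduct_decompose(1)[OF b, of u] biproduct_decompose(1)[OF b, of v] assms by metis

lemma direct_sum_typing:
  assumes "is_direct_sum C N A S \<iota> \<pi>" "n \<in> N"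
  shows "A n \<in> Ob C" "\<iota> n \<in> Ar C" "Dom C (\<iota> n) = A n" "Cod C (\<iota> n) = S"
    "\<pi> n \<in> Ar C" "Dom C (\<pi> n) = S" "Cod C (\<pi> n) = A n"
  using assms by (auto simp: is_direct_sum_def Hom_def)

lemma direct_sum_Ob: "is_direct_sum C N A S \<iota> \<pi> \<Longrightarrow> S \<in> Ob C"
  by (simp add: is_direct_sum_def)

lemma direct_sum_rules:
  assumes "is_direct_sum C N A S \<iota> \<pi>" "n \<in> N"
  shows "\<pi> n \<cdot> \<iota> n = Ide C (A n)" "k \<in> N \<Longrightarrow> k \<noteq> n \<Longrightarrow> \<pi> k \<cdot> \<iota> n = Zer C (A n) (A k)"
  using assms by (auto simp: is_direct_sum_def)

lemma direct_sum_universal: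
  assumes s: "is_direct_sum C N A S \<iota> \<pi>" and W: "W \<in> Ob C"
  shows "(\<And>n. n \<in> N \<Longrightarrow> f n \<in> Hom C W (A n)) \<Longrightarrow> \<exists>!u. u \<in> Hom C W S \<and> (\<forall>n \<in> N. \<pi> n \<cdot> u = f n)"
    and "(\<And>n. n \<in> N \<Longrightarrow> f n \<in> Hom C (A n) W) \<Longrightarrow> \<exists>!u. u \<in> Hom C S W \<and> (\<forall>n \<in> N. u \<cdot> \<iota> n = f n)"
  using s W by (simp_all only: is_direct_sum_def) (elim conjE, simp)+

lemma direct_sum_jointly_monic:
  assumes s: "is_direct_sum C N A S \<iota> \<pi>"
    and u: "u \<in> Hom C W S" "v \<in> Hom C W S" and eq: "\<And>n. n \<in> N \<Longrightarrow> \<pi> n \<cdot> u = \<pi> n \<cdot> v"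
  shows "u = v"
proof -
  have W: "W \<in> Ob C" using Hom_Ob[OF u(1)] by simp
  have "\<forall>n \<in> N. \<pi> n \<cdot> u \<in> Hom C W (A n)"
    using direct_sum_typing[OF s] u by (auto simp: Hom_def)
  then have "\<exists>!w. w \<in> Hom C W S \<and> (\<forall>n \<in> N. \<pi> n \<cdot> w = \<pi> n \<cdot> u)"
    by (intro direct_sum_universal(1)[OF s W]) blast
  then show ?thesis using u eq by metis
qed

lemma direct_sum_jointly_epic:
  assumes s: "is_direct_sum C N A S \<iota> \<pi>"
    and u: "u \<in> Hom C S W" "v \<in> Hom C S W" and eq: "\<And>n. n \<in> N \<Longrightarrow> u \<cdot> \<iota> n = v \<cdot> \<iota> n"
  shows "u = v"
proof -
  have W: "W \<in> Ob C" using Hom_Ob[OF u(1)] by simp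
  have "\<forall>n \<in> N. u \<cdot> \<iota> n \<in> Hom C (A n) W"
    using direct_sum_typing[OF s] u by (auto simp: Hom_def)
  then have "\<exists>!w. w \<in> Hom C S W \<and> (\<forall>n \<in> N. w \<cdot> \<iota> n = u \<cdot> \<iota> n)"
    by (intro direct_sum_universal(2)[OF s W]) blast
  then show ?thesis using u eq by metis
qed

lemma direct_sum_pair:
  assumes s: "is_direct_sum C N A S \<iota> \<pi>" and W: "W \<in> Ob C"
    and f: "\<And>n. n \<in> N \<Longrightarrow> f n \<in> Hom C W (A n)"
  obtains u where "u \<in> Hom C W S" "\<And>n. n \<in> N \<Longrightarrow> \<pi> n \<cdot> u = f n"
  using direct_sum_universal(1)[OF s W f] by blast

lemma direct_sum_copair:
  assumes s: "is_direct_sum C N A S \<iota> \<pi>" and W: "W \<in> Ob C"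
    and f: "\<And>n. n \<in> N \<Longrightarrow> f n \<in> Hom C (A n) W"
  obtains u where "u \<in> Hom C S W" "\<And>n. n \<in> N \<Longrightarrow> u \<cdot> \<iota> n = f n"
  using direct_sum_universal(2)[OF s W f] by blast

lemma direct_sum_empty:
  assumes "is_zero C Z"
  shows "is_direct_sum C {} A Z \<iota> \<pi>"
  using assms unfolding is_direct_sum_def is_zero_def is_initial_def is_terminal_def by simp

lemma direct_sum_insert:
  assumes s: "is_direct_sum C N A S \<iota> \<pi>" and n: "n \<notin> N"
    and b: "is_biproduct2 C (A n) S S' i1 i2 p1 p2"
  shows "is_direct_sum C (insert n N) A S'
    (\<lambda>k. if k = n then i1 else i2 \<cdot> \<iota> k) (\<lambda>k. if k = n then p1 else \<pi> k \<cdot> p2)"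
    (is "is_direct_sum C ?N A S' ?\<iota> ?\<pi>")
proof -
  note t = biproduct_typing[OF b] direct_sum_typing[OF s]
  note r = biproduct_rules[OF b] direct_sum_rules[OF s] biproduct_cancel[OF b]
  have N: "k \<noteq> n" if "k \<in> N" for k using that n by auto
  have pair: "\<exists>!u. u \<in> Hom C X S' \<and> (\<forall>k \<in> ?N. ?\<pi> k \<cdot> u = f k)"
    if X: "X \<in> Ob C" and f: "\<forall>k \<in> ?N. f k \<in> Hom C X (A k)" for X f
  proof -
    obtain v where v: "v \<in> Hom C X S" "\<And>k. k \<in> N \<Longrightarrow> \<pi> k \<cdot> v = f k"
      using direct_sum_pair[OF s X, of f] f by blast
    have fn: "f n \<in> Ar C" "Dom C (f n) = X" "Cod C (f n) = A n"
      "v \<in> Ar C" "Dom C v = X" "Cod C v = S"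
      using f v by (auto simp: Hom_def)
    have fk: "f k \<in> Ar C" "Dom C (f k) = X" "Cod C (f k) = A k" if "k \<in> N" for k
      using f that by (auto simp: Hom_def)
    show ?thesis
    proof (rule ex1I[of _ "i1 \<cdot> f n \<oplus>\<^sub>a i2 \<cdot> v"])
      show "i1 \<cdot> f n \<oplus>\<^sub>a i2 \<cdot> v \<in> Hom C X S' \<and> (\<forall>k \<in> ?N. ?\<pi> k \<cdot> (i1 \<cdot> f n \<oplus>\<^sub>a i2 \<cdot> v) = f k)"
        using t fn fk r v(2) N by (auto simp: Hom_def)
    next
      fix u assume u: "u \<in> Hom C X S' \<and> (\<forall>k \<in> ?N. ?\<pi> k \<cdot> u = f k)"
      then have u': "u \<in> Ar C" "Dom C u = X" "Cod C u = S'" "p1 \<cdot> u = f n"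
        by (auto simp: Hom_def)
      have "p2 \<cdot> u = v"
      proof (rule direct_sum_jointly_monic[OF s _ v(1)])
        show "p2 \<cdot> u \<in> Hom C X S" using u' t by (simp add: Hom_def)
        fix k assume k: "k \<in> N"
        have "(\<pi> k \<cdot> p2) \<cdot> u = f k" using bspec[OF conjunct2[OF u], of k] N k by simp
        then show "\<pi> k \<cdot> (p2 \<cdot> u) = \<pi> k \<cdot> v" using u' t k v(2) by simp
      qed
      then show "u = i1 \<cdot> f n \<oplus>\<^sub>a i2 \<cdot> v"
        using biproduct_decompose(1)[OF b u'(1) u'(3)] u'(4) by simp
    qed
  qed
  have copair: "\<exists>!u. u \<in> Hom C S' X \<and> (\<forall>k \<in> ?N. u \<cdot> ?\<iota> k = f k)"
    if X: "X \<in> Ob C" and f: "\<forall>k \<in> ?N. f k \<in> Hom C (A k) X" for X f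
  proof -
    obtain v where v: "v \<in> Hom C S X" "\<And>k. k \<in> N \<Longrightarrow> v \<cdot> \<iota> k = f k"
      using direct_sum_copair[OF s X, of f] f by blast
    have fn: "f n \<in> Ar C" "Cod C (f n) = X" "Dom C (f n) = A n"
      "v \<in> Ar C" "Cod C v = X" "Dom C v = S"
      using f v by (auto simp: Hom_def)
    have fk: "f k \<in> Ar C" "Dom C (f k) = A k" "Cod C (f k) = X" if "k \<in> N" for k
      using f that by (auto simp: Hom_def)
    show ?thesis
    proof (rule ex1I[of _ "f n \<cdot> p1 \<oplus>\<^sub>a v \<cdot> p2"])
      show "f n \<cdot> p1 \<oplus>\<^sub>a v \<cdot> p2 \<in> Hom C S' X \<and> (\<forall>k \<in> ?N. (f n \<cdot> p1 \<oplus>\<^sub>a v \<cdot> p2) \<cdot> ?\<iota> k = f k)"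
        using t fn fk r v(2) N by (auto simp: Hom_def)
    next
      fix u assume u: "u \<in> Hom C S' X \<and> (\<forall>k \<in> ?N. u \<cdot> ?\<iota> k = f k)"
      then have u': "u \<in> Ar C" "Cod C u = X" "Dom C u = S'" "u \<cdot> i1 = f n"
        by (auto simp: Hom_def)
      have "u \<cdot> i2 = v"
      proof (rule direct_sum_jointly_epic[OF s _ v(1)])
        show "u \<cdot> i2 \<in> Hom C S X" using u' t by (simp add: Hom_def)
        fix k assume k: "k \<in> N"
        have "u \<cdot> (i2 \<cdot> \<iota> k) = f k" using bspec[OF conjunct2[OF u], of k] N k by simp
        then show "(u \<cdot> i2) \<cdot> \<iota> k = v \<cdot> \<iota> k" using u' t k v(2) by simp
      qed
      then show "u = f n \<cdot> p1 \<oplus>\<^sub>a v \<cdot> p2"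
        using biproduct_decompose(2)[OF b u'(1) u'(3)] u'(4) by simp
    qed
  qed
  have orthonormal: "?\<pi> k \<cdot> ?\<iota> l = (if l = k then Ide C (A l) else Zer C (A l) (A k))"
    if "l \<in> ?N" "k \<in> ?N" for k l
    using that t r N by auto
  show ?thesis
    unfolding is_direct_sum_def
  proof (intro conjI ballI allI impI)
    fix k assume "k \<in> ?N"
    then show "A k \<in> Ob C" "?\<iota> k \<in> Hom C (A k) S'" "?\<pi> k \<in> Hom C S' (A k)"
      using t N by (auto simp: Hom_def)
  next
    show "S' \<in> Ob C" by (rule t(3))
  next
    fix k l assume "k \<in> ?N" "l \<in> ?N"
    then show "?\<pi> l \<cdot> ?\<iota> k = (if k = l then Ide C (A k) else Zer C (A k) (A l))"
      by (intro orthonormal)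
  next
    fix X f assume "X \<in> Ob C" "\<forall>k \<in> ?N. f k \<in> Hom C X (A k)"
    then show "\<exists>!u. u \<in> Hom C X S' \<and> (\<forall>k \<in> ?N. ?\<pi> k \<cdot> u = f k)"
      by (rule pair)
  next
    fix X f assume "X \<in> Ob C" "\<forall>k \<in> ?N. f k \<in> Hom C (A k) X"
    then show "\<exists>!u. u \<in> Hom C S' X \<and> (\<forall>k \<in> ?N. u \<cdot> ?\<iota> k = f k)"
      by (rule copair)
  qed
qed

text \<open>Relative to a class \<open>I\<close> of objects closed under zero objects and binary sums, the induction gives
  existence, for the class of all objects, and also closure of ideals under finite sums.\<close>

lemma direct_sum_exists:
  assumes "finite N" "\<And>n. n \<in> N \<Longrightarrow> A n \<in> I" and I: "I \<subseteq> Ob C"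
    and zero: "\<And>Z. is_zero C Z \<Longrightarrow> Z \<in> I"
    and biproduct: "\<And>A B S i1 i2 p1 p2. \<lbrakk>A \<in> I; B \<in> I; is_biproduct2 C A B S i1 i2 p1 p2\<rbrakk> \<Longrightarrow> S \<in> I"
  shows "\<exists>S \<iota> \<pi>. S \<in> I \<and> is_direct_sum C N A S \<iota> \<pi>"
  using assms(1,2)
proof (induction N)
  case empty
  then show ?case using zero_object zero direct_sum_empty by blast
next
  case (insert n N)
  then obtain S \<iota> \<pi> where S: "S \<in> I" "is_direct_sum C N A S \<iota> \<pi>" by auto
  obtain S' i1 i2 p1 p2 where b: "is_biproduct2 C (A n) S S' i1 i2 p1 p2"
    using biproducts[of "A n" S] insert.prems S I by blast
  then have "S' \<in> I" using biproduct insert.prems S by blast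
  then show ?case using direct_sum_insert[OF S(2) insert.hyps(2) b] by blast
qed

lemma direct_sum_unique:
  assumes s: "is_direct_sum C N A S \<iota> \<pi>" and s': "is_direct_sum C N A S' \<iota>' \<pi>'"
  shows "isomorphic C S S'"
proof -
  note t = direct_sum_typing[OF s] direct_sum_typing[OF s'] direct_sum_Ob[OF s] direct_sum_Ob[OF s']
  obtain u where u: "u \<in> Hom C S S'" "\<And>n. n \<in> N \<Longrightarrow> \<pi>' n \<cdot> u = \<pi> n"
    using direct_sum_pair[OF s', of S \<pi>] t by (auto simp: Hom_def)
  obtain v where v: "v \<in> Hom C S' S" "\<And>n. n \<in> N \<Longrightarrow> \<pi> n \<cdot> v = \<pi>' n"
    using direct_sum_pair[OF s, of S' \<pi>'] t by (auto simp: Hom_def)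
  note uv = Hom_rules[OF u(1)] Hom_rules[OF v(1)]
  have "v \<cdot> u = Ide C S"
  proof (rule direct_sum_jointly_monic[OF s])
    show "v \<cdot> u \<in> Hom C S S" "Ide C S \<in> Hom C S S" using uv t by (simp_all add: Hom_def)
    show "\<pi> n \<cdot> (v \<cdot> u) = \<pi> n \<cdot> Ide C S" if "n \<in> N" for n
      using Cmp_rewrite[OF v(2)[OF that], of u] u(2) that uv t by simp
  qed
  moreover have "u \<cdot> v = Ide C S'"
  proof (rule direct_sum_jointly_monic[OF s'])
    show "u \<cdot> v \<in> Hom C S' S'" "Ide C S' \<in> Hom C S' S'" using uv t by (simp_all add: Hom_def)
    show "\<pi>' n \<cdot> (u \<cdot> v) = \<pi>' n \<cdot> Ide C S'" if "n \<in> N" for n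
      using Cmp_rewrite[OF u(2)[OF that], of v] v(2) that uv t by simp
  qed
  ultimately show ?thesis
    using u v is_isoI[of u S S' v] by (auto simp: isomorphic_def)
qed

lemma direct_sum_FA_jointly_monic:
  assumes D: "category D" "cat_equivalence C D F" and s: "is_direct_sum C N A S \<iota> \<pi>"
    and u: "u \<in> Hom D W (FO F S)" "v \<in> Hom D W (FO F S)"
    and eq: "\<And>n. n \<in> N \<Longrightarrow> FA F (\<pi> n) \<cdot>\<^bsub>D\<^esub> u = FA F (\<pi> n) \<cdot>\<^bsub>D\<^esub> v"
  shows "u = v"
proof (rule equivalence_jointly_monic[where p = \<pi> and N = N, OF category_axioms D direct_sum_Ob[OF s] _ _ u])
  show "\<pi> n \<in> Ar C \<and> Dom C (\<pi> n) = S" if "n \<in> N" for n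
    using direct_sum_typing[OF s that] by simp
qed (use direct_sum_jointly_monic[OF s] eq in blast)+

end

lemma additive_functor_Zer:
  assumes "additive_category C" "additive_category D" "additive_functor C D F"
    and X: "X \<in> Ob C" "Y \<in> Ob C"
  shows "FA F (Zer C X Y) = Zer D (FO F X) (FO F Y)"
proof -
  interpret C: additive_category C by fact
  interpret D: additive_category D by fact
  interpret F: cat_functor C D F using assms(3) by (simp add: additive_functor_def)
  have z: "Zer C X Y \<in> Hom C X Y" using X by (simp add: Hom_def)
  then have "FA F (Zer C X Y \<oplus>\<^sub>a\<^bsub>C\<^esub> Zer C X Y) = FA F (Zer C X Y) \<oplus>\<^sub>a\<^bsub>D\<^esub> FA F (Zer C X Y)"
    using assms(3) X unfolding additive_functor_def by blast
  then have "FA F (Zer C X Y) \<oplus>\<^sub>a\<^bsub>D\<^esub> FA F (Zer C X Y) = FA F (Zer C X Y)"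
    using X by simp
  then show ?thesis
    using D.Add_self_Zer[of "FA F (Zer C X Y)"] F.FA_Hom[OF z] by (simp add: Hom_def)
qed

section \<open>Triangles\<close>

context triangulated_category
begin

abbreviation "SO \<equiv> FO (Sh C)"
abbreviation "SA \<equiv> FA (Sh C)"

sublocale Sh: cat_functor C C "Sh C"
  using shift_equivalence by (simp add: cat_equivalence_def)

lemma Sh_Ob [simp]: "X \<in> Ob C \<Longrightarrow> SO X \<in> Ob C"
  by (rule Sh.FO_Ob)

lemma Sh_typing [simp]:
  assumes "f \<in> Ar C"
  shows "SA f \<in> Ar C" "Dom C (SA f) = SO (Dom C f)"
    "Cod C (SA f) = SO (Cod C f)"
  using Sh.FA_typing[OF category_axioms assms] by auto

lemma Sh_Cmp [simp]:
  "f \<in> Ar C \<Longrightarrow> g \<in> Ar C \<Longrightarrow> Dom C g = Cod C f \<Longrightarrow> SA (g \<cdot> f) = SA g \<cdot> SA f"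
  by (rule Sh.FA_Cmp')

lemma Sh_Ide [simp]: "X \<in> Ob C \<Longrightarrow> SA (Ide C X) = Ide C (SO X)"
  by (rule Sh.FA_Ide)

lemma Sh_Zer [simp]:
  "X \<in> Ob C \<Longrightarrow> Y \<in> Ob C \<Longrightarrow> SA (Zer C X Y) = Zer C (SO X) (SO Y)"
  by (rule additive_functor_Zer[OF additive_category_axioms additive_category_axioms shift_additive])

lemma Sh_is_iso [simp]: "is_iso C f \<Longrightarrow> is_iso C (SA f)"
  by (rule Sh.FA_is_iso[OF category_axioms])

lemma Tri_typing:
  assumes "(f, g, h) \<in> Tri C"
  shows "f \<in> Ar C" "g \<in> Ar C" "h \<in> Ar C" "Dom C g = Cod C f" "Dom C h = Cod C g"
    "Cod C h = SO (Dom C f)"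
  using Tri_triangle[OF assms] by (auto simp: is_triangle_def)

lemma Tri_rotate: "(f, g, h) \<in> Tri C \<Longrightarrow> (g, h, neg_ar C (SA f)) \<in> Tri C"
  using TR2 Tri_triangle by blast

lemma Tri_comp_Zer:
  assumes t: "(f, g, h) \<in> Tri C"
  shows "g \<cdot> f = Zer C (Dom C f) (Cod C g)"
proof -
  note ty = Tri_typing[OF t]
  obtain Z where Z: "is_zero C Z" "Z \<in> Ob C" using zero_object is_zero_typing by blast
  let ?X = "Dom C f"
  have t1: "(Ide C ?X, Zer C ?X Z, Zer C Z (SO ?X)) \<in> Tri C"
    using TR1_id Z ty by simp
  obtain c where c: "c \<in> Hom C Z (Cod C g)" "c \<cdot> Zer C ?X Z = g \<cdot> f"
    using TR3[OF t1 t, of "Ide C ?X" f] ty Z by (auto simp: Hom_def)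
  then show ?thesis using ty Z by (simp add: Hom_def)
qed

text \<open>Exactness of \<^term>\<open>Hom C W\<close> on a triangle: the identity triangle of \<open>W\<close>, rotated, maps to the
  rotated triangle, and the third arrow is unshifted by fullness of the shift.\<close>

lemma Tri_exact:
  assumes t: "(f, g, h) \<in> Tri C" and k: "k \<in> Ar C" "Cod C k = Dom C g"
    and gk: "g \<cdot> k = Zer C (Dom C k) (Cod C g)"
  obtains l where "l \<in> Hom C (Dom C k) (Dom C f)" "f \<cdot> l = k"
proof -
  note ty = Tri_typing[OF t]
  obtain Z where Z: "is_zero C Z" "Z \<in> Ob C" using zero_object is_zero_typing by blast
  let ?W = "Dom C k"
  have W: "?W \<in> Ob C" using k by simp
  have "(Ide C ?W, Zer C ?W Z, Zer C Z (SO ?W)) \<in> Tri C"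
    using TR1_id Z W by simp
  then have t1: "(Zer C ?W Z, Zer C Z (SO ?W), neg_ar C (SA (Ide C ?W))) \<in> Tri C"
    by (rule Tri_rotate)
  obtain c where c: "c \<in> Hom C (SO ?W) (SO (Dom C f))"
    "SA k \<cdot> neg_ar C (SA (Ide C ?W)) = neg_ar C (SA f) \<cdot> c"
    using TR3[OF t1 Tri_rotate[OF t], of k "Zer C Z (Cod C g)"] ty Z W k gk by (auto simp: Hom_def)
  obtain l where l: "l \<in> Hom C ?W (Dom C f)" "SA l = c"
    using equivalence_full[OF category_axioms category_axioms shift_equivalence W _ c(1)] ty by auto
  note l' = Hom_rules[OF l(1)]
  have "neg_ar C (SA k) = neg_ar C (SA (f \<cdot> l))"
    using c(2) l(2)[symmetric] l' ty W k by simp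
  then have "SA k = SA (f \<cdot> l)"
    using l' ty k by (metis Cmp_typing(1) Sh_typing(1) neg_neg)
  then have "k = f \<cdot> l"
    using equivalence_faithful[OF category_axioms shift_equivalence, of k ?W "Dom C g" "f \<cdot> l"] k l' ty
    by (simp add: Hom_def)
  then show ?thesis using that l(1) by simp
qed

lemma split_mono_triangle_Zer:
  assumes t: "(i, g, h) \<in> Tri C" and p: "p \<in> Hom C (Cod C i) (Dom C i)" "p \<cdot> i = Ide C (Dom C i)"
  shows "h = Zer C (Cod C g) (SO (Dom C i))"
proof -
  note ty = Tri_typing[OF t]
  note p' = Hom_rules[OF p(1)]
  have "neg_ar C (SA i) \<cdot> h = Zer C (Cod C g) (SO (Cod C i))"
    using Tri_comp_Zer[OF Tri_rotate[OF t]]  Tri_comp_Zer[OF Tri_rotate[OF Tri_rotate[OF t]]] ty by simp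
  then have "neg_ar C (neg_ar C (SA i \<cdot> h)) = neg_ar C (Zer C (Cod C g) (SO (Cod C i)))"
    using ty by simp
  then have "SA i \<cdot> h = Zer C (Cod C g) (SO (Cod C i))"
    using ty by simp
  then have "SA p \<cdot> (SA i \<cdot> h) = SA p \<cdot> Zer C (Cod C g) (SO (Cod C i))"
    by simp
  moreover have "SA p \<cdot> SA i = Ide C (SO (Dom C i))"
    using p(2) Sh_Cmp[of i p] ty p' by simp
  ultimately show ?thesis
    using Cmp_rewrite[of "SA p" "SA i" "Ide C (SO (Dom C i))" h] ty p' by simp
qed

text \<open>The connecting arrow of the triangle on a split monomorphism vanishes, so the arrow to the cone has a
  section, which becomes complementary after subtraction of its component along \<open>i\<close>.\<close>

lemma split_mono_complement:
  assumes i: "i \<in> Hom C X Y" and p: "p \<in> Hom C Y X" "p \<cdot> i = Ide C X"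
  obtains B j q where "is_biproduct2 C X B Y i j p q" "(i, q, Zer C B (SO X)) \<in> Tri C"
proof -
  have i': "i \<in> Ar C" "Dom C i = X" "Cod C i = Y" and p': "p \<in> Ar C" "Dom C p = Y" "Cod C p = X"
    using i p by (auto simp: Hom_def)
  obtain q h where t: "(i, q, h) \<in> Tri C" using TR1_cone i' by blast
  note ty = Tri_typing[OF t]
  define B where "B = Cod C q"
  have q: "q \<in> Ar C" "Dom C q = Y" "Cod C q = B" "B \<in> Ob C" using ty i' by (auto simp: B_def)
  have XY: "X \<in> Ob C" "Y \<in> Ob C" using i' by auto
  have h: "h = Zer C B (SO X)"
    using split_mono_triangle_Zer[OF t] p i' by (simp add: B_def)
  have qi: "q \<cdot> i = Zer C X B" using Tri_comp_Zer[OF t] i' q by simp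
  have "h \<cdot> Ide C B = Zer C (Dom C (Ide C B)) (Cod C h)" using h q XY by simp
  then obtain j0 where "j0 \<in> Hom C (Dom C (Ide C B)) (Dom C q)" and j0: "q \<cdot> j0 = Ide C B"
    using Tri_exact[OF Tri_rotate[OF t], of "Ide C B"] q ty(5) by auto
  then have j0': "j0 \<in> Ar C" "Dom C j0 = B" "Cod C j0 = Y" using q by (auto simp: Hom_def)
  define j where "j = j0 \<oplus>\<^sub>a neg_ar C (i \<cdot> (p \<cdot> j0))"
  have j': "j \<in> Ar C" "Dom C j = B" "Cod C j = Y" using j0' i' p' by (simp_all add: j_def)
  have qix: "q \<cdot> (i \<cdot> x) = Zer C (Dom C x) B" if "x \<in> Ar C" "Cod C x = X" for x
    using Cmp_rewrite[OF qi, of x] that i' q by simp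
  have pix: "p \<cdot> (i \<cdot> x) = x" if "x \<in> Ar C" "Cod C x = X" for x
    using Cmp_rewrite[OF p(2), of x] that i' p' by simp
  have qj: "q \<cdot> j = Ide C B"
    unfolding j_def using j0 j0' i' p' q by (simp add: qix)
  have pj: "p \<cdot> j = Zer C B X"
    unfolding j_def using j0 j0' i' p' q by (simp add: pix)
  have qjx: "q \<cdot> (j \<cdot> x) = x" if "x \<in> Ar C" "Cod C x = B" for x
    using Cmp_rewrite[OF qj, of x] that j' q by simp
  have pjx: "p \<cdot> (j \<cdot> x) = Zer C (Dom C x) X" if "x \<in> Ar C" "Cod C x = B" for x
    using Cmp_rewrite[OF pj, of x] that j' p' XY by simp
  define s where "s = i \<cdot> p \<oplus>\<^sub>a j \<cdot> q"
  have s: "s \<in> Ar C" "Dom C s = Y" "Cod C s = Y" using i' p' j' q by (simp_all add: s_def)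
  have ps: "p \<cdot> s = p" unfolding s_def using i' p' j' q XY by (simp add: pix pjx)
  have qs: "q \<cdot> s = q" unfolding s_def using i' p' j' q XY by (simp add: qix qjx)
  define d where "d = Ide C Y \<oplus>\<^sub>a neg_ar C s"
  have d: "d \<in> Ar C" "Dom C d = Y" "Cod C d = Y" using s XY by (simp_all add: d_def)
  have "q \<cdot> d = Zer C (Dom C d) (Cod C q)" using qs s d q XY by (simp add: d_def)
  then obtain l where "l \<in> Hom C (Dom C d) (Dom C i)" and il: "i \<cdot> l = d"
    using Tri_exact[OF t, of d] d q by auto
  then have l: "l \<in> Ar C" "Dom C l = Y" "Cod C l = X" using i' d by (auto simp: Hom_def)
  have "l = p \<cdot> d" using pix[of l] l il by simp
  also have "\<dots> = Zer C Y X" using ps s p' XY by (simp add: d_def)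
  finally have "d = Zer C Y Y" using il i' XY by simp
  then have "s = Ide C Y"
    using eq_if_diff_Zer[of "Ide C Y" s] s XY by (simp add: d_def)
  then have "is_biproduct2 C X B Y i j p q"
    unfolding is_biproduct2_def using i' p' j' q XY p(2) qi qj pj by (simp add: Hom_def s_def)
  then show ?thesis using that t h by blast
qed

lemma biproduct_triangle:
  assumes b: "is_biproduct2 C A B S i j p q"
  shows "(i, q, Zer C B (SO A)) \<in> Tri C"
proof -
  note t = biproduct_typing[OF b] and r = biproduct_rules[OF b] and c = biproduct_cancel[OF b]
  obtain B' j' q' where b': "is_biproduct2 C A B' S i j' p q'"
    and t': "(i, q', Zer C B' (SO A)) \<in> Tri C"
    using split_mono_complement[of i A S p] t r by (auto simp: Hom_def)
  note ty = biproduct_typing[OF b'] and r' = biproduct_rules[OF b'] and c' = biproduct_cancel[OF b']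
  have qjq': "q \<cdot> (j' \<cdot> q') = q"
  proof -
    have "q \<cdot> (i \<cdot> p \<oplus>\<^sub>a j' \<cdot> q') = q" using r'(5) t by simp
    then show ?thesis using t ty r by (simp add: c)
  qed
  have q'jq: "q' \<cdot> (j \<cdot> q) = q'"
  proof -
    have "q' \<cdot> (i \<cdot> p \<oplus>\<^sub>a j \<cdot> q) = q'" using r(5) ty by simp
    then show ?thesis using t ty r' by (simp add: c')
  qed
  have "(q \<cdot> j') \<cdot> (q' \<cdot> j) = (q \<cdot> (j' \<cdot> q')) \<cdot> j" "(q' \<cdot> j) \<cdot> (q \<cdot> j') = (q' \<cdot> (j \<cdot> q)) \<cdot> j'"
    using t ty by simp_all
  then have "(q \<cdot> j') \<cdot> (q' \<cdot> j) = Ide C B" "(q' \<cdot> j) \<cdot> (q \<cdot> j') = Ide C B'"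
    using qjq' q'jq r r' by simp_all
  then have iso: "is_iso C (q \<cdot> j')"
    using is_isoI[of "q \<cdot> j'" B' B "q' \<cdot> j"] t ty by (simp add: Hom_def)
  have "iso_triangles C (Sh C) (i, q', Zer C B' (SO A)) (i, q, Zer C B (SO A))"
    unfolding iso_triangles_def split_conv
    using iso qjq' t ty
    by (intro bexI[of _ "Ide C A"] bexI[of _ "Ide C S"] bexI[of _ "q \<cdot> j'"] conjI) (simp_all add: Hom_def)
  then show ?thesis
    using TR0[OF t'] t by (simp add: is_triangle_def)
qed

lemma biproduct_swap:
  assumes "is_biproduct2 C A B S i1 i2 p1 p2"
  shows "is_biproduct2 C B A S i2 i1 p2 p1"
  using assms biproduct_typing[OF assms]
    Add_comm[of "i1 \<cdot> p1" "i2 \<cdot> p2" "i1 \<cdot> p1" S S]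
  by (simp add: is_biproduct2_def)

lemma triangulated_subcategory_rules:
  assumes "triangulated_subcategory C I"
  shows "I \<subseteq> Ob C" "\<And>A B. A \<in> I \<Longrightarrow> isomorphic C A B \<Longrightarrow> B \<in> Ob C \<Longrightarrow> B \<in> I"
    "\<And>Z. is_zero C Z \<Longrightarrow> Z \<in> I" "\<And>A. A \<in> Ob C \<Longrightarrow> SO A \<in> I \<longleftrightarrow> A \<in> I"
    "\<And>f g h. (f, g, h) \<in> Tri C \<Longrightarrow> Dom C f \<in> I \<Longrightarrow> Cod C f \<in> I \<Longrightarrow> Cod C g \<in> I"
  using assms unfolding triangulated_subcategory_def by blast+

lemma triangulated_subcategory_biproduct:
  assumes I: "triangulated_subcategory C I" and b: "is_biproduct2 C A B S i1 i2 p1 p2"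
    and AB: "A \<in> I" "B \<in> I"
  shows "S \<in> I"
proof -
  note t = biproduct_typing[OF b] and rules = triangulated_subcategory_rules[OF I]
  \<comment> \<open>rotated twice, the split triangle has \<open>B\<close> and the shift of \<open>A\<close> as its first two vertices\<close>
  have "(Zer C B (SO A), neg_ar C (SA i1), neg_ar C (SA p2)) \<in> Tri C"
    by (intro Tri_rotate biproduct_triangle[OF b])
  from rules(5)[OF this] have "SO S \<in> I"
    using t AB rules(4) by simp
  then show ?thesis using rules(4) t by simp
qed

text \<open>An arrow that is diagonal with respect to injections is diagonal with respect to projections. The
  target is only required to carry an orthonormal system, so that it can be the shift of a direct sum.\<close>

lemma direct_sum_transpose:
  assumes s: "is_direct_sum C N A X \<iota> \<pi>"
    and p: "\<And>n. n \<in> N \<Longrightarrow> \<iota>' n \<in> Hom C (B n) Y \<and> \<pi>' n \<in> Hom C Y (B n)"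
    and o: "\<And>n k. n \<in> N \<Longrightarrow> k \<in> N \<Longrightarrow> \<pi>' k \<cdot> \<iota>' n = (if n = k then Ide C (B n) else Zer C (B n) (B k))"
    and F: "F \<in> Hom C X Y" and f: "\<And>n. n \<in> N \<Longrightarrow> f n \<in> Hom C (A n) (B n)"
    and eq: "\<And>n. n \<in> N \<Longrightarrow> F \<cdot> \<iota> n = \<iota>' n \<cdot> f n" and n: "n \<in> N"
  shows "\<pi>' n \<cdot> F = f n \<cdot> \<pi> n"
proof (rule direct_sum_jointly_epic[OF s])
  note t = direct_sum_typing[OF s]
  have t': "\<pi>' k \<in> Ar C" "Dom C (\<pi>' k) = Y" "Cod C (\<pi>' k) = B k"
    "\<iota>' k \<in> Ar C" "Dom C (\<iota>' k) = B k" "Cod C (\<iota>' k) = Y"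
    "f k \<in> Ar C" "Dom C (f k) = A k" "Cod C (f k) = B k" "B k \<in> Ob C" if "k \<in> N" for k
    using p[OF that] f[OF that] Hom_Ob[of "f k"] by (auto simp: Hom_def)
  note tF = Hom_rules[OF F(1)]
  show "\<pi>' n \<cdot> F \<in> Hom C X (B n)" "f n \<cdot> \<pi> n \<in> Hom C X (B n)"
    using t[OF n] t'[OF n] tF by (simp_all add: Hom_def)
  fix k assume k: "k \<in> N"
  have "(\<pi>' n \<cdot> F) \<cdot> \<iota> k = \<pi>' n \<cdot> (\<iota>' k \<cdot> f k)"
    using t[OF k] t'[OF n] tF eq[OF k] by simp
  also have "\<dots> = (if k = n then f k else Zer C (A k) (B n))"
    using Cmp_rewrite[OF o[OF k n], of "f k"] t'[OF k] t'[OF n] t[OF k] by auto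
  also have "\<dots> = (f n \<cdot> \<pi> n) \<cdot> \<iota> k"
    using t[OF k] t[OF n] t'[OF n] direct_sum_rules[OF s, of k] direct_sum_rules(2)[OF s k n] k
    by auto
  finally show "(\<pi>' n \<cdot> F) \<cdot> \<iota> k = (f n \<cdot> \<pi> n) \<cdot> \<iota> k" .
qed

text \<open>Complete \<open>F\<close> to a triangle and map it to the given one by the components of TR3. The
  comparison arrow is an isomorphism by the usual five lemma chase, which only needs exactness of the
  Hom functors on the two triangles.\<close>

lemma direct_sum_triangle:
  assumes X: "is_direct_sum C N A X \<iota>X \<pi>X" and Y: "is_direct_sum C N B Y \<iota>Y \<pi>Y"
    and Z: "is_direct_sum C N D Z \<iota>Z \<pi>Z"
    and tri: "\<And>n. n \<in> N \<Longrightarrow> (f n, g n, h n) \<in> Tri C"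
    and tri_typing: "\<And>n. n \<in> N \<Longrightarrow> Dom C (f n) = A n \<and> Cod C (f n) = B n \<and> Cod C (g n) = D n"
    and FGH: "F \<in> Hom C X Y" "G \<in> Hom C Y Z" "H \<in> Hom C Z (SO X)"
    and F: "\<And>n. n \<in> N \<Longrightarrow> F \<cdot> \<iota>X n = \<iota>Y n \<cdot> f n"
    and G: "\<And>n. n \<in> N \<Longrightarrow> G \<cdot> \<iota>Y n = \<iota>Z n \<cdot> g n"
    and H: "\<And>n. n \<in> N \<Longrightarrow> H \<cdot> \<iota>Z n = SA (\<iota>X n) \<cdot> h n"
  shows "(F, G, H) \<in> Tri C"
proof -
  note t = direct_sum_typing[OF X] direct_sum_typing[OF Y] direct_sum_typing[OF Z]
  have ob: "X \<in> Ob C" "Y \<in> Ob C" "Z \<in> Ob C"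
    using direct_sum_Ob[OF X] direct_sum_Ob[OF Y] direct_sum_Ob[OF Z] by auto
  have ty: "f n \<in> Ar C" "g n \<in> Ar C" "h n \<in> Ar C" "Dom C (f n) = A n" "Cod C (f n) = B n"
    "Dom C (g n) = B n" "Cod C (g n) = D n" "Dom C (h n) = D n" "Cod C (h n) = SO (A n)"
    if "n \<in> N" for n
    using Tri_typing[OF tri[OF that]] tri_typing[OF that] by auto
  have tF: "F \<in> Ar C" "Dom C F = X" "Cod C F = Y" "G \<in> Ar C" "Dom C G = Y" "Cod C G = Z"
    "H \<in> Ar C" "Dom C H = Z" "Cod C H = SO X"
    using FGH by (auto simp: Hom_def)
  have pF: "\<pi>Y n \<cdot> F = f n \<cdot> \<pi>X n" if "n \<in> N" for n
    using t ty direct_sum_rules[OF Y] that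
    by (intro direct_sum_transpose[OF X _ _ FGH(1) _ F]) (auto simp: Hom_def)
  have pG: "\<pi>Z n \<cdot> G = g n \<cdot> \<pi>Y n" if "n \<in> N" for n
    using t ty direct_sum_rules[OF Z] that
    by (intro direct_sum_transpose[OF Y _ _ FGH(2) _ G]) (auto simp: Hom_def)
  have pH: "SA (\<pi>X n) \<cdot> H = h n \<cdot> \<pi>Z n" if "n \<in> N" for n
  proof (rule direct_sum_transpose[OF Z _ _ FGH(3) _ H])
    fix n k assume "n \<in> N" "k \<in> N"
    then show "SA (\<pi>X k) \<cdot> SA (\<iota>X n) =
        (if n = k then Ide C (SO (A n)) else Zer C (SO (A n)) (SO (A k)))"
      using t direct_sum_rules[OF X, of n] by (auto simp del: Sh_Cmp simp add: Sh_Cmp[symmetric])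
  qed (use t ty that in \<open>auto simp: Hom_def\<close>)
  have mono_Sh: "u = v"
    if s: "is_direct_sum C N E S \<iota> \<pi>" and u: "u \<in> Hom C W (SO S)" "v \<in> Hom C W (SO S)"
      and eq: "\<And>n. n \<in> N \<Longrightarrow> SA (\<pi> n) \<cdot> u = SA (\<pi> n) \<cdot> v" for E S \<iota> \<pi> W u v
    by (rule direct_sum_FA_jointly_monic[OF category_axioms shift_equivalence s u eq])
  obtain g' h' where tri': "(F, g', h') \<in> Tri C" using TR1_cone tF by blast
  define Z' where "Z' = Cod C g'"
  have ty': "g' \<in> Ar C" "h' \<in> Ar C" "Dom C g' = Y" "Cod C g' = Z'" "Dom C h' = Z'"
    "Cod C h' = SO X" "Z' \<in> Ob C"
    using Tri_typing[OF tri'] tF by (auto simp: Z'_def)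
  have "\<exists>c. c \<in> Hom C Z' (D n) \<and> c \<cdot> g' = g n \<cdot> \<pi>Y n \<and> SA (\<pi>X n) \<cdot> h' = h n \<cdot> c" if "n \<in> N" for n
    using TR3[OF tri' tri[OF that], of "\<pi>X n" "\<pi>Y n"] t[OF that] ty[OF that] ty' tF pF[OF that]
    by (auto simp: Hom_def)
  then obtain c where c: "\<And>n. n \<in> N \<Longrightarrow> c n \<in> Hom C Z' (D n)" "\<And>n. n \<in> N \<Longrightarrow> c n \<cdot> g' = g n \<cdot> \<pi>Y n"
    "\<And>n. n \<in> N \<Longrightarrow> SA (\<pi>X n) \<cdot> h' = h n \<cdot> c n"
    by metis
  obtain e where e: "e \<in> Hom C Z' Z" and pe: "\<And>n. n \<in> N \<Longrightarrow> \<pi>Z n \<cdot> e = c n"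
    using direct_sum_pair[OF Z ty'(7) c(1)] by blast
  note te = Hom_rules[OF e(1)]
  have eg: "e \<cdot> g' = G"
  proof (rule direct_sum_jointly_monic[OF Z _ FGH(2)])
    show "e \<cdot> g' \<in> Hom C Y Z" using te ty' by (simp add: Hom_def)
    fix n assume n: "n \<in> N"
    show "\<pi>Z n \<cdot> (e \<cdot> g') = \<pi>Z n \<cdot> G"
      using Cmp_rewrite[OF pe[OF n], of g'] c(2)[OF n] pG[OF n] te ty' t n by simp
  qed
  have He: "H \<cdot> e = h'"
  proof (rule mono_Sh[OF X])
    show "H \<cdot> e \<in> Hom C Z' (SO X)" "h' \<in> Hom C Z' (SO X)"
      using te ty' tF by (simp_all add: Hom_def)
    fix n assume n: "n \<in> N"
    show "SA (\<pi>X n) \<cdot> (H \<cdot> e) = SA (\<pi>X n) \<cdot> h'"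
      using Cmp_rewrite[OF pH[OF n], of e] pe[OF n] c(3)[OF n] te tF t ty n by simp
  qed
  \<comment> \<open>the chase for injectivity\<close>
  have mono: "k = Zer C W Z'" if k: "k \<in> Hom C W Z'" and ek: "e \<cdot> k = Zer C W Z" for k W
  proof -
    have tk: "k \<in> Ar C" "Dom C k = W" "Cod C k = Z'" "W \<in> Ob C"
      using k Hom_Ob[OF k] by (auto simp: Hom_def)
    have "h' \<cdot> k = H \<cdot> (e \<cdot> k)"
      using Cmp_rewrite[OF He, of k] te tF tk by simp
    then have "h' \<cdot> k = Zer C (Dom C k) (Cod C h')"
      using ek tk tF ob ty' by simp
    then obtain y where y: "y \<in> Hom C W Y" "g' \<cdot> y = k"
      using Tri_exact[OF Tri_rotate[OF tri'], of k] tk ty' by auto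
    note ty2 = Hom_rules[OF y(1)]
    have Gy: "G \<cdot> y = Zer C W Z"
      using Cmp_rewrite[OF eg, of y] y(2) ek ty2 te ty' by simp
    have "\<exists>x. x \<in> Hom C W (A n) \<and> f n \<cdot> x = \<pi>Y n \<cdot> y" if n: "n \<in> N" for n
    proof -
      have "g n \<cdot> (\<pi>Y n \<cdot> y) = Zer C W (D n)"
        using Cmp_rewrite[OF pG[OF n], of y] Gy t[OF n] ty[OF n] tF ty2 tk by simp
      then show ?thesis
        using Tri_exact[OF tri[OF n], of "\<pi>Y n \<cdot> y"] t[OF n] ty[OF n] ty2 by auto
    qed
    then obtain x where x: "\<And>n. n \<in> N \<Longrightarrow> x n \<in> Hom C W (A n)" "\<And>n. n \<in> N \<Longrightarrow> f n \<cdot> x n = \<pi>Y n \<cdot> y"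
      by metis
    obtain x0 where x0: "x0 \<in> Hom C W X" "\<And>n. n \<in> N \<Longrightarrow> \<pi>X n \<cdot> x0 = x n"
      using direct_sum_pair[OF X tk(4) x(1)] by blast
    note tx0 = Hom_rules[OF x0(1)]
    have "F \<cdot> x0 = y"
    proof (rule direct_sum_jointly_monic[OF Y _ y(1)])
      show "F \<cdot> x0 \<in> Hom C W Y" using tx0 tF by (simp add: Hom_def)
      show "\<pi>Y n \<cdot> (F \<cdot> x0) = \<pi>Y n \<cdot> y" if n: "n \<in> N" for n
        using Cmp_rewrite[OF pF[OF n], of x0] x0(2)[OF n] x(2)[OF n] t[OF n] ty[OF n] tF tx0 by simp
    qed
    then have "k = g' \<cdot> (F \<cdot> x0)" using y by simp
    also have "\<dots> = Zer C W Z'"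
      using Cmp_rewrite[OF Tri_comp_Zer[OF tri'], of x0] tx0 tF ty' by simp
    finally show ?thesis .
  qed
  \<comment> \<open>the chase for surjectivity, applied to the identity\<close>
  have "SA F \<cdot> H = Zer C Z (SO Y)"
  proof (rule mono_Sh[OF Y])
    show "SA F \<cdot> H \<in> Hom C Z (SO Y)" "Zer C Z (SO Y) \<in> Hom C Z (SO Y)"
      using tF ob by (simp_all add: Hom_def)
    fix n assume n: "n \<in> N"
    have "neg_ar C (SA (f n)) \<cdot> h n = Zer C (D n) (SO (B n))"
      using Tri_comp_Zer[OF Tri_rotate[OF Tri_rotate[OF tri[OF n]]]]
        Tri_comp_Zer[OF Tri_rotate[OF tri[OF n]]] ty[OF n] by simp
    then have "neg_ar C (neg_ar C (SA (f n) \<cdot> h n)) = neg_ar C (Zer C (D n) (SO (B n)))"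
      using ty[OF n] by simp
    then have fh: "SA (f n) \<cdot> h n = Zer C (D n) (SO (B n))"
      using ty[OF n] t[OF n] by simp
    have "SA (\<pi>Y n) \<cdot> SA F = SA (f n) \<cdot> SA (\<pi>X n)"
      using pF[OF n] Sh_Cmp[of F "\<pi>Y n"] Sh_Cmp[of "\<pi>X n" "f n"] t[OF n] ty[OF n] tF by simp
    then have "SA (\<pi>Y n) \<cdot> (SA F \<cdot> H) = SA (f n) \<cdot> (h n \<cdot> \<pi>Z n)"
      using Cmp_rewrite[of "SA (\<pi>Y n)" "SA F" _ H] pH[OF n] t[OF n] ty[OF n] tF by simp
    also have "\<dots> = Zer C Z (SO (B n))"
      using Cmp_rewrite[OF fh, of "\<pi>Z n"] t[OF n] ty[OF n] by simp
    finally show "SA (\<pi>Y n) \<cdot> (SA F \<cdot> H) = SA (\<pi>Y n) \<cdot> Zer C Z (SO Y)"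
      using t[OF n] ob by simp
  qed
  then have "neg_ar C (SA F) \<cdot> H = Zer C (Dom C H) (Cod C (neg_ar C (SA F)))"
    using tF ob by simp
  then obtain z0 where z0: "z0 \<in> Hom C Z Z'" "h' \<cdot> z0 = H"
    using Tri_exact[OF Tri_rotate[OF Tri_rotate[OF tri']], of H] tF ty' by auto
  note tz0 = Hom_rules[OF z0(1)]
  define d where "d = Ide C Z \<oplus>\<^sub>a neg_ar C (e \<cdot> z0)"
  have td: "d \<in> Ar C" "Dom C d = Z" "Cod C d = Z" using te tz0 ob by (simp_all add: d_def)
  have Hd: "H \<cdot> d = Zer C Z (SO X)"
    using Cmp_rewrite[OF He, of z0] z0(2) te tz0 tF ob by (simp add: d_def)
  have "\<exists>y. y \<in> Hom C Z (B n) \<and> g n \<cdot> y = \<pi>Z n \<cdot> d" if n: "n \<in> N" for n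
  proof -
    have "h n \<cdot> (\<pi>Z n \<cdot> d) = Zer C Z (SO (A n))"
      using Cmp_rewrite[OF pH[OF n], of d] Hd t[OF n] ty[OF n] tF td ob by simp
    then show ?thesis
      using Tri_exact[OF Tri_rotate[OF tri[OF n]], of "\<pi>Z n \<cdot> d"] t[OF n] ty[OF n] td by auto
  qed
  then obtain y where y: "\<And>n. n \<in> N \<Longrightarrow> y n \<in> Hom C Z (B n)" "\<And>n. n \<in> N \<Longrightarrow> g n \<cdot> y n = \<pi>Z n \<cdot> d"
    by metis
  obtain y0 where y0: "y0 \<in> Hom C Z Y" "\<And>n. n \<in> N \<Longrightarrow> \<pi>Y n \<cdot> y0 = y n"
    using direct_sum_pair[OF Y ob(3) y(1)] by blast
  note ty0 = Hom_rules[OF y0(1)]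
  have "G \<cdot> y0 = d"
  proof (rule direct_sum_jointly_monic[OF Z])
    show "G \<cdot> y0 \<in> Hom C Z Z" "d \<in> Hom C Z Z" using ty0 tF td by (simp_all add: Hom_def)
    show "\<pi>Z n \<cdot> (G \<cdot> y0) = \<pi>Z n \<cdot> d" if n: "n \<in> N" for n
      using Cmp_rewrite[OF pG[OF n], of y0] y0(2)[OF n] y(2)[OF n] t[OF n] ty[OF n] tF ty0 by simp
  qed
  then have "e \<cdot> (g' \<cdot> y0) = d"
    using Cmp_rewrite[OF eg, of y0] ty0 te ty' by simp
  define z where "z = z0 \<oplus>\<^sub>a g' \<cdot> y0"
  have tz: "z \<in> Ar C" "Dom C z = Z" "Cod C z = Z'" using tz0 ty0 ty' by (simp_all add: z_def)
  have ez: "e \<cdot> z = Ide C Z"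
    using \<open>e \<cdot> (g' \<cdot> y0) = d\<close> diff_add_cancel(2)[of "Ide C Z" "e \<cdot> z0"] te tz0 ty0 ty' ob
    by (simp add: z_def d_def)
  have "e \<cdot> (z \<cdot> e) = e" using Cmp_rewrite[OF ez, of e] tz te by simp
  then have "e \<cdot> (z \<cdot> e \<oplus>\<^sub>a neg_ar C (Ide C Z')) = Zer C Z' Z"
    using te tz ty' by simp
  then have "z \<cdot> e \<oplus>\<^sub>a neg_ar C (Ide C Z') = Zer C Z' Z'"
    using te tz ty' by (intro mono) (simp_all add: Hom_def)
  then have ze: "z \<cdot> e = Ide C Z'"
    using eq_if_diff_Zer[of "z \<cdot> e" "Ide C Z'"] te tz ty' by simp
  have iso: "is_iso C e" using is_isoI[OF e _ ze ez] tz by (simp add: Hom_def)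
  have "iso_triangles C (Sh C) (F, g', h') (F, G, H)"
    unfolding iso_triangles_def split_conv
    using iso te ty' tF ob eg He
    by (intro bexI[of _ "Ide C X"] bexI[of _ "Ide C Y"] bexI[of _ e] conjI) (simp_all add: Hom_def)
  then show ?thesis
    using TR0[OF tri'] tF by (simp add: is_triangle_def)
qed

text \<open>The octahedral axiom presents the cone of \<open>\<eta> \<epsilon>\<close> as an extension of the cokernel of \<open>\<eta>\<close>
  by the shifted kernel of \<open>\<epsilon>\<close> with zero connecting arrow. The splitting is chosen so that the two other
  arrows of the triangle are composites of \<open>q\<close> and \<open>j\<close> with structure arrows of the biproduct; this is
  what later makes them equivariant.\<close>

lemma split_factorization_triangle:
  assumes e: "is_biproduct2 C A B S s j \<epsilon> p" and n: "is_biproduct2 C A D S \<eta> k r q"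
  obtains Z i1 i2 p1 p2 where "is_biproduct2 C (SO B) D Z i1 i2 p1 p2"
    "(\<eta> \<cdot> \<epsilon>, i2 \<cdot> q, neg_ar C (SA j) \<cdot> p1) \<in> Tri C"
proof -
  note te = biproduct_typing[OF e] and tn = biproduct_typing[OF n]
  note re = biproduct_rules[OF e] and rn = biproduct_rules[OF n]
  have tri_e: "(\<epsilon>, Zer C A (SO B), neg_ar C (SA j)) \<in> Tri C"
    by (intro Tri_rotate biproduct_triangle[OF biproduct_swap[OF e]])
  have tri_n: "(\<eta>, q, Zer C D (SO A)) \<in> Tri C"
    by (rule biproduct_triangle[OF n])
  have "\<eta> \<cdot> \<epsilon> \<in> Ar C" using te tn by simp
  then obtain g h where tri: "(\<eta> \<cdot> \<epsilon>, g, h) \<in> Tri C" using TR1_cone by blast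
  define Z where "Z = Cod C g"
  have ty: "g \<in> Ar C" "h \<in> Ar C" "Dom C g = S" "Cod C g = Z" "Dom C h = Z" "Cod C h = SO S" "Z \<in> Ob C"
    using Tri_typing[OF tri] te tn by (auto simp: Z_def)
  obtain u v where uv: "(u, v, SA (Zer C A (SO B)) \<cdot> Zer C D (SO A)) \<in> Tri C"
    and u: "u \<in> Hom C (SO B) Z" and v: "v \<in> Hom C Z D"
    and eqs: "u \<cdot> Zer C A (SO B) = g \<cdot> \<eta>" "h \<cdot> u = neg_ar C (SA j)" "v \<cdot> g = q"
    using TR4[OF tri_e tri_n _ tri] te tn by (auto simp: Z_def)
  note tu = Hom_rules[OF u(1)] Hom_rules[OF v(1)]
  \<comment> \<open>a section of \<open>v\<close>; since \<open>g\<close> kills \<open>\<eta>\<close>, it turns \<open>q\<close> into \<open>g\<close>\<close>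
  define w where "w = g \<cdot> k"
  have tw: "w \<in> Ar C" "Dom C w = D" "Cod C w = Z" using tn ty by (simp_all add: w_def)
  have vw: "v \<cdot> w = Ide C D"
    using Cmp_rewrite[OF eqs(3), of k] tn ty tu rn by (simp add: w_def)
  have gn: "g \<cdot> \<eta> = Zer C A Z" using eqs(1) tu te by simp
  have wq: "w \<cdot> q = g"
  proof -
    have "g = g \<cdot> (\<eta> \<cdot> r \<oplus>\<^sub>a k \<cdot> q)" using rn(5) ty by simp
    also have "\<dots> = (g \<cdot> \<eta>) \<cdot> r \<oplus>\<^sub>a (g \<cdot> k) \<cdot> q" using tn ty by simp
    also have "\<dots> = w \<cdot> q" using gn tn ty by (simp add: w_def)
    finally show ?thesis by simp
  qed
  obtain B' j' q' where b: "is_biproduct2 C D B' Z w j' v q'"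
    using split_mono_complement[OF _ v vw] tw by (metis Ar_Hom)
  note tb = biproduct_typing[OF b] and rb = biproduct_rules[OF b]
  \<comment> \<open>\<open>u\<close> is a kernel of \<open>v\<close>, like \<open>j'\<close>\<close>
  have uv_Zer: "v \<cdot> u = Zer C (SO B) D" using Tri_comp_Zer[OF uv] tu by simp
  have "v \<cdot> j' = Zer C (Dom C j') (Cod C v)" using rb(4) tb by simp
  then obtain l where "l \<in> Hom C (Dom C j') (Dom C u)" and ul: "u \<cdot> l = j'"
    using Tri_exact[OF uv, of j'] tb by auto
  then have l: "l \<in> Ar C" "Dom C l = B'" "Cod C l = SO B" using tu tb by (auto simp: Hom_def)
  have u_mono: "x = Zer C (Dom C x) (SO B)"
    if x: "x \<in> Ar C" "Cod C x = SO B" "u \<cdot> x = Zer C (Dom C x) Z" for x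
  proof -
    \<comment> \<open>\<open>h \<cdot> u\<close> is a split monomorphism\<close>
    have "h \<cdot> (u \<cdot> x) = neg_ar C (SA j) \<cdot> x"
      using Cmp_rewrite[OF eqs(2), of x] x tu ty by simp
    then have "neg_ar C (SA j) \<cdot> x = Zer C (Dom C x) (SO S)"
      using x ty by simp
    then have "SA p \<cdot> (neg_ar C (SA j) \<cdot> x) = Zer C (Dom C x) (SO B)"
      using te x(1) by simp
    moreover have "SA p \<cdot> SA j = Ide C (SO B)"
      using Sh_Cmp[of j p] te re by simp
    ultimately have "neg_ar C x = Zer C (Dom C x) (SO B)"
      using Cmp_rewrite[of "SA p" "SA j" "Ide C (SO B)" x] te x by simp
    then show ?thesis using neg_neg[OF x(1)] neg_Zer[of "Dom C x" "SO B"] x(1) te by simp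
  qed
  define p1 where "p1 = l \<cdot> q'"
  have p1: "p1 \<in> Ar C" "Dom C p1 = Z" "Cod C p1 = SO B" using l tb by (simp_all add: p1_def)
  have up1: "u \<cdot> p1 = j' \<cdot> q'"
    using Cmp_rewrite[OF ul, of q'] l tb tu by (simp add: p1_def)
  have sum: "u \<cdot> p1 \<oplus>\<^sub>a w \<cdot> v = Ide C Z"
    using up1 biproduct_rules(5)[OF biproduct_swap[OF b]] by simp
  have p1u: "p1 \<cdot> u = Ide C (SO B)"
  proof -
    have "(u \<cdot> p1 \<oplus>\<^sub>a w \<cdot> v) \<cdot> u = u" using sum tu by simp
    then have "u \<cdot> (p1 \<cdot> u) = u" using uv_Zer tu tw p1 te by simp
    then have "u \<cdot> (p1 \<cdot> u \<oplus>\<^sub>a neg_ar C (Ide C (SO B))) = Zer C (SO B) Z"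
      using tu p1 te by simp
    then have "p1 \<cdot> u \<oplus>\<^sub>a neg_ar C (Ide C (SO B)) = Zer C (SO B) (SO B)"
      using u_mono[of "p1 \<cdot> u \<oplus>\<^sub>a neg_ar C (Ide C (SO B))"] tu p1 te by simp
    then show ?thesis
      using eq_if_diff_Zer[of "p1 \<cdot> u" "Ide C (SO B)"] tu p1 te by simp
  qed
  have p1w: "p1 \<cdot> w = Zer C D (SO B)"
    using rb(3) l tb by (simp add: p1_def)
  have "is_biproduct2 C (SO B) D Z u w p1 v"
    unfolding is_biproduct2_def
    using tu tw p1 te tn ty vw uv_Zer p1u p1w sum by (simp add: Hom_def)
  moreover have "neg_ar C (SA j) \<cdot> p1 = h"
  proof -
    have hw: "h \<cdot> w = Zer C D (SO S)"
      using Cmp_rewrite[OF Tri_comp_Zer[OF Tri_rotate[OF tri]], of k] ty tn by (simp add: w_def)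
    have "h = h \<cdot> (u \<cdot> p1 \<oplus>\<^sub>a w \<cdot> v)" using sum ty by simp
    also have "\<dots> = (h \<cdot> u) \<cdot> p1 \<oplus>\<^sub>a (h \<cdot> w) \<cdot> v" using ty tu tw p1 by simp
    also have "\<dots> = neg_ar C (SA j) \<cdot> p1" using hw eqs(2) ty tu p1 te by simp
    finally show ?thesis by simp
  qed
  ultimately show ?thesis using that wq tri by metis
qed

end

section \<open>Tensor products of arrows\<close>

context monoidal_category
begin

lemma TO_Ob' [simp]: "A \<in> Ob K \<Longrightarrow> B \<in> Ob K \<Longrightarrow> TO K A B \<in> Ob K"
  by (rule TO_Ob)

lemma TA_typing [simp]:
  assumes "f \<in> Ar K" "g \<in> Ar K"
  shows "TA K f g \<in> Ar K" "Dom K (TA K f g) = TO K (Dom K f) (Dom K g)"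
    "Cod K (TA K f g) = TO K (Cod K f) (Cod K g)"
  using TA_Hom[OF Ar_Hom Ar_Hom, OF assms] by (auto simp: Hom_def)

lemma TA_Ide' [simp]: "A \<in> Ob K \<Longrightarrow> B \<in> Ob K \<Longrightarrow> TA K (Ide K A) (Ide K B) = Ide K (TO K A B)"
  by (rule TA_Ide)

lemma TA_merge:
  assumes "f \<in> Ar K" "g \<in> Ar K" "f' \<in> Ar K" "g' \<in> Ar K" "Dom K f' = Cod K f" "Dom K g' = Cod K g"
  shows "TA K f' g' \<cdot> TA K f g = TA K (f' \<cdot> f) (g' \<cdot> g)"
  using TA_Cmp[of f "Dom K f" "Cod K f" f' "Cod K f'" g "Dom K g" "Cod K g" g' "Cod K g'"] assms
  by (simp add: Hom_def)

lemma TA_is_iso [simp]: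
  assumes "is_iso K f" "is_iso K g"
  shows "is_iso K (TA K f g)"
  using assms is_iso_Ar[OF assms(1)] is_iso_Ar[OF assms(2)]
  by (intro is_isoI[of _ "TO K (Dom K f) (Dom K g)" "TO K (Cod K f) (Cod K g)"
        "TA K (inv_ar K f) (inv_ar K g)"]) (simp_all add: TA_merge Hom_def)

end

context monoidal_triangulated_category
begin

lemma TA_Zer:
  assumes "f \<in> Ar K" "X \<in> Ob K" "Y \<in> Ob K"
  shows "TA K f (Zer K X Y) = Zer K (TO K (Dom K f) X) (TO K (Cod K f) Y)"
proof -
  have "additive_functor K K (tensor_left K (Dom K f))"
    using exact_left[of "Dom K f"] assms by (auto simp: exact_functor_def)
  then have z: "TA K (Ide K (Dom K f)) (Zer K X Y) = Zer K (TO K (Dom K f) X) (TO K (Dom K f) Y)"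
    using additive_functor_Zer[OF additive_category_axioms additive_category_axioms, of _ X Y] assms
    by (force simp: tensor_left_def)
  have "TA K f (Zer K X Y) = TA K f (Ide K Y) \<cdot> TA K (Ide K (Dom K f)) (Zer K X Y)"
    using assms by (subst TA_merge) simp_all
  then show ?thesis using z assms by simp
qed

end

section \<open>The action and equivariant objects\<close>

context mt_action
begin

abbreviation cmpK (infixl "\<odot>" 70) where "f \<odot> g \<equiv> f \<cdot>\<^bsub>K\<^esub> g"
abbreviation addK (infixl "\<boxplus>" 65) where "f \<boxplus> g \<equiv> f \<oplus>\<^sub>a\<^bsub>K\<^esub> g"
abbreviation mulG (infixl "\<ast>" 75) where "g \<ast> h \<equiv> g \<otimes>\<^bsub>G\<^esub> h"
abbreviation "eG \<equiv> \<one>\<^bsub>G\<^esub>"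
abbreviation "act_ob g \<equiv> FO (T \<T> g)"
abbreviation "act_ar g \<equiv> FA (T \<T> g)"
abbreviation "EO \<equiv> equivariant_objects G K \<T>"
abbreviation "KG \<equiv> equivariantization G K \<T>"
abbreviation "shift \<equiv> eq_shift G K \<T>"
abbreviation "tensor \<equiv> eq_tensor G K \<T>"
abbreviation "Ind' \<equiv> Ind G K \<T>"
abbreviation "E \<equiv> equivariant_ideal G K \<T>"
abbreviation "R \<equiv> restricted_ideal G K \<T>"

lemma act_functor: "g \<in> carrier G \<Longrightarrow> cat_functor K K (T \<T> g)"
  using T_equivalence by (simp add: cat_equivalence_def)

lemma act_Ob [simp]: "g \<in> carrier G \<Longrightarrow> A \<in> Ob K \<Longrightarrow> act_ob g A \<in> Ob K"
  using cat_functor.FO_Ob[OF act_functor] .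

lemma act_typing [simp]:
  assumes "g \<in> carrier G" "f \<in> Ar K"
  shows "act_ar g f \<in> Ar K" "Dom K (act_ar g f) = act_ob g (Dom K f)" "Cod K (act_ar g f) = act_ob g (Cod K f)"
  using cat_functor.FA_typing[OF act_functor category_axioms] assms by auto

lemma act_Cmp [simp]:
  "g \<in> carrier G \<Longrightarrow> f \<in> Ar K \<Longrightarrow> f' \<in> Ar K \<Longrightarrow> Dom K f' = Cod K f \<Longrightarrow>
     act_ar g (f' \<odot> f) = act_ar g f' \<odot> act_ar g f"
  using cat_functor.FA_Cmp'[OF act_functor] .

lemma act_Ide [simp]: "g \<in> carrier G \<Longrightarrow> A \<in> Ob K \<Longrightarrow> act_ar g (Ide K A) = Ide K (act_ob g A)"
  using cat_functor.FA_Ide[OF act_functor] .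

lemma act_is_iso [simp]: "g \<in> carrier G \<Longrightarrow> is_iso K f \<Longrightarrow> is_iso K (act_ar g f)"
  using cat_functor.FA_is_iso[OF act_functor category_axioms] .

lemma act_inv [simp]:
  "g \<in> carrier G \<Longrightarrow> is_iso K f \<Longrightarrow> act_ar g (inv_ar K f) = inv_ar K (act_ar g f)"
  using cat_functor.FA_inv[OF act_functor category_axioms category_axioms] .

lemma act_additive: "g \<in> carrier G \<Longrightarrow> additive_functor K K (T \<T> g)"
  using T_exact by (simp add: exact_functor_def)

lemma act_Zer [simp]:
  "g \<in> carrier G \<Longrightarrow> X \<in> Ob K \<Longrightarrow> Y \<in> Ob K \<Longrightarrow> act_ar g (Zer K X Y) = Zer K (act_ob g X) (act_ob g Y)"
  using additive_functor_Zer[OF additive_category_axioms additive_category_axioms act_additive] .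

lemma act_Add [simp]:
  assumes "g \<in> carrier G" "f \<in> Ar K" "f' \<in> Ar K" "Dom K f' = Dom K f" "Cod K f' = Cod K f"
  shows "act_ar g (f \<boxplus> f') = act_ar g f \<boxplus> act_ar g f'"
proof -
  have "f \<in> Hom K (Dom K f) (Cod K f)" "f' \<in> Hom K (Dom K f) (Cod K f)"
    using assms by (auto simp: Hom_def)
  then show ?thesis
    using act_additive[OF assms(1)] assms unfolding additive_functor_def by (meson Dom_Ob Cod_Ob)
qed

lemma act_neg [simp]: "g \<in> carrier G \<Longrightarrow> f \<in> Ar K \<Longrightarrow> act_ar g (neg_ar K f) = neg_ar K (act_ar g f)"
  using act_Add[of g f "neg_ar K f"] by (intro neg_eqI) simp_all

lemma act_faithful:
  assumes "g \<in> carrier G" "f \<in> Hom K X Y" "f' \<in> Hom K X Y" "act_ar g f = act_ar g f'"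
  shows "f = f'"
  using equivalence_faithful[OF category_axioms T_equivalence] assms .

lemma act_full:
  assumes "g \<in> carrier G" "X \<in> Ob K" "Y \<in> Ob K" "k \<in> Hom K (act_ob g X) (act_ob g Y)"
  obtains f where "f \<in> Hom K X Y" "act_ar g f = k"
  using equivalence_full[OF category_axioms category_axioms T_equivalence] assms by blast

lemma gam_typing [simp]:
  assumes "g \<in> carrier G" "h \<in> carrier G" "A \<in> Ob K"
  shows "gam \<T> g h A \<in> Ar K" "Dom K (gam \<T> g h A) = act_ob g (act_ob h A)"
    "Cod K (gam \<T> g h A) = act_ob (g \<ast> h) A" "is_iso K (gam \<T> g h A)"
  using gam_nat_iso[OF assms(1,2)] assms(3) by (auto simp: nat_iso_def comp_funct_def Hom_def)

lemma gam_nat: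
  assumes "g \<in> carrier G" "h \<in> carrier G" "f \<in> Ar K"
  shows "gam \<T> g h (Cod K f) \<odot> act_ar g (act_ar h f) = act_ar (g \<ast> h) f \<odot> gam \<T> g h (Dom K f)"
  using gam_nat_iso[OF assms(1,2)] assms(3) by (auto simp: nat_iso_def comp_funct_def)

lemma mu_typing [simp]:
  assumes "g \<in> carrier G" "A \<in> Ob K" "B \<in> Ob K"
  shows "mu \<T> g A B \<in> Ar K" "Dom K (mu \<T> g A B) = TO K (act_ob g A) (act_ob g B)"
    "Cod K (mu \<T> g A B) = act_ob g (TO K A B)" "is_iso K (mu \<T> g A B)"
  using T_monoidal[OF assms(1)] assms(2,3) by (auto simp: monoidal_functor_def Hom_def)

lemma mu_nat:
  assumes "g \<in> carrier G" "f \<in> Ar K" "f' \<in> Ar K"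
  shows "mu \<T> g (Cod K f) (Cod K f') \<odot> TA K (act_ar g f) (act_ar g f') =
    act_ar g (TA K f f') \<odot> mu \<T> g (Dom K f) (Dom K f')"
  using T_monoidal[OF assms(1)] assms(2,3) by (auto simp: monoidal_functor_def)

lemma xi_typing [simp]:
  assumes "g \<in> carrier G" "A \<in> Ob K"
  shows "xi \<T> g A \<in> Ar K" "Dom K (xi \<T> g A) = act_ob g (SO A)"
    "Cod K (xi \<T> g A) = SO (act_ob g A)" "is_iso K (xi \<T> g A)"
  using T_exact[OF assms(1)] assms(2) by (auto simp: exact_functor_def nat_iso_def comp_funct_def Hom_def)

lemma xi_nat:
  assumes "g \<in> carrier G" "f \<in> Ar K"
  shows "xi \<T> g (Cod K f) \<odot> act_ar g (SA f) = SA (act_ar g f) \<odot> xi \<T> g (Dom K f)"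
  using T_exact[OF assms(1)] assms(2) by (auto simp: exact_functor_def nat_iso_def comp_funct_def)

lemma act_Tri:
  assumes "g \<in> carrier G" "(f, f', f'') \<in> Tri K"
  shows "(act_ar g f, act_ar g f', xi \<T> g (Dom K f) \<odot> act_ar g f'') \<in> Tri K"
  using T_exact[OF assms(1)] assms(2) by (auto simp: exact_functor_def)

text \<open>The isomorphism between the action of the neutral element and the identity functor is not part of
  the data; it is recovered from \<^term>\<open>gam \<T> eG eG\<close> by full faithfulness.\<close>

definition unit_ar :: "'o \<Rightarrow> 'm" where
  "unit_ar A = (SOME u. u \<in> Hom K (act_ob eG A) A \<and> act_ar eG u = gam \<T> eG eG A)"

lemma unit_ar:
  assumes "A \<in> Ob K"
  shows "unit_ar A \<in> Hom K (act_ob eG A) A" "act_ar eG (unit_ar A) = gam \<T> eG eG A"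
proof -
  have "gam \<T> eG eG A \<in> Hom K (act_ob eG (act_ob eG A)) (act_ob eG A)"
    using assms by (simp add: Hom_def)
  then have "\<exists>u. u \<in> Hom K (act_ob eG A) A \<and> act_ar eG u = gam \<T> eG eG A"
    using act_full[of "eG" "act_ob eG A" A] assms by (metis act_Ob one_closed)
  from someI_ex[OF this]
  show "unit_ar A \<in> Hom K (act_ob eG A) A" "act_ar eG (unit_ar A) = gam \<T> eG eG A"
    by (auto simp: unit_ar_def)
qed

lemma unit_typing [simp]:
  assumes "A \<in> Ob K"
  shows "unit_ar A \<in> Ar K" "Dom K (unit_ar A) = act_ob eG A" "Cod K (unit_ar A) = A"
  using unit_ar[OF assms] by (auto simp: Hom_def)

lemma unit_is_iso [simp]:
  assumes A: "A \<in> Ob K"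
  shows "is_iso K (unit_ar A)"
proof -
  let ?g = "gam \<T> eG eG A" and ?T = "act_ob eG"
  have "inv_ar K ?g \<in> Hom K (?T A) (?T (?T A))"
    using A by (simp add: Hom_def)
  then obtain v where v: "v \<in> Hom K A (?T A)" "act_ar eG v = inv_ar K ?g"
    using act_full[of "eG" A "?T A"] A by (metis act_Ob one_closed)
  note v' = Hom_rules[OF v(1)]
  have "unit_ar A \<odot> v = Ide K A"
    by (rule act_faithful[of "eG" _ A A]) (use v v' A unit_ar(2) in \<open>simp_all add: Hom_def\<close>)
  moreover have "v \<odot> unit_ar A = Ide K (?T A)"
    by (rule act_faithful[of "eG" _ "?T A" "?T A"]) (use v v' A unit_ar(2) in \<open>simp_all add: Hom_def\<close>)
  ultimately show ?thesis
    using is_isoI[OF unit_ar(1)[OF A] v(1)] by simp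
qed

lemma unit_nat:
  assumes f: "f \<in> Ar K"
  shows "unit_ar (Cod K f) \<odot> act_ar eG f = f \<odot> unit_ar (Dom K f)"
proof (rule act_faithful[of "eG"])
  show "act_ar eG (unit_ar (Cod K f) \<odot> act_ar eG f) = act_ar eG (f \<odot> unit_ar (Dom K f))"
    using f gam_nat[of "eG" "eG" f] unit_ar(2) by simp
qed (use f in \<open>simp_all add: Hom_def\<close>)

lemma gam_one:
  assumes g: "g \<in> carrier G" and A: "A \<in> Ob K"
  shows "gam \<T> eG g A = unit_ar (act_ob g A)"
proof (rule act_faithful[of "eG"])
  have "gam \<T> eG g A \<odot> act_ar eG (gam \<T> eG g A) = gam \<T> eG g A \<odot> gam \<T> eG eG (act_ob g A)"
    using gam_cocycle[of "eG" "eG" g A] g A by simp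
  then have "act_ar eG (gam \<T> eG g A) = gam \<T> eG eG (act_ob g A)"
    by (rule iso_cancel_left[rotated]) (use g A in simp_all)
  then show "act_ar eG (gam \<T> eG g A) = act_ar eG (unit_ar (act_ob g A))"
    using unit_ar(2) g A by simp
qed (use g A in \<open>simp_all add: Hom_def\<close>)

lemma EO_rules:
  assumes "X \<in> EO"
  shows EO_Ob: "fst X \<in> Ob K" and EO_ext: "snd X \<in> extensional (carrier G)"
    and EO_typing: "\<And>g. g \<in> carrier G \<Longrightarrow> snd X g \<in> Ar K"
      "\<And>g. g \<in> carrier G \<Longrightarrow> Dom K (snd X g) = act_ob g (fst X)"
      "\<And>g. g \<in> carrier G \<Longrightarrow> Cod K (snd X g) = fst X"
      "\<And>g. g \<in> carrier G \<Longrightarrow> is_iso K (snd X g)"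
    and EO_cocycle: "\<And>g h. g \<in> carrier G \<Longrightarrow> h \<in> carrier G \<Longrightarrow>
       snd X (g \<ast> h) \<odot> gam \<T> g h (fst X) = snd X g \<odot> act_ar g (snd X h)"
  using assms by (auto simp: equivariant_objects_def Hom_def)

lemmas EO_simps [simp] = EO_Ob EO_typing

lemma EO_one:
  assumes X: "X \<in> EO"
  shows "snd X eG = unit_ar (fst X)"
proof (rule act_faithful[of "eG"])
  have "snd X eG \<odot> gam \<T> eG eG (fst X) = snd X eG \<odot> act_ar eG (snd X eG)"
    using EO_cocycle[OF X, of "eG" "eG"] by simp
  then have "gam \<T> eG eG (fst X) = act_ar eG (snd X eG)"
    by (rule iso_cancel_left[rotated]) (use X in simp_all)
  then show "act_ar eG (snd X eG) = act_ar eG (unit_ar (fst X))"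
    using unit_ar(2) X by simp
qed (use X in \<open>simp_all add: Hom_def\<close>)

text \<open>A family satisfying the cocycle condition consists of isomorphisms as soon as its value at the
  neutral element is one: the relations for \<open>(g, g\<inverse>)\<close> and \<open>(g\<inverse>, g)\<close> make \<open>\<phi> g\<close> a split
  epimorphism and a split monomorphism.\<close>

lemma equivariant_objectI:
  assumes A: "A \<in> Ob K" and \<phi>: "\<And>g. g \<in> carrier G \<Longrightarrow> \<phi> g \<in> Hom K (act_ob g A) A"
    and cocycle: "\<And>g h. g \<in> carrier G \<Longrightarrow> h \<in> carrier G \<Longrightarrow>
       \<phi> (g \<ast> h) \<odot> gam \<T> g h A = \<phi> g \<odot> act_ar g (\<phi> h)"
    and one: "\<phi> eG = unit_ar A"
  shows "(A, restrict \<phi> (carrier G)) \<in> EO"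
proof -
  have t: "\<phi> g \<in> Ar K" "Dom K (\<phi> g) = act_ob g A" "Cod K (\<phi> g) = A" if "g \<in> carrier G" for g
    using \<phi>[OF that] by (auto simp: Hom_def)
  have "is_iso K (\<phi> g)" if g: "g \<in> carrier G" for g
  proof -
    let ?h = "inv\<^bsub>G\<^esub> g"
    have h: "?h \<in> carrier G" "g \<ast> ?h = eG" "?h \<ast> g = eG" using g by simp_all
    let ?a = "unit_ar A \<odot> gam \<T> g ?h A" and ?b = "unit_ar A \<odot> gam \<T> ?h g A"
    have a: "\<phi> g \<odot> act_ar g (\<phi> ?h) = ?a" and b: "\<phi> ?h \<odot> act_ar ?h (\<phi> g) = ?b"
      using cocycle[OF g h(1)] cocycle[OF h(1) g] h one by simp_all
    have ab: "is_iso K ?a" "is_iso K ?b" using A g h by simp_all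
    have ta: "?a \<in> Ar K" "Dom K ?a = act_ob g (act_ob ?h A)" "Cod K ?a = A"
      "?b \<in> Ar K" "Dom K ?b = act_ob ?h (act_ob g A)" "Cod K ?b = A"
      using A g h by simp_all
    have r: "\<phi> g \<odot> (act_ar g (\<phi> ?h) \<odot> inv_ar K ?a) = Ide K A"
      using Cmp_rewrite[OF a, of "inv_ar K ?a"] t[OF g] t[OF h(1)] ta(1-3) g ab(1)
        inv_typing[OF ab(1)] by simp
    have l: "(inv_ar K ?b \<odot> \<phi> ?h) \<odot> act_ar ?h (\<phi> g) = Ide K (act_ob ?h (act_ob g A))"
      using b t[OF g] t[OF h(1)] ta(4-6) h(1) inv_typing[OF ab(2)] by simp
    have "inv_ar K ?b \<odot> \<phi> ?h \<in> Hom K (act_ob ?h A) (act_ob ?h (act_ob g A))"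
      using t[OF h(1)] ta(4-6) inv_typing[OF ab(2)] by (simp add: Hom_def)
    then obtain s where s: "s \<in> Hom K A (act_ob g A)" "act_ar ?h s = inv_ar K ?b \<odot> \<phi> ?h"
      using act_full[OF h(1) A, of "act_ob g A"] g A by (metis act_Ob)
    note ts = Hom_rules[OF s(1)]
    have "act_ar ?h (s \<odot> \<phi> g) = act_ar ?h (Ide K (act_ob g A))"
      using l s(2) ts t[OF g] h(1) g A by simp
    then have "s \<odot> \<phi> g = Ide K (act_ob g A)"
      by (rule act_faithful[OF h(1), rotated 2]) (use ts t[OF g] g A in \<open>simp_all add: Hom_def\<close>)
    moreover have "act_ar g (\<phi> ?h) \<odot> inv_ar K ?a \<in> Hom K A (act_ob g A)"
      using t[OF h(1)] ta(1-3) inv_typing[OF ab(1)] g by (simp add: Hom_def)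
    ultimately show ?thesis
      using split_mono_epi_iso[OF \<phi>[OF g] s(1) _ _ r] by simp
  qed
  then show ?thesis
    using A \<phi> cocycle by (auto simp: equivariant_objects_def)
qed

section \<open>Arrows of the equivariantization\<close>

definition eq_arrow :: "('g, 'o, 'm) eq_ob \<Rightarrow> ('g, 'o, 'm) eq_ob \<Rightarrow> 'm \<Rightarrow> bool" where
  "eq_arrow X Y f \<longleftrightarrow> X \<in> EO \<and> Y \<in> EO \<and> f \<in> Hom K (fst X) (fst Y) \<and>
     (\<forall>g \<in> carrier G. f \<odot> snd X g = snd Y g \<odot> act_ar g f)"

lemma eq_arrow_rules:
  assumes "eq_arrow X Y f"
  shows "X \<in> EO" "Y \<in> EO" "f \<in> Ar K" "Dom K f = fst X" "Cod K f = fst Y"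
    "\<And>g. g \<in> carrier G \<Longrightarrow> f \<odot> snd X g = snd Y g \<odot> act_ar g f"
  using assms by (auto simp: eq_arrow_def Hom_def)

lemma eq_arrows_iff: "(X, Y, f) \<in> eq_arrows G K \<T> \<longleftrightarrow> eq_arrow X Y f"
  by (cases X; cases Y) (auto simp: eq_arrows_def eq_arrow_def)

lemma KG_simps [simp]:
  "Ob KG = EO" "Ar KG = eq_arrows G K \<T>" "Dom KG (X, Y, f) = X" "Cod KG (X, Y, f) = Y"
  "Ide KG X = (X, X, Ide K (fst X))" "Cmp KG (Y, Z, g) (X, Y', f) = (X, Z, g \<odot> f)"
  "FO (Sh KG) X = shift X" "Zer KG X Y = (X, Y, Zer K (fst X) (fst Y))"
  "Add KG (X, Y, f) (X', Y'', h) = (X, Y, f \<boxplus> h)" "TO KG X Y = tensor X Y"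
  by (simp_all add: equivariantization_def Let_def)

lemma Hom_KG [simp]: "(X', Y', f) \<in> Hom KG X Y \<longleftrightarrow> X' = X \<and> Y' = Y \<and> eq_arrow X Y f"
  by (auto simp: Hom_def eq_arrows_iff)

lemma Tri_KG:
  "((X, Y, f), (Y', Z, g), (Z', W, h)) \<in> Tri KG \<longleftrightarrow> eq_arrow X Y f \<and> eq_arrow Y Z g \<and>
     eq_arrow Z (shift X) h \<and> Y' = Y \<and> Z' = Z \<and> W = shift X \<and> (f, g, h) \<in> Tri K"
  by (auto simp: equivariantization_def Let_def eq_arrows_iff)

lemma eq_arrow_Ide: "X \<in> EO \<Longrightarrow> eq_arrow X X (Ide K (fst X))"
  by (simp add: eq_arrow_def Hom_def)

lemma eq_arrow_Zer: "X \<in> EO \<Longrightarrow> Y \<in> EO \<Longrightarrow> eq_arrow X Y (Zer K (fst X) (fst Y))"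
  by (simp add: eq_arrow_def Hom_def)

lemma eq_arrow_neg:
  assumes f: "eq_arrow X Y f"
  shows "eq_arrow X Y (neg_ar K f)"
  unfolding eq_arrow_def using eq_arrow_rules[OF f] by (simp add: Hom_def)

lemma eq_arrow_Cmp:
  assumes f: "eq_arrow X Y f" and g: "eq_arrow Y Z g"
  shows "eq_arrow X Z (g \<odot> f)"
proof -
  note rf = eq_arrow_rules[OF f] and rg = eq_arrow_rules[OF g]
  have "(g \<odot> f) \<odot> snd X a = snd Z a \<odot> act_ar a (g \<odot> f)" if a: "a \<in> carrier G" for a
  proof -
    have "(g \<odot> f) \<odot> snd X a = g \<odot> (snd Y a \<odot> act_ar a f)"
      using rf rg a by simp
    also have "\<dots> = (snd Z a \<odot> act_ar a g) \<odot> act_ar a f"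
      using Cmp_rewrite[OF rg(6)[OF a], of "act_ar a f"] rf(1-5) rg(1-5) a by simp
    finally show ?thesis using rf(1-5) rg(1-5) a by simp
  qed
  then show ?thesis using rf rg by (simp add: eq_arrow_def Hom_def)
qed

lemma eq_arrow_inv:
  assumes f: "eq_arrow X Y f" and iso: "is_iso K f"
  shows "eq_arrow Y X (inv_ar K f)"
proof -
  note r = eq_arrow_rules[OF f]
  have "inv_ar K f \<odot> snd Y g = snd X g \<odot> act_ar g (inv_ar K f)" if g: "g \<in> carrier G" for g
  proof (rule iso_cancel_left[OF iso])
    have "f \<odot> (snd X g \<odot> act_ar g (inv_ar K f)) = (snd Y g \<odot> act_ar g f) \<odot> inv_ar K (act_ar g f)"
      using Cmp_rewrite[OF r(6)[OF g], of "inv_ar K (act_ar g f)"] r(1-5) iso g by simp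
    then show "f \<odot> (inv_ar K f \<odot> snd Y g) = f \<odot> (snd X g \<odot> act_ar g (inv_ar K f))"
      using r(1-5) iso g by simp
  qed (use r(1-5) iso g in simp_all)
  then show ?thesis using r(1-5) iso by (simp add: eq_arrow_def Hom_def)
qed

text \<open>A retract in \<open>K\<close> of an equivariant object inherits a structure if the given structure
  preserves the image of the section, as for kernels, or descends along the retraction, as for cokernels.\<close>

definition retract_structure :: "('g, 'o, 'm) eq_ob \<Rightarrow> 'm \<Rightarrow> 'm \<Rightarrow> ('g, 'o, 'm) eq_ob" where
  "retract_structure Y j q = (Dom K j, \<lambda>g \<in> carrier G. q \<odot> (snd Y g \<odot> act_ar g j))"

lemma retract_structure_simps [simp]:
  "fst (retract_structure Y j q) = Dom K j"
  "g \<in> carrier G \<Longrightarrow> snd (retract_structure Y j q) g = q \<odot> (snd Y g \<odot> act_ar g j)"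
  by (simp_all add: retract_structure_def)

lemma retract_structure_EO:
  assumes Y: "Y \<in> EO" and j: "j \<in> Hom K B (fst Y)" and q: "q \<in> Hom K (fst Y) B" and qj: "q \<odot> j = Ide K B"
    and compat: "\<And>g h. g \<in> carrier G \<Longrightarrow> h \<in> carrier G \<Longrightarrow>
      q \<odot> (snd Y g \<odot> act_ar g (j \<odot> (q \<odot> (snd Y h \<odot> act_ar h j)))) =
      q \<odot> (snd Y g \<odot> act_ar g (snd Y h \<odot> act_ar h j))"
  shows "retract_structure Y j q \<in> EO"
proof -
  let ?\<kappa> = "\<lambda>g. q \<odot> (snd Y g \<odot> act_ar g j)"
  have t: "j \<in> Ar K" "Dom K j = B" "Cod K j = fst Y" "q \<in> Ar K" "Dom K q = fst Y" "Cod K q = B" "B \<in> Ob K"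
    using j q Hom_Ob[OF j] by (auto simp: Hom_def)
  have "(B, restrict ?\<kappa> (carrier G)) \<in> EO"
  proof (rule equivariant_objectI)
    show "B \<in> Ob K" by (rule t(7))
    show "?\<kappa> g \<in> Hom K (act_ob g B) B" if "g \<in> carrier G" for g
      using t that Y by (simp add: Hom_def)
    show "?\<kappa> eG = unit_ar B"
    proof -
      have "?\<kappa> eG = q \<odot> (j \<odot> unit_ar B)"
        using unit_nat[OF t(1)] EO_one[OF Y] t by simp
      also have "\<dots> = unit_ar B"
        using Cmp_rewrite[OF qj, of "unit_ar B"] t by simp
      finally show ?thesis .
    qed
    show "?\<kappa> (g \<ast> h) \<odot> gam \<T> g h B = ?\<kappa> g \<odot> act_ar g (?\<kappa> h)"
      if g: "g \<in> carrier G" and h: "h \<in> carrier G" for g h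
    proof -
      have "?\<kappa> (g \<ast> h) \<odot> gam \<T> g h B = q \<odot> (snd Y (g \<ast> h) \<odot> (act_ar (g \<ast> h) j \<odot> gam \<T> g h B))"
        using t Y g h by simp
      also have "act_ar (g \<ast> h) j \<odot> gam \<T> g h B = gam \<T> g h (fst Y) \<odot> act_ar g (act_ar h j)"
        using gam_nat[OF g h t(1)] t by simp
      also have "snd Y (g \<ast> h) \<odot> (gam \<T> g h (fst Y) \<odot> act_ar g (act_ar h j)) =
          (snd Y g \<odot> act_ar g (snd Y h)) \<odot> act_ar g (act_ar h j)"
        using Cmp_rewrite[OF EO_cocycle[OF Y g h], of "act_ar g (act_ar h j)"] t Y g h by simp
      also have "q \<odot> \<dots> = q \<odot> (snd Y g \<odot> act_ar g (snd Y h \<odot> act_ar h j))"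
        using t Y g h by simp
      also have "\<dots> = q \<odot> (snd Y g \<odot> act_ar g (j \<odot> (q \<odot> (snd Y h \<odot> act_ar h j))))"
        using compat[OF g h] by simp
      also have "\<dots> = ?\<kappa> g \<odot> act_ar g (?\<kappa> h)"
        using t Y g h by simp
      finally show ?thesis .
    qed
  qed
  then show ?thesis using t by (simp add: retract_structure_def)
qed

lemma kernel_structure:
  assumes e: "eq_arrow Y X \<epsilon>" and b: "is_biproduct2 K (fst X) B (fst Y) s j \<epsilon> q"
  shows "eq_arrow (retract_structure Y j q) Y j"
proof -
  note t = biproduct_typing[OF b] and r = biproduct_rules[OF b] and c = biproduct_cancel[OF b]
  note re = eq_arrow_rules[OF e]
  \<comment> \<open>the structure of \<open>Y\<close> maps the kernel into the kernel\<close>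
  have stable: "j \<odot> (q \<odot> (snd Y g \<odot> act_ar g j)) = snd Y g \<odot> act_ar g j" if g: "g \<in> carrier G" for g
  proof (rule biproduct_jointly_monic[OF b])
    have "\<epsilon> \<odot> (snd Y g \<odot> act_ar g j) = snd X g \<odot> (act_ar g \<epsilon> \<odot> act_ar g j)"
      using Cmp_rewrite[OF re(6)[OF g], of "act_ar g j"] re(1-5) t g by simp
    also have "act_ar g \<epsilon> \<odot> act_ar g j = act_ar g (\<epsilon> \<odot> j)" using t g by simp
    also have "\<dots> = Zer K (act_ob g B) (act_ob g (fst X))" using r(4) t g by simp
    finally show "\<epsilon> \<odot> (j \<odot> (q \<odot> (snd Y g \<odot> act_ar g j))) = \<epsilon> \<odot> (snd Y g \<odot> act_ar g j)"
      using t g re(1,2) by (simp add: c)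
    show "q \<odot> (j \<odot> (q \<odot> (snd Y g \<odot> act_ar g j))) = q \<odot> (snd Y g \<odot> act_ar g j)"
      using t g re(1,2) by (simp add: c)
  qed (use t g re(1,2) in simp_all)
  have "retract_structure Y j q \<in> EO"
    by (rule retract_structure_EO[of _ _ B]) (use t re(1,2) r stable in \<open>auto simp: Hom_def\<close>)
  then show ?thesis
    using t stable re(1) by (simp add: eq_arrow_def Hom_def)
qed

lemma cokernel_structure:
  assumes e: "eq_arrow X Y \<eta>" and b: "is_biproduct2 K (fst X) D (fst Y) \<eta> k r q"
  shows "eq_arrow Y (retract_structure Y k q) q"
proof -
  note t = biproduct_typing[OF b] and ru = biproduct_rules[OF b] and c = biproduct_cancel[OF b]
  note re = eq_arrow_rules[OF e]
  \<comment> \<open>the structure of \<open>Y\<close> descends to the cokernel\<close>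
  have stable: "q \<odot> (snd Y g \<odot> (act_ar g k \<odot> act_ar g q)) = q \<odot> snd Y g" if g: "g \<in> carrier G" for g
  proof -
    have "q \<odot> snd Y g = (q \<odot> snd Y g) \<odot> act_ar g (\<eta> \<odot> r \<boxplus> k \<odot> q)"
      using ru(5) re(1,2) t g by simp
    also have "\<dots> = q \<odot> (snd Y g \<odot> (act_ar g \<eta> \<odot> act_ar g r)) \<boxplus> q \<odot> (snd Y g \<odot> (act_ar g k \<odot> act_ar g q))"
      using re(1,2) t g by simp
    also have "snd Y g \<odot> (act_ar g \<eta> \<odot> act_ar g r) = \<eta> \<odot> (snd X g \<odot> act_ar g r)"
      using Cmp_rewrite[OF re(6)[OF g, symmetric], of "act_ar g r"] re(1-5) t g by simp
    also have "q \<odot> \<dots> = Zer K (act_ob g (fst Y)) D"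
      using re(1,2) t g by (simp add: c)
    finally show ?thesis using re(1,2) t g by simp
  qed
  have "retract_structure Y k q \<in> EO"
  proof (rule retract_structure_EO[of _ _ D])
    fix g h assume g: "g \<in> carrier G" and h: "h \<in> carrier G"
    let ?x = "snd Y h \<odot> act_ar h k"
    have x: "?x \<in> Ar K" "Cod K ?x = fst Y" using t re g h by simp_all
    have "q \<odot> (snd Y g \<odot> act_ar g (k \<odot> (q \<odot> ?x))) = (q \<odot> (snd Y g \<odot> (act_ar g k \<odot> act_ar g q))) \<odot> act_ar g ?x"
      using t re(1,2) g x h by simp
    also have "\<dots> = q \<odot> (snd Y g \<odot> act_ar g ?x)"
      unfolding stable[OF g] using t re(1,2) g x h by simp
    finally show "q \<odot> (snd Y g \<odot> act_ar g (k \<odot> (q \<odot> ?x))) = q \<odot> (snd Y g \<odot> act_ar g ?x)" .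
  qed (use t re(1,2) ru in \<open>auto simp: Hom_def\<close>)
  then show ?thesis
    using t stable re(2) by (simp add: eq_arrow_def Hom_def)
qed

lemma biproduct_structure:
  assumes U: "U \<in> EO" and V: "V \<in> EO" and b: "is_biproduct2 K (fst U) (fst V) W i1 i2 p1 p2"
  obtains Y where "Y \<in> EO" "fst Y = W" "eq_arrow U Y i1" "eq_arrow V Y i2" "eq_arrow Y U p1" "eq_arrow Y V p2"
proof -
  note t = biproduct_typing[OF b] and r = biproduct_rules[OF b] and c = biproduct_cancel[OF b]
  define \<omega> where "\<omega> g = i1 \<odot> (snd U g \<odot> act_ar g p1) \<boxplus> i2 \<odot> (snd V g \<odot> act_ar g p2)" for g
  have t\<omega>: "\<omega> g \<in> Ar K" "Dom K (\<omega> g) = act_ob g W" "Cod K (\<omega> g) = W" if "g \<in> carrier G" for g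
    using that U V t by (simp_all add: \<omega>_def)
  have p1: "p1 \<odot> \<omega> g = snd U g \<odot> act_ar g p1" and p2: "p2 \<odot> \<omega> g = snd V g \<odot> act_ar g p2"
    if "g \<in> carrier G" for g
    using that U V t by (simp_all add: \<omega>_def c)
  have Y: "(W, restrict \<omega> (carrier G)) \<in> EO"
  proof (rule equivariant_objectI)
    show "W \<in> Ob K" by (rule t(3))
    show "\<omega> g \<in> Hom K (act_ob g W) W" if "g \<in> carrier G" for g
      using t\<omega>[OF that] by (simp add: Hom_def)
    show "\<omega> eG = unit_ar W"
      by (rule biproduct_jointly_monic[OF b])
        (use t\<omega>[of "eG"] t p1[of "eG"] p2[of "eG"] EO_one[OF U] EO_one[OF V]
          unit_nat[of p1] unit_nat[of p2] in simp_all)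
    fix g h assume g: "g \<in> carrier G" and h: "h \<in> carrier G"
    have gh: "g \<ast> h \<in> carrier G" using g h by simp
    have component: "p \<odot> (\<omega> (g \<ast> h) \<odot> gam \<T> g h W) = p \<odot> (\<omega> g \<odot> act_ar g (\<omega> h))"
      if A: "A \<in> EO" and p: "p \<in> Ar K" "Dom K p = W" "Cod K p = fst A"
        and eq: "\<And>g. g \<in> carrier G \<Longrightarrow> p \<odot> \<omega> g = snd A g \<odot> act_ar g p" for p A
    proof -
      have "p \<odot> (\<omega> (g \<ast> h) \<odot> gam \<T> g h W) = snd A (g \<ast> h) \<odot> (act_ar (g \<ast> h) p \<odot> gam \<T> g h W)"
        using Cmp_rewrite[OF eq[OF gh], of "gam \<T> g h W"] A p t\<omega>[OF gh] g h t by simp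
      also have "act_ar (g \<ast> h) p \<odot> gam \<T> g h W = gam \<T> g h (fst A) \<odot> act_ar g (act_ar h p)"
        using gam_nat[OF g h p(1)] p by simp
      also have "snd A (g \<ast> h) \<odot> \<dots> = snd A g \<odot> act_ar g (snd A h \<odot> act_ar h p)"
        using Cmp_rewrite[OF EO_cocycle[OF A g h], of "act_ar g (act_ar h p)"] A p g h by simp
      also have "\<dots> = snd A g \<odot> (act_ar g p \<odot> act_ar g (\<omega> h))"
        using eq[OF h, symmetric] p t\<omega>[OF h] g by simp
      also have "\<dots> = p \<odot> (\<omega> g \<odot> act_ar g (\<omega> h))"
        using Cmp_rewrite[OF eq[OF g], of "act_ar g (\<omega> h)"] A p t\<omega>[OF h] t\<omega>[OF g] g h by simp
      finally show ?thesis .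
    qed
    show "\<omega> (g \<ast> h) \<odot> gam \<T> g h W = \<omega> g \<odot> act_ar g (\<omega> h)"
      by (rule biproduct_jointly_monic[OF b])
        (use g h gh t t\<omega>[OF gh] t\<omega>[OF g] t\<omega>[OF h] component[OF U _ _ _ p1] component[OF V _ _ _ p2] in simp_all)
  qed
  have Hi: "i1 \<odot> snd U g = \<omega> g \<odot> act_ar g i1" "i2 \<odot> snd V g = \<omega> g \<odot> act_ar g i2" if g: "g \<in> carrier G" for g
  proof -
    have "act_ar g p1 \<odot> act_ar g i1 = act_ar g (p1 \<odot> i1)" "act_ar g p2 \<odot> act_ar g i1 = act_ar g (p2 \<odot> i1)"
      "act_ar g p1 \<odot> act_ar g i2 = act_ar g (p1 \<odot> i2)" "act_ar g p2 \<odot> act_ar g i2 = act_ar g (p2 \<odot> i2)"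
      using t g by simp_all
    then show "i1 \<odot> snd U g = \<omega> g \<odot> act_ar g i1" "i2 \<odot> snd V g = \<omega> g \<odot> act_ar g i2"
      using t g U V r by (simp_all add: \<omega>_def)
  qed
  show ?thesis
    by (rule that[OF Y]) (use Y U V t Hi p1 p2 in \<open>simp_all add: eq_arrow_def Hom_def\<close>)
qed

text \<open>A complement in \<open>K\<close> is the kernel of the retraction and the cokernel of the section, and it
  inherits the same structure in both ways.\<close>

lemma eq_retract_direct_summand:
  assumes i: "eq_arrow X Y i" and p: "eq_arrow Y X p" and pi: "p \<odot> i = Ide K (fst X)"
  shows "direct_summand KG X Y"
proof -
  note ri = eq_arrow_rules[OF i] and rp = eq_arrow_rules[OF p]
  obtain B j q where b: "is_biproduct2 K (fst X) B (fst Y) i j p q"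
    using split_mono_complement[OF _ _ pi] ri(3-5) rp(3-5) by (metis Ar_Hom)
  let ?B = "retract_structure Y j q"
  have "eq_arrow ?B Y j" "eq_arrow Y ?B q"
    using kernel_structure[OF p b] cokernel_structure[OF i b] by auto
  then have "is_biproduct2 KG X ?B Y (X, Y, i) (?B, Y, j) (Y, X, p) (Y, ?B, q)"
    using b i p biproduct_typing[OF b] eq_arrow_rules(1)[of ?B Y j]
    by (simp add: is_biproduct2_def ri(1,2))
  then show ?thesis unfolding direct_summand_def by blast
qed

end

context mt_action
begin

section \<open>Compatible families and induced objects\<close>

text \<open>A family \<open>T g A \<rightarrow> Y\<close> indexed by \<open>G\<close> that is compatible with the structures is the same
  as an equivariant arrow from \<^term>\<open>Ind' A\<close> to \<open>Y\<close>; dually, a compatible family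
  \<open>Y \<rightarrow> T g A\<close> is an equivariant arrow to \<^term>\<open>Ind' A\<close>. For the family
  \<^term>\<open>snd Y\<close>, compatibility is the cocycle condition, so the constructions of families with values in
  shifts and tensor products also show that these are equivariant objects; therefore \<open>Y\<close> is not assumed to
  be one in the definitions.\<close>

definition family_from :: "'o \<Rightarrow> ('g, 'o, 'm) eq_ob \<Rightarrow> ('g \<Rightarrow> 'm) \<Rightarrow> bool" where
  "family_from A Y \<iota> \<longleftrightarrow>
     (\<forall>g \<in> carrier G. \<iota> g \<in> Hom K (act_ob g A) (fst Y)) \<and>
     (\<forall>h \<in> carrier G. \<forall>g \<in> carrier G. \<iota> (h \<ast> g) \<odot> gam \<T> h g A = snd Y h \<odot> act_ar h (\<iota> g))"

definition family_to :: "'o \<Rightarrow> ('g, 'o, 'm) eq_ob \<Rightarrow> ('g \<Rightarrow> 'm) \<Rightarrow> bool" where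
  "family_to A Y \<pi> \<longleftrightarrow>
     (\<forall>g \<in> carrier G. \<pi> g \<in> Hom K (fst Y) (act_ob g A)) \<and>
     (\<forall>h \<in> carrier G. \<forall>g \<in> carrier G. \<pi> (h \<ast> g) \<odot> snd Y h = gam \<T> h g A \<odot> act_ar h (\<pi> g))"

lemma family_from_rules:
  assumes "family_from A Y \<iota>" "g \<in> carrier G"
  shows "\<iota> g \<in> Ar K" "Dom K (\<iota> g) = act_ob g A" "Cod K (\<iota> g) = fst Y"
    "h \<in> carrier G \<Longrightarrow> \<iota> (h \<ast> g) \<odot> gam \<T> h g A = snd Y h \<odot> act_ar h (\<iota> g)"
  using assms by (auto simp: family_from_def Hom_def)

lemma family_to_rules:
  assumes "family_to A Y \<pi>" "g \<in> carrier G"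
  shows "\<pi> g \<in> Ar K" "Dom K (\<pi> g) = fst Y" "Cod K (\<pi> g) = act_ob g A"
    "h \<in> carrier G \<Longrightarrow> \<pi> (h \<ast> g) \<odot> snd Y h = gam \<T> h g A \<odot> act_ar h (\<pi> g)"
  using assms by (auto simp: family_to_def Hom_def)

lemma family_from_structure: "X \<in> EO \<Longrightarrow> family_from (fst X) X (snd X)"
  using EO_cocycle by (auto simp: family_from_def Hom_def)

lemma family_to_structure:
  assumes X: "X \<in> EO"
  shows "family_to (fst X) X (\<lambda>g. inv_ar K (snd X g))"
  unfolding family_to_def
proof (intro conjI ballI)
  fix g assume "g \<in> carrier G"
  then show "inv_ar K (snd X g) \<in> Hom K (fst X) (act_ob g (fst X))" using X by (simp add: Hom_def)
next
  fix h g assume h: "h \<in> carrier G" and g: "g \<in> carrier G"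
  have hg: "h \<ast> g \<in> carrier G" using g h by simp
  let ?c = "gam \<T> h g (fst X)" and ?d = "act_ar h (snd X g)"
  have "snd X (h \<ast> g) \<odot> (?c \<odot> act_ar h (inv_ar K (snd X g))) = (snd X h \<odot> ?d) \<odot> inv_ar K ?d"
    using Cmp_rewrite[OF EO_cocycle[OF X h g], of "inv_ar K ?d"] X g h hg by simp
  also have "\<dots> = snd X h" using X g h by simp
  also have "\<dots> = snd X (h \<ast> g) \<odot> (inv_ar K (snd X (h \<ast> g)) \<odot> snd X h)" using X g h hg by simp
  finally show "inv_ar K (snd X (h \<ast> g)) \<odot> snd X h = ?c \<odot> act_ar h (inv_ar K (snd X g))"
    by (rule iso_cancel_left[symmetric, rotated]) (use X g h hg in simp_all)
qed

lemma family_from_precompose: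
  assumes c: "family_from B Y \<iota>" and f: "f \<in> Ar K" "Dom K f = A" "Cod K f = B"
    and Y: "\<And>h. h \<in> carrier G \<Longrightarrow> snd Y h \<in> Hom K (act_ob h (fst Y)) (fst Y)"
  shows "family_from A Y (\<lambda>g. \<iota> g \<odot> act_ar g f)"
  unfolding family_from_def
proof (intro conjI ballI)
  fix g assume "g \<in> carrier G"
  then show "\<iota> g \<odot> act_ar g f \<in> Hom K (act_ob g A) (fst Y)"
    using family_from_rules[OF c] f by (simp add: Hom_def)
next
  fix h g assume h: "h \<in> carrier G" and g: "g \<in> carrier G"
  have hg: "h \<ast> g \<in> carrier G" using g h by simp
  note t = family_from_rules(1-3)[OF c g] family_from_rules(1-3)[OF c hg]
  have tY: "snd Y h \<in> Ar K" "Dom K (snd Y h) = act_ob h (fst Y)" using Y[OF h] by (auto simp: Hom_def)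
  have A: "A \<in> Ob K" "B \<in> Ob K" using f by auto
  have "(\<iota> (h \<ast> g) \<odot> act_ar (h \<ast> g) f) \<odot> gam \<T> h g A = \<iota> (h \<ast> g) \<odot> (gam \<T> h g B \<odot> act_ar h (act_ar g f))"
    using gam_nat[OF h g f(1)] t f A g h hg by simp
  also have "\<dots> = (snd Y h \<odot> act_ar h (\<iota> g)) \<odot> act_ar h (act_ar g f)"
    using Cmp_rewrite[OF family_from_rules(4)[OF c g h], of "act_ar h (act_ar g f)"] t f A g h by simp
  also have "\<dots> = snd Y h \<odot> act_ar h (\<iota> g \<odot> act_ar g f)"
    using t tY f A g h by simp
  finally show "(\<iota> (h \<ast> g) \<odot> act_ar (h \<ast> g) f) \<odot> gam \<T> h g A = snd Y h \<odot> act_ar h (\<iota> g \<odot> act_ar g f)" .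
qed

lemma eq_shift_simps [simp]:
  "fst (shift Y) = SO (fst Y)"
  "g \<in> carrier G \<Longrightarrow> snd (shift Y) g = SA (snd Y g) \<odot> xi \<T> g (fst Y)"
  by (simp_all add: eq_shift_def split_beta)

lemma eq_tensor_simps [simp]:
  "fst (tensor X Y) = TO K (fst X) (fst Y)"
  "g \<in> carrier G \<Longrightarrow> snd (tensor X Y) g =
     TA K (snd X g) (snd Y g) \<odot> inv_ar K (mu \<T> g (fst X) (fst Y))"
  by (simp_all add: eq_tensor_def split_beta)

lemma family_from_shift:
  assumes c: "family_from A Y \<iota>" and A: "A \<in> Ob K" and Y: "Y \<in> EO"
  shows "family_from (SO A) (shift Y) (\<lambda>g. SA (\<iota> g) \<odot> xi \<T> g A)"
  unfolding family_from_def
proof (intro conjI ballI)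
  fix g assume "g \<in> carrier G"
  then show "SA (\<iota> g) \<odot> xi \<T> g A \<in> Hom K (act_ob g (SO A)) (fst (shift Y))"
    using family_from_rules[OF c] A by (simp add: Hom_def)
next
  fix h g assume h: "h \<in> carrier G" and g: "g \<in> carrier G"
  have hg: "h \<ast> g \<in> carrier G" using g h by simp
  note t = family_from_rules(1-3)[OF c g] family_from_rules(1-3)[OF c hg]
  let ?A = "act_ob g A"
  have "(SA (\<iota> (h \<ast> g)) \<odot> xi \<T> (h \<ast> g) A) \<odot> gam \<T> h g (SO A) =
      SA (\<iota> (h \<ast> g)) \<odot> (SA (gam \<T> h g A) \<odot> (xi \<T> h ?A \<odot> act_ar h (xi \<T> g A)))"
    using gam_xi[OF h g A] t A g h hg by simp
  also have "\<dots> = SA (\<iota> (h \<ast> g) \<odot> gam \<T> h g A) \<odot> (xi \<T> h ?A \<odot> act_ar h (xi \<T> g A))"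
    using t A g h hg by simp
  also have "\<dots> = SA (snd Y h) \<odot> (SA (act_ar h (\<iota> g)) \<odot> (xi \<T> h ?A \<odot> act_ar h (xi \<T> g A)))"
    unfolding family_from_rules(4)[OF c g h] using t A Y g h hg by simp
  also have "SA (act_ar h (\<iota> g)) \<odot> (xi \<T> h ?A \<odot> act_ar h (xi \<T> g A)) =
      xi \<T> h (fst Y) \<odot> (act_ar h (SA (\<iota> g)) \<odot> act_ar h (xi \<T> g A))"
    using Cmp_rewrite[OF xi_nat[OF h t(1), symmetric], of "act_ar h (xi \<T> g A)"] t A Y g h by simp
  finally show "(SA (\<iota> (h \<ast> g)) \<odot> xi \<T> (h \<ast> g) A) \<odot> gam \<T> h g (SO A) =
      snd (shift Y) h \<odot> act_ar h (SA (\<iota> g) \<odot> xi \<T> g A)"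
    using t A Y g h by simp
qed

lemma family_from_tensor:
  assumes c: "family_from A Y \<iota>" and c': "family_from A' Y' \<iota>'" and A: "A \<in> Ob K" "A' \<in> Ob K"
    and Y: "Y \<in> EO" "Y' \<in> EO"
  shows "family_from (TO K A A') (tensor Y Y')
    (\<lambda>g. TA K (\<iota> g) (\<iota>' g) \<odot> inv_ar K (mu \<T> g A A'))"
  unfolding family_from_def
proof (intro conjI ballI)
  fix g assume "g \<in> carrier G"
  then show "TA K (\<iota> g) (\<iota>' g) \<odot> inv_ar K (mu \<T> g A A') \<in>
      Hom K (act_ob g (TO K A A')) (fst (tensor Y Y'))"
    using family_from_rules[OF c] family_from_rules[OF c'] A by (simp add: Hom_def)
next
  fix h g assume h: "h \<in> carrier G" and g: "g \<in> carrier G"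
  have hg: "h \<ast> g \<in> carrier G" using g h by simp
  note t = family_from_rules(1-3)[OF c g] family_from_rules(1-3)[OF c hg]
    family_from_rules(1-3)[OF c' g] family_from_rules(1-3)[OF c' hg]
  let ?mhg = "mu \<T> (h \<ast> g) A A'" and ?mg = "mu \<T> g A A'"
  let ?mh = "mu \<T> h (act_ob g A) (act_ob g A')" and ?mY = "mu \<T> h (fst Y) (fst Y')"
  let ?l = "(TA K (\<iota> (h \<ast> g)) (\<iota>' (h \<ast> g)) \<odot> inv_ar K ?mhg) \<odot> gam \<T> h g (TO K A A')"
  let ?r = "snd (tensor Y Y') h \<odot> act_ar h (TA K (\<iota> g) (\<iota>' g) \<odot> inv_ar K ?mg)"
  let ?e = "act_ar h ?mg \<odot> ?mh"
  have tt: "?mhg \<in> Ar K" "?mg \<in> Ar K" "?mh \<in> Ar K" "?e \<in> Ar K" using A g h hg by simp_all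
  have "?l \<odot> ?e = (TA K (\<iota> (h \<ast> g)) (\<iota>' (h \<ast> g)) \<odot> inv_ar K ?mhg) \<odot> (gam \<T> h g (TO K A A') \<odot> act_ar h ?mg \<odot> ?mh)"
    using t A g h hg by simp
  also have "\<dots> = TA K (\<iota> (h \<ast> g)) (\<iota>' (h \<ast> g)) \<odot> TA K (gam \<T> h g A) (gam \<T> h g A')"
    unfolding gam_mu[OF h g A] using t A g h hg by simp
  also have "\<dots> = TA K (snd Y h \<odot> act_ar h (\<iota> g)) (snd Y' h \<odot> act_ar h (\<iota>' g))"
    using t A g h hg family_from_rules(4)[OF c g h] family_from_rules(4)[OF c' g h] by (simp add: TA_merge)
  also have "\<dots> = TA K (snd Y h) (snd Y' h) \<odot> TA K (act_ar h (\<iota> g)) (act_ar h (\<iota>' g))"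
    using t Y g h by (simp add: TA_merge)
  also have "\<dots> = TA K (snd Y h) (snd Y' h) \<odot> (inv_ar K ?mY \<odot> (?mY \<odot> TA K (act_ar h (\<iota> g)) (act_ar h (\<iota>' g))))"
    using t Y g h by simp
  also have "?mY \<odot> TA K (act_ar h (\<iota> g)) (act_ar h (\<iota>' g)) = act_ar h (TA K (\<iota> g) (\<iota>' g)) \<odot> ?mh"
    using mu_nat[OF h t(1) t(7)] t by simp
  also have "TA K (snd Y h) (snd Y' h) \<odot> (inv_ar K ?mY \<odot> (act_ar h (TA K (\<iota> g) (\<iota>' g)) \<odot> ?mh)) = ?r \<odot> ?e"
    using t A Y g h by simp
  finally show "?l = ?r"
    by (rule iso_cancel_right[rotated]) (use t A Y g h hg in simp_all)
qed

lemma family_to_tensor: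
  assumes c: "family_to A Y \<pi>" and c': "family_to A' Y' \<pi>'" and A: "A \<in> Ob K" "A' \<in> Ob K"
    and Y: "Y \<in> EO" "Y' \<in> EO"
  shows "family_to (TO K A A') (tensor Y Y') (\<lambda>g. mu \<T> g A A' \<odot> TA K (\<pi> g) (\<pi>' g))"
  unfolding family_to_def
proof (intro conjI ballI)
  fix g assume "g \<in> carrier G"
  then show "mu \<T> g A A' \<odot> TA K (\<pi> g) (\<pi>' g) \<in>
      Hom K (fst (tensor Y Y')) (act_ob g (TO K A A'))"
    using family_to_rules[OF c] family_to_rules[OF c'] A by (simp add: Hom_def)
next
  fix h g assume h: "h \<in> carrier G" and g: "g \<in> carrier G"
  have hg: "h \<ast> g \<in> carrier G" using g h by simp
  note t = family_to_rules(1-3)[OF c g] family_to_rules(1-3)[OF c hg]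
    family_to_rules(1-3)[OF c' g] family_to_rules(1-3)[OF c' hg]
  let ?mhg = "mu \<T> (h \<ast> g) A A'" and ?mg = "mu \<T> g A A'"
  let ?mh = "mu \<T> h (act_ob g A) (act_ob g A')" and ?mY = "mu \<T> h (fst Y) (fst Y')"
  let ?p = "TA K (act_ar h (\<pi> g)) (act_ar h (\<pi>' g)) \<odot> inv_ar K ?mY"
  have mY: "?mY \<in> Ar K" using Y h by simp
  have "(?mhg \<odot> TA K (\<pi> (h \<ast> g)) (\<pi>' (h \<ast> g))) \<odot> snd (tensor Y Y') h =
      ?mhg \<odot> ((TA K (\<pi> (h \<ast> g)) (\<pi>' (h \<ast> g)) \<odot> TA K (snd Y h) (snd Y' h)) \<odot> inv_ar K ?mY)"
    using t A Y g h hg by simp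
  also have "TA K (\<pi> (h \<ast> g)) (\<pi>' (h \<ast> g)) \<odot> TA K (snd Y h) (snd Y' h) =
      TA K (gam \<T> h g A \<odot> act_ar h (\<pi> g)) (gam \<T> h g A' \<odot> act_ar h (\<pi>' g))"
    using t A Y g h hg family_to_rules(4)[OF c g h] family_to_rules(4)[OF c' g h] by (simp add: TA_merge)
  also have "\<dots> = TA K (gam \<T> h g A) (gam \<T> h g A') \<odot> TA K (act_ar h (\<pi> g)) (act_ar h (\<pi>' g))"
    using t A g h by (simp add: TA_merge)
  also have "?mhg \<odot> (\<dots> \<odot> inv_ar K ?mY) = (?mhg \<odot> TA K (gam \<T> h g A) (gam \<T> h g A')) \<odot> ?p"
    using t A Y g h hg by simp
  also have "\<dots> = gam \<T> h g (TO K A A') \<odot> (act_ar h ?mg \<odot> (?mh \<odot> ?p))"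
    unfolding gam_mu[OF h g A, symmetric] using t A Y g h hg by simp
  also have "?mh \<odot> ?p = act_ar h (TA K (\<pi> g) (\<pi>' g)) \<odot> (?mY \<odot> inv_ar K ?mY)"
    using Cmp_rewrite[OF mu_nat[OF h t(1) t(7)], of "inv_ar K ?mY"] t A Y g h mY by simp
  also have "act_ar h ?mg \<odot> \<dots> = act_ar h (?mg \<odot> TA K (\<pi> g) (\<pi>' g))"
    using t A Y g h by simp
  finally show "(?mhg \<odot> TA K (\<pi> (h \<ast> g)) (\<pi>' (h \<ast> g))) \<odot> snd (tensor Y Y') h =
      gam \<T> h g (TO K A A') \<odot> act_ar h (?mg \<odot> TA K (\<pi> g) (\<pi>' g))" .
qed

lemma equivariant_objectI_iso:
  assumes "A \<in> Ob K" "\<And>g. g \<in> carrier G \<Longrightarrow> \<phi> g \<in> Hom K (act_ob g A) A \<and> is_iso K (\<phi> g)"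
    and "\<And>g h. g \<in> carrier G \<Longrightarrow> h \<in> carrier G \<Longrightarrow>
       \<phi> (g \<ast> h) \<odot> gam \<T> g h A = \<phi> g \<odot> act_ar g (\<phi> h)"
  shows "(A, restrict \<phi> (carrier G)) \<in> EO"
  using assms by (auto simp: equivariant_objects_def)

lemma eq_shift_EO [simp]:
  assumes X: "X \<in> EO"
  shows "shift X \<in> EO"
proof -
  have "(SO (fst X), \<lambda>g \<in> carrier G. SA (snd X g) \<odot> xi \<T> g (fst X)) \<in> EO"
  proof (rule equivariant_objectI_iso)
    fix g h assume g: "g \<in> carrier G" and h: "h \<in> carrier G"
    show "(SA (snd X (g \<ast> h)) \<odot> xi \<T> (g \<ast> h) (fst X)) \<odot> gam \<T> g h (SO (fst X)) =
        (SA (snd X g) \<odot> xi \<T> g (fst X)) \<odot> act_ar g (SA (snd X h) \<odot> xi \<T> h (fst X))"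
      using family_from_rules(4)[OF family_from_shift[OF family_from_structure[OF X] EO_Ob[OF X] X] h g] g
      by (simp only: eq_shift_simps)
  qed (use X in \<open>simp_all add: Hom_def\<close>)
  then show ?thesis by (simp add: eq_shift_def split_beta)
qed

lemma eq_tensor_EO [simp]:
  assumes X: "X \<in> EO" "Y \<in> EO"
  shows "tensor X Y \<in> EO"
proof -
  let ?\<phi> = "\<lambda>g. TA K (snd X g) (snd Y g) \<odot> inv_ar K (mu \<T> g (fst X) (fst Y))"
  have "(TO K (fst X) (fst Y), restrict ?\<phi> (carrier G)) \<in> EO"
  proof (rule equivariant_objectI_iso)
    fix g h assume g: "g \<in> carrier G" and h: "h \<in> carrier G"
    show "?\<phi> (g \<ast> h) \<odot> gam \<T> g h (TO K (fst X) (fst Y)) = ?\<phi> g \<odot> act_ar g (?\<phi> h)"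
      using family_from_rules(4)[OF family_from_tensor[OF family_from_structure[OF X(1)]
            family_from_structure[OF X(2)] EO_Ob[OF X(1)] EO_Ob[OF X(2)] X] h g] g
      by (simp only: eq_tensor_simps)
  qed (use X in \<open>simp_all add: Hom_def\<close>)
  then show ?thesis by (simp add: eq_tensor_def split_beta)
qed

lemma eq_arrow_shift:
  assumes f: "eq_arrow X Y f"
  shows "eq_arrow (shift X) (shift Y) (SA f)"
proof -
  note r = eq_arrow_rules[OF f]
  have "SA f \<odot> snd (shift X) g = snd (shift Y) g \<odot> act_ar g (SA f)"
    if g: "g \<in> carrier G" for g
  proof -
    have "SA f \<odot> snd (shift X) g = SA (f \<odot> snd X g) \<odot> xi \<T> g (fst X)"
      using r(1-5) g by simp
    also have "\<dots> = SA (snd Y g) \<odot> (SA (act_ar g f) \<odot> xi \<T> g (fst X))"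
      unfolding r(6)[OF g] using r(1-5) g by simp
    also have "SA (act_ar g f) \<odot> xi \<T> g (fst X) = xi \<T> g (fst Y) \<odot> act_ar g (SA f)"
      using xi_nat[OF g r(3)] r(4,5) by simp
    finally show ?thesis using r(1-5) g by simp
  qed
  then show ?thesis using r(1-5) by (simp add: eq_arrow_def Hom_def)
qed

text \<open>\<open>Ind A\<close> enters the arguments only through these properties, which do not mention the choice of a
  direct sum and the definite description in its definition.\<close>

definition induced :: "'o \<Rightarrow> ('g, 'o, 'm) eq_ob \<Rightarrow> ('g \<Rightarrow> 'm) \<Rightarrow> ('g \<Rightarrow> 'm) \<Rightarrow> bool" where
  "induced A Y \<iota> \<pi> \<longleftrightarrow> A \<in> Ob K \<and> Y \<in> EO \<and>
     is_direct_sum K (carrier G) (\<lambda>g. act_ob g A) (fst Y) \<iota> \<pi> \<and> family_from A Y \<iota> \<and> family_to A Y \<pi>"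

text \<open>The structure of an induced object identifies \<open>T h (\<iota> g)\<close> with \<open>\<iota> (h g)\<close>, so that
  the translated injections are jointly epic as well.\<close>

lemma induced_jointly_epic:
  assumes ind: "induced A Y \<iota> \<pi>" and h: "h \<in> carrier G"
    and u: "u \<in> Hom K (act_ob h (fst Y)) W" and v: "v \<in> Hom K (act_ob h (fst Y)) W"
    and eq: "\<And>g. g \<in> carrier G \<Longrightarrow> u \<odot> act_ar h (\<iota> g) = v \<odot> act_ar h (\<iota> g)"
  shows "u = v"
proof -
  have Y: "Y \<in> EO" "A \<in> Ob K" and s: "is_direct_sum K (carrier G) (\<lambda>g. act_ob g A) (fst Y) \<iota> \<pi>"
    and c: "family_from A Y \<iota>" using ind by (auto simp: induced_def)
  note tu = Hom_rules[OF u] and tv = Hom_rules[OF v]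
  let ?\<psi> = "inv_ar K (snd Y h)"
  have shift_index: "(w \<odot> ?\<psi>) \<odot> \<iota> (h \<ast> g) = (w \<odot> act_ar h (\<iota> g)) \<odot> inv_ar K (gam \<T> h g A)"
    if g: "g \<in> carrier G" and w: "w \<in> Ar K" "Dom K w = act_ob h (fst Y)" for g w
  proof -
    have hg: "h \<ast> g \<in> carrier G" using g h by simp
    note t = family_from_rules(1-3)[OF c g] family_from_rules(1-3)[OF c hg]
    have "\<iota> (h \<ast> g) = (\<iota> (h \<ast> g) \<odot> gam \<T> h g A) \<odot> inv_ar K (gam \<T> h g A)" using t Y g h by simp
    also have "\<dots> = snd Y h \<odot> (act_ar h (\<iota> g) \<odot> inv_ar K (gam \<T> h g A))"
      unfolding family_from_rules(4)[OF c g h] using t Y g h by simp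
    finally have i: "\<iota> (h \<ast> g) = snd Y h \<odot> (act_ar h (\<iota> g) \<odot> inv_ar K (gam \<T> h g A))" .
    show ?thesis unfolding i using t w Y g h by simp
  qed
  have "u \<odot> ?\<psi> = v \<odot> ?\<psi>"
  proof (rule direct_sum_jointly_epic[OF s])
    show "u \<odot> ?\<psi> \<in> Hom K (fst Y) W" "v \<odot> ?\<psi> \<in> Hom K (fst Y) W" using tu tv Y h by (simp_all add: Hom_def)
    fix k assume k: "k \<in> carrier G"
    have g: "inv\<^bsub>G\<^esub> h \<ast> k \<in> carrier G" "h \<ast> (inv\<^bsub>G\<^esub> h \<ast> k) = k"
      using h k by (simp_all add: m_assoc[symmetric])
    show "(u \<odot> ?\<psi>) \<odot> \<iota> k = (v \<odot> ?\<psi>) \<odot> \<iota> k"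
      using shift_index[OF g(1) tu(1,2)] shift_index[OF g(1) tv(1,2)] eq[OF g(1)] g(2) by simp
  qed
  then show ?thesis
    by (rule iso_cancel_right[rotated]) (use tu tv Y h in simp_all)
qed

lemma induced_arrow_from:
  assumes ind: "induced A Y \<iota> \<pi>" and X: "X \<in> EO" and c: "family_from A X \<iota>'"
  obtains e where "eq_arrow Y X e" "\<And>g. g \<in> carrier G \<Longrightarrow> e \<odot> \<iota> g = \<iota>' g"
proof -
  have Y: "Y \<in> EO" "A \<in> Ob K" and s: "is_direct_sum K (carrier G) (\<lambda>g. act_ob g A) (fst Y) \<iota> \<pi>"
    and cY: "family_from A Y \<iota>" using ind by (auto simp: induced_def)
  note t = family_from_rules[OF c] family_from_rules[OF cY]
  obtain e where e: "e \<in> Hom K (fst Y) (fst X)" "\<And>g. g \<in> carrier G \<Longrightarrow> e \<odot> \<iota> g = \<iota>' g"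
    using direct_sum_copair[OF s EO_Ob[OF X], of \<iota>'] c by (auto simp: family_from_def)
  note te = Hom_rules[OF e(1)]
  have "e \<odot> snd Y h = snd X h \<odot> act_ar h e" if h: "h \<in> carrier G" for h
  proof (rule induced_jointly_epic[OF ind h])
    show "e \<odot> snd Y h \<in> Hom K (act_ob h (fst Y)) (fst X)" "snd X h \<odot> act_ar h e \<in> Hom K (act_ob h (fst Y)) (fst X)"
      using te X Y h by (simp_all add: Hom_def)
    fix g assume g: "g \<in> carrier G"
    have hg: "h \<ast> g \<in> carrier G" using g h by simp
    have "(e \<odot> snd Y h) \<odot> act_ar h (\<iota> g) = e \<odot> (\<iota> (h \<ast> g) \<odot> gam \<T> h g A)"
      using t(8)[OF g h] t(5-7)[OF g] te Y h by simp
    also have "\<dots> = snd X h \<odot> act_ar h (e \<odot> \<iota> g)"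
      using Cmp_rewrite[OF e(2)[OF hg], of "gam \<T> h g A"] t(4)[OF g h] t(5-7)[OF hg] e(2)[OF g] te Y g h by simp
    also have "\<dots> = (snd X h \<odot> act_ar h e) \<odot> act_ar h (\<iota> g)"
      using t(5-7)[OF g] te X h by simp
    finally show "(e \<odot> snd Y h) \<odot> act_ar h (\<iota> g) = (snd X h \<odot> act_ar h e) \<odot> act_ar h (\<iota> g)" .
  qed
  then show ?thesis by (intro that[of e]) (use e X Y in \<open>simp_all add: eq_arrow_def\<close>)
qed

lemma induced_arrow_to:
  assumes ind: "induced A Y \<iota> \<pi>" and X: "X \<in> EO" and c: "family_to A X \<pi>'"
  obtains e where "eq_arrow X Y e" "\<And>g. g \<in> carrier G \<Longrightarrow> \<pi> g \<odot> e = \<pi>' g"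
proof -
  have Y: "Y \<in> EO" "A \<in> Ob K" and s: "is_direct_sum K (carrier G) (\<lambda>g. act_ob g A) (fst Y) \<iota> \<pi>"
    and cY: "family_to A Y \<pi>" using ind by (auto simp: induced_def)
  note t = family_to_rules[OF c] family_to_rules[OF cY]
  obtain e where e: "e \<in> Hom K (fst X) (fst Y)" "\<And>g. g \<in> carrier G \<Longrightarrow> \<pi> g \<odot> e = \<pi>' g"
    using direct_sum_pair[OF s EO_Ob[OF X], of \<pi>'] c by (auto simp: family_to_def)
  note te = Hom_rules[OF e(1)]
  have "e \<odot> snd X h = snd Y h \<odot> act_ar h e" if h: "h \<in> carrier G" for h
  proof (rule direct_sum_jointly_monic[OF s])
    show "e \<odot> snd X h \<in> Hom K (act_ob h (fst X)) (fst Y)" "snd Y h \<odot> act_ar h e \<in> Hom K (act_ob h (fst X)) (fst Y)"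
      using te X Y h by (simp_all add: Hom_def)
    fix k assume k: "k \<in> carrier G"
    define g where "g = inv\<^bsub>G\<^esub> h \<ast> k"
    have g: "g \<in> carrier G" "h \<ast> g = k"
      using h k by (simp_all add: g_def m_assoc[symmetric])
    have "\<pi> k \<odot> (e \<odot> snd X h) = \<pi>' (h \<ast> g) \<odot> snd X h"
      using Cmp_rewrite[OF e(2)[OF k], of "snd X h"] t(5-7)[OF k] te X h g(2) by simp
    also have "\<dots> = gam \<T> h g A \<odot> (act_ar h (\<pi> g) \<odot> act_ar h e)"
      using t(4)[OF g(1) h] e(2)[OF g(1), symmetric] t(5-7)[OF g(1)] te Y g h by simp
    also have "\<dots> = \<pi> k \<odot> (snd Y h \<odot> act_ar h e)"
      using Cmp_rewrite[OF t(8)[OF g(1) h], of "act_ar h e"] t(5-7)[OF g(1)] t(5-7)[OF k] te Y g h by simp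
    finally show "\<pi> k \<odot> (e \<odot> snd X h) = \<pi> k \<odot> (snd Y h \<odot> act_ar h e)" .
  qed
  then show ?thesis by (intro that[of e]) (use e X Y in \<open>simp_all add: eq_arrow_def\<close>)
qed

lemma induced_summand:
  assumes ind: "induced A Y \<iota> \<pi>"
  obtains i p where "i \<in> Hom K A (fst Y)" "p \<in> Hom K (fst Y) A" "p \<odot> i = Ide K A"
proof -
  have A: "A \<in> Ob K" and s: "is_direct_sum K (carrier G) (\<lambda>g. act_ob g A) (fst Y) \<iota> \<pi>"
    using ind by (auto simp: induced_def)
  let ?u = "unit_ar A"
  note t = direct_sum_typing[OF s one_closed]
  have "(?u \<odot> \<pi> eG) \<odot> (\<iota> eG \<odot> inv_ar K ?u) = ?u \<odot> ((\<pi> eG \<odot> \<iota> eG) \<odot> inv_ar K ?u)"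
    using t A by simp
  also have "\<dots> = Ide K A"
    using direct_sum_rules(1)[OF s one_closed] A by simp
  finally show ?thesis
    by (rule that[rotated 2]) (use t A in \<open>simp_all add: Hom_def\<close>)
qed

definition eq_retract :: "('g, 'o, 'm) eq_ob \<Rightarrow> ('g, 'o, 'm) eq_ob \<Rightarrow> bool" where
  "eq_retract X Y \<longleftrightarrow> (\<exists>i p. eq_arrow X Y i \<and> eq_arrow Y X p \<and> p \<odot> i = Ide K (fst X))"

definition orthonormal :: "'o \<Rightarrow> ('g \<Rightarrow> 'm) \<Rightarrow> ('g \<Rightarrow> 'm) \<Rightarrow> bool" where
  "orthonormal A \<iota> \<pi> \<longleftrightarrow> (\<forall>g \<in> carrier G. \<forall>h \<in> carrier G.
     \<pi> h \<odot> \<iota> g = (if g = h then Ide K (act_ob g A) else Zer K (act_ob g A) (act_ob h A)))"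

text \<open>An orthonormal pair of compatible families gives arrows \<open>Ind A \<rightarrow> X \<rightarrow> Ind A\<close> whose composite
  has the entries of an identity matrix.\<close>

lemma induced_retract:
  assumes ind: "induced A Y \<iota> \<pi>" and X: "X \<in> EO" and c: "family_from A X \<iota>'" "family_to A X \<pi>'"
    and orthonormal: "orthonormal A \<iota>' \<pi>'"
  shows "eq_retract Y X"
proof -
  have s: "is_direct_sum K (carrier G) (\<lambda>g. act_ob g A) (fst Y) \<iota> \<pi>" using ind by (simp add: induced_def)
  note t = direct_sum_typing[OF s]
  obtain i where i: "eq_arrow Y X i" "\<And>g. g \<in> carrier G \<Longrightarrow> i \<odot> \<iota> g = \<iota>' g"
    using induced_arrow_from[OF ind X c(1)] by blast
  obtain p where p: "eq_arrow X Y p" "\<And>g. g \<in> carrier G \<Longrightarrow> \<pi> g \<odot> p = \<pi>' g"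
    using induced_arrow_to[OF ind X c(2)] by blast
  note ri = eq_arrow_rules(1-5)[OF i(1)] eq_arrow_rules(1-5)[OF p(1)]
  have "p \<odot> i = Ide K (fst Y)"
  proof (rule direct_sum_jointly_epic[OF s])
    show "p \<odot> i \<in> Hom K (fst Y) (fst Y)" "Ide K (fst Y) \<in> Hom K (fst Y) (fst Y)"
      using ri by (simp_all add: Hom_def)
    fix g assume g: "g \<in> carrier G"
    show "(p \<odot> i) \<odot> \<iota> g = Ide K (fst Y) \<odot> \<iota> g"
    proof (rule direct_sum_jointly_monic[OF s])
      show "(p \<odot> i) \<odot> \<iota> g \<in> Hom K (act_ob g A) (fst Y)" "Ide K (fst Y) \<odot> \<iota> g \<in> Hom K (act_ob g A) (fst Y)"
        using ri t[OF g] by (simp_all add: Hom_def)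
      fix h assume h: "h \<in> carrier G"
      have "\<pi> h \<odot> ((p \<odot> i) \<odot> \<iota> g) = \<pi>' h \<odot> \<iota>' g"
        using Cmp_rewrite[OF p(2)[OF h], of "i \<odot> \<iota> g"] i(2)[OF g] ri t[OF g] t[OF h]
          family_from_rules(1-3)[OF c(1) g] by simp
      also have "\<dots> = \<pi> h \<odot> \<iota> g"
        using orthonormal direct_sum_rules[OF s g] g h by (auto simp: orthonormal_def)
      finally show "\<pi> h \<odot> ((p \<odot> i) \<odot> \<iota> g) = \<pi> h \<odot> (Ide K (fst Y) \<odot> \<iota> g)"
        using ri t[OF g] by simp
    qed
  qed
  then show ?thesis using i(1) p(1) by (auto simp: eq_retract_def)
qed

lemma direct_sum_act_exists:
  assumes "finite (carrier G)" "A \<in> Ob K"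
  obtains S \<iota> \<pi> where "direct_sum K (carrier G) (\<lambda>g. act_ob g A) = (S, \<iota>, \<pi>)"
    "is_direct_sum K (carrier G) (\<lambda>g. act_ob g A) S \<iota> \<pi>"
proof -
  let ?P = "\<lambda>(S, \<iota>, \<pi>). is_direct_sum K (carrier G) (\<lambda>g. act_ob g A) S \<iota> \<pi>"
  have "\<exists>S \<iota> \<pi>. S \<in> Ob K \<and> is_direct_sum K (carrier G) (\<lambda>g. act_ob g A) S \<iota> \<pi>"
    using assms is_zero_typing biproduct_typing(3) by (intro direct_sum_exists) auto
  then have "\<exists>x. ?P x" by auto
  then have "?P (direct_sum K (carrier G) (\<lambda>g. act_ob g A))"
    unfolding direct_sum_def by (rule someI_ex)
  then show ?thesis using that by (cases "direct_sum K (carrier G) (\<lambda>g. act_ob g A)") auto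
qed

lemma Ind_induced:
  assumes fin: "finite (carrier G)" and A: "A \<in> Ob K"
  obtains \<iota> \<pi> where "induced A (Ind' A) \<iota> \<pi>"
proof -
  obtain S \<iota> \<pi> where S: "direct_sum K (carrier G) (\<lambda>g. act_ob g A) = (S, \<iota>, \<pi>)"
    and s: "is_direct_sum K (carrier G) (\<lambda>g. act_ob g A) S \<iota> \<pi>"
    using direct_sum_act_exists[OF fin A] by blast
  note t = direct_sum_typing[OF s]
  have SO: "S \<in> Ob K" using direct_sum_Ob[OF s] .
  define P where "P h t \<longleftrightarrow> t \<in> Hom K (act_ob h S) S \<and>
     (\<forall>g \<in> carrier G. \<pi> g \<odot> t = gam \<T> h (inv\<^bsub>G\<^esub> h \<ast> g) A \<odot> act_ar h (\<pi> (inv\<^bsub>G\<^esub> h \<ast> g)))" for h t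
  define \<tau> where "\<tau> h = (THE t. P h t)" for h
  have Ind: "Ind' A = (S, restrict \<tau> (carrier G))"
    unfolding Ind_def S \<tau>_def P_def by simp
  have hg: "inv\<^bsub>G\<^esub> h \<ast> g \<in> carrier G" "h \<ast> (inv\<^bsub>G\<^esub> h \<ast> g) = g"
    if "h \<in> carrier G" "g \<in> carrier G" for g h
    using that by (simp_all add: m_assoc[symmetric])
  have "P h (\<tau> h)" if h: "h \<in> carrier G" for h
  proof -
    have "\<exists>!t. P h t"
      unfolding P_def
      by (rule direct_sum_universal(1)[OF s]) (use t hg[OF h] h A SO in \<open>simp_all add: Hom_def\<close>)
    then show ?thesis unfolding \<tau>_def by (rule theI')
  qed
  then have \<tau>: "\<tau> h \<in> Ar K" "Dom K (\<tau> h) = act_ob h S" "Cod K (\<tau> h) = S"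
    and \<pi>\<tau>': "\<And>g. g \<in> carrier G \<Longrightarrow> \<pi> g \<odot> \<tau> h = gam \<T> h (inv\<^bsub>G\<^esub> h \<ast> g) A \<odot> act_ar h (\<pi> (inv\<^bsub>G\<^esub> h \<ast> g))"
    if "h \<in> carrier G" for h
    using that by (auto simp: P_def Hom_def)
  have \<pi>\<tau>: "\<pi> (h \<ast> g) \<odot> \<tau> h = gam \<T> h g A \<odot> act_ar h (\<pi> g)" if "h \<in> carrier G" "g \<in> carrier G" for h g
  proof -
    have "inv\<^bsub>G\<^esub> h \<ast> (h \<ast> g) = g" using that by (simp add: m_assoc[symmetric])
    then show ?thesis using \<pi>\<tau>'[of h "h \<ast> g"] that by simp
  qed
  have EO: "(S, restrict \<tau> (carrier G)) \<in> EO"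
  proof (rule equivariant_objectI[OF SO])
    show "\<tau> g \<in> Hom K (act_ob g S) S" if "g \<in> carrier G" for g
      using \<tau>[OF that] by (simp add: Hom_def)
    show "\<tau> eG = unit_ar S"
    proof (rule direct_sum_jointly_monic[OF s])
      fix g assume g: "g \<in> carrier G"
      show "\<pi> g \<odot> \<tau> eG = \<pi> g \<odot> unit_ar S"
        using \<pi>\<tau>[of "eG" g] gam_one[OF g A] unit_nat[of "\<pi> g"] t[OF g] g by simp
    qed (use \<tau>[of "eG"] SO in \<open>simp_all add: Hom_def\<close>)
    fix g h assume g: "g \<in> carrier G" and h: "h \<in> carrier G"
    have gh: "g \<ast> h \<in> carrier G" using g h by simp
    show "\<tau> (g \<ast> h) \<odot> gam \<T> g h S = \<tau> g \<odot> act_ar g (\<tau> h)"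
    proof (rule direct_sum_jointly_monic[OF s])
      show "\<tau> (g \<ast> h) \<odot> gam \<T> g h S \<in> Hom K (act_ob g (act_ob h S)) S"
        "\<tau> g \<odot> act_ar g (\<tau> h) \<in> Hom K (act_ob g (act_ob h S)) S"
        using \<tau>[OF g] \<tau>[OF h] \<tau>[OF gh] g h gh SO by (simp_all add: Hom_def)
      fix k' assume k': "k' \<in> carrier G"
      define k where "k = inv\<^bsub>G\<^esub> (g \<ast> h) \<ast> k'"
      have k: "k \<in> carrier G" "k' = g \<ast> h \<ast> k" "h \<ast> k \<in> carrier G" "k' = g \<ast> (h \<ast> k)"
        using hg[OF gh k'] g h by (simp_all add: k_def m_assoc)
      have "\<pi> k' \<odot> (\<tau> (g \<ast> h) \<odot> gam \<T> g h S) = gam \<T> (g \<ast> h) k A \<odot> (act_ar (g \<ast> h) (\<pi> k) \<odot> gam \<T> g h S)"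
        using Cmp_rewrite[OF \<pi>\<tau>[OF gh k(1)], of "gam \<T> g h S"] \<tau>[OF gh] t[OF k'] t[OF k(1)] k(2) gh g h SO A k(1)
        by simp
      also have "act_ar (g \<ast> h) (\<pi> k) \<odot> gam \<T> g h S = gam \<T> g h (act_ob k A) \<odot> act_ar g (act_ar h (\<pi> k))"
        using gam_nat[OF g h t(5)[OF k(1)]] t[OF k(1)] by simp
      also have "gam \<T> (g \<ast> h) k A \<odot> \<dots> =
          (gam \<T> g (h \<ast> k) A \<odot> act_ar g (gam \<T> h k A)) \<odot> act_ar g (act_ar h (\<pi> k))"
        using Cmp_rewrite[OF gam_cocycle[OF g h k(1) A, symmetric], of "act_ar g (act_ar h (\<pi> k))"]
          t[OF k(1)] g h k A gh by simp
      also have "\<dots> = gam \<T> g (h \<ast> k) A \<odot> act_ar g (\<pi> (h \<ast> k) \<odot> \<tau> h)"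
        using \<pi>\<tau>[OF h k(1)] t[OF k(1)] g h k(1,3) A m_assoc[OF g h k(1)] by simp
      also have "\<dots> = \<pi> k' \<odot> (\<tau> g \<odot> act_ar g (\<tau> h))"
        using Cmp_rewrite[OF \<pi>\<tau>[OF g k(3)], of "act_ar g (\<tau> h)"] \<tau>[OF g] \<tau>[OF h] t[OF k(3)] t[OF k'] k(4) g h k(3) A
        by simp
      finally show "\<pi> k' \<odot> (\<tau> (g \<ast> h) \<odot> gam \<T> g h S) = \<pi> k' \<odot> (\<tau> g \<odot> act_ar g (\<tau> h))" .
    qed
  qed
  have compat: "\<iota> (h \<ast> g) \<odot> gam \<T> h g A = \<tau> h \<odot> act_ar h (\<iota> g)" if h: "h \<in> carrier G" and g: "g \<in> carrier G" for h g
  proof (rule direct_sum_jointly_monic[OF s])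
    have hg': "h \<ast> g \<in> carrier G" using g h by simp
    show "\<iota> (h \<ast> g) \<odot> gam \<T> h g A \<in> Hom K (act_ob h (act_ob g A)) S"
      "\<tau> h \<odot> act_ar h (\<iota> g) \<in> Hom K (act_ob h (act_ob g A)) S"
      using t[OF g] t[OF hg'] \<tau>[OF h] g h A by (simp_all add: Hom_def)
    fix k' assume k': "k' \<in> carrier G"
    define k where "k = inv\<^bsub>G\<^esub> h \<ast> k'"
    have k: "k \<in> carrier G" "h \<ast> k = k'" using hg[OF h k'] by (simp_all add: k_def)
    have "\<pi> k' \<odot> (\<tau> h \<odot> act_ar h (\<iota> g)) = gam \<T> h k A \<odot> act_ar h (\<pi> k \<odot> \<iota> g)"
      using Cmp_rewrite[OF \<pi>\<tau>[OF h k(1)], of "act_ar h (\<iota> g)"] t[OF g] t[OF k(1)] t[OF k'] \<tau>[OF h] g h k A by simp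
    also have "\<dots> = \<pi> k' \<odot> (\<iota> (h \<ast> g) \<odot> gam \<T> h g A)"
    proof (cases "g = k")
      case True
      have "\<pi> k \<odot> \<iota> g = Ide K (act_ob k A)" "\<pi> k' \<odot> \<iota> (h \<ast> g) = Ide K (act_ob k' A)"
        using direct_sum_rules(1)[OF s k(1)] direct_sum_rules(1)[OF s k'] True k(2) by simp_all
      then show ?thesis
        using Cmp_rewrite[of "\<pi> k'" "\<iota> (h \<ast> g)" _ "gam \<T> h g A"] t[OF hg'] t[OF k'] g h k A True by simp
    next
      case False
      then have "k' \<noteq> h \<ast> g" using k g h by auto
      then have "\<pi> k \<odot> \<iota> g = Zer K (act_ob g A) (act_ob k A)"
        "\<pi> k' \<odot> \<iota> (h \<ast> g) = Zer K (act_ob (h \<ast> g) A) (act_ob k' A)"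
        using direct_sum_rules(2)[OF s g k(1)] direct_sum_rules(2)[OF s hg' k'] False by simp_all
      then show ?thesis
        using Cmp_rewrite[of "\<pi> k'" "\<iota> (h \<ast> g)" _ "gam \<T> h g A"] t[OF hg'] t[OF k'] g h k A by simp
    qed
    finally show "\<pi> k' \<odot> (\<iota> (h \<ast> g) \<odot> gam \<T> h g A) = \<pi> k' \<odot> (\<tau> h \<odot> act_ar h (\<iota> g))" by simp
  qed
  have "induced A (Ind' A) \<iota> \<pi>"
    unfolding induced_def Ind family_from_def family_to_def
    using A EO s compat \<pi>\<tau> t by (simp add: Hom_def)
  then show ?thesis by (rule that)
qed

end

section \<open>Zariski topologies\<close>

text \<open>The sets \<open>V(S) = {P \<in> X. S \<inter> P = {}}\<close> are closed under binary unions if any two objects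
  \<open>A\<close>, \<open>B\<close> have a sum \<open>C A B\<close> that lies in a point iff both do: then \<open>V(S) \<union> V(S')\<close> is
  \<open>V(S'')\<close>, where \<open>S''\<close> consists of the sums of objects of \<open>S\<close> with objects of \<open>S'\<close>. The empty
  set is \<open>V(Obj)\<close> because points are nonempty.\<close>

locale zariski_space =
  fixes Obj :: "'o set" and X :: "'o set set"
  assumes sums: "\<And>A B. A \<in> Obj \<Longrightarrow> B \<in> Obj \<Longrightarrow> \<exists>C \<in> Obj. \<forall>P \<in> X. C \<in> P \<longleftrightarrow> A \<in> P \<and> B \<in> P"
    and nonempty: "\<And>P. P \<in> X \<Longrightarrow> P \<inter> Obj \<noteq> {}"
begin

lemma openin_zariski: "openin (zariski_topology Obj X) U \<longleftrightarrow>
      U \<subseteq> X \<and> (\<exists>S \<subseteq> Obj. X - U = {P \<in> X. S \<inter> P = {}})"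
proof -
  let ?L = "\<lambda>U. U \<subseteq> X \<and> (\<exists>S \<subseteq> Obj. X - U = {P \<in> X. S \<inter> P = {}})"
  have "istopology ?L"
    unfolding istopology_def
  proof (intro conjI allI impI)
    fix U U' assume U: "?L U" and U': "?L U'"
    obtain S where S: "S \<subseteq> Obj" "X - U = {P \<in> X. S \<inter> P = {}}" using U by blast
    obtain S' where S': "S' \<subseteq> Obj" "X - U' = {P \<in> X. S' \<inter> P = {}}" using U' by blast
    have "\<forall>A \<in> Obj. \<forall>B \<in> Obj. \<exists>C \<in> Obj. \<forall>P \<in> X. C \<in> P \<longleftrightarrow> A \<in> P \<and> B \<in> P" using sums by blast
    then obtain C where C: "\<And>A B. A \<in> Obj \<Longrightarrow> B \<in> Obj \<Longrightarrow> C A B \<in> Obj"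
      "\<And>A B P. \<lbrakk>A \<in> Obj; B \<in> Obj; P \<in> X\<rbrakk> \<Longrightarrow> C A B \<in> P \<longleftrightarrow> A \<in> P \<and> B \<in> P"
      by metis
    define S'' where "S'' = {C A B | A B. A \<in> S \<and> B \<in> S'}"
    have iff: "S'' \<inter> P = {} \<longleftrightarrow> S \<inter> P = {} \<or> S' \<inter> P = {}" if P: "P \<in> X" for P
    proof
      assume empty: "S'' \<inter> P = {}"
      have "\<not> (A \<in> P \<and> B \<in> P)" if "A \<in> S" "B \<in> S'" for A B
        using empty C(2)[of A B P] P that S(1) S'(1) unfolding S''_def by blast
      then show "S \<inter> P = {} \<or> S' \<inter> P = {}" by blast
    next
      assume "S \<inter> P = {} \<or> S' \<inter> P = {}"
      then show "S'' \<inter> P = {}"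
        using C(2)[OF _ _ P] S(1) S'(1) unfolding S''_def by blast
    qed
    show "U \<inter> U' \<subseteq> X" using U by blast
    have "X - U \<inter> U' = (X - U) \<union> (X - U')" by blast
    also have "\<dots> = {P \<in> X. S'' \<inter> P = {}}" using iff S(2) S'(2) by auto
    finally have "X - U \<inter> U' = {P \<in> X. S'' \<inter> P = {}}" .
    moreover have "S'' \<subseteq> Obj" using C(1) S(1) S'(1) unfolding S''_def by blast
    ultimately show "\<exists>S \<subseteq> Obj. X - U \<inter> U' = {P \<in> X. S \<inter> P = {}}" by blast
  next
    fix \<U> assume \<U>: "\<forall>U \<in> \<U>. ?L U"
    then show "\<Union>\<U> \<subseteq> X" by blast
    obtain S where S: "\<And>U. U \<in> \<U> \<Longrightarrow> S U \<subseteq> Obj \<and> X - U = {P \<in> X. S U \<inter> P = {}}"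
      using \<U> by metis
    have "X - \<Union>\<U> = {P \<in> X. (\<Union>U \<in> \<U>. S U) \<inter> P = {}}"
    proof (intro subset_antisym subsetI)
      fix P assume P: "P \<in> X - \<Union>\<U>"
      then have "S U \<inter> P = {}" if "U \<in> \<U>" for U using S[OF that] that by blast
      then show "P \<in> {P \<in> X. (\<Union>U \<in> \<U>. S U) \<inter> P = {}}" using P by blast
    next
      fix P assume P: "P \<in> {P \<in> X. (\<Union>U \<in> \<U>. S U) \<inter> P = {}}"
      have "P \<in> X - U" if U: "U \<in> \<U>" for U
      proof -
        have "S U \<inter> P = {}" using P U by blast
        then show ?thesis using conjunct2[OF S[OF U]] P by blast
      qed
      then show "P \<in> X - \<Union>\<U>" using P by blast
    qed
    then show "\<exists>S \<subseteq> Obj. X - \<Union>\<U> = {P \<in> X. S \<inter> P = {}}"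
      using S by (intro exI[of _ "\<Union>U \<in> \<U>. S U"]) blast
  qed
  then show ?thesis
    unfolding zariski_topology_def by (simp add: topology_inverse')
qed

lemma topspace_zariski: "topspace (zariski_topology Obj X) = X"
proof -
  have "X - X = {P \<in> X. Obj \<inter> P = {}}" using nonempty by blast
  then have "openin (zariski_topology Obj X) X" unfolding openin_zariski by blast
  moreover have "\<And>U. openin (zariski_topology Obj X) U \<Longrightarrow> U \<subseteq> X" unfolding openin_zariski by blast
  ultimately show ?thesis unfolding topspace_def by blast
qed

end

lemma continuous_map_zariski:
  assumes X: "zariski_space Obj X" and X': "zariski_space Obj' X'"
    and f: "\<And>P. P \<in> X \<Longrightarrow> f P \<in> X'"
    and t: "\<And>A. A \<in> Obj' \<Longrightarrow> t A \<in> Obj" "\<And>A P. A \<in> Obj' \<Longrightarrow> P \<in> X \<Longrightarrow> A \<in> f P \<longleftrightarrow> t A \<in> P"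
  shows "continuous_map (zariski_topology Obj X) (zariski_topology Obj' X') f"
proof -
  note o = zariski_space.openin_zariski[OF X] and ts = zariski_space.topspace_zariski[OF X]
  note o' = zariski_space.openin_zariski[OF X'] and ts' = zariski_space.topspace_zariski[OF X']
  have "openin (zariski_topology Obj X) {P \<in> X. f P \<in> U}" if U: "openin (zariski_topology Obj' X') U" for U
  proof -
    obtain S where S: "S \<subseteq> Obj'" "X' - U = {P \<in> X'. S \<inter> P = {}}"
      using U unfolding o' by (elim conjE exE) iprover
    have "f P \<notin> U \<longleftrightarrow> t ` S \<inter> P = {}" if P: "P \<in> X" for P
    proof -
      have "f P \<notin> U \<longleftrightarrow> S \<inter> f P = {}" using S(2) f[OF P] by blast
      also have "\<dots> \<longleftrightarrow> t ` S \<inter> P = {}" using t(2)[OF _ P] S(1) by blast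
      finally show ?thesis .
    qed
    then have "X - {P \<in> X. f P \<in> U} = {P \<in> X. t ` S \<inter> P = {}}" by auto
    moreover have "t ` S \<subseteq> Obj" using S(1) t(1) by blast
    ultimately have "\<exists>S \<subseteq> Obj. X - {P \<in> X. f P \<in> U} = {P \<in> X. S \<inter> P = {}}" by blast
    then show ?thesis by (subst o) simp
  qed
  then show ?thesis using f by (auto simp: continuous_map_def ts ts')
qed

section \<open>Thick ideals\<close>

context monoidal_triangulated_category
begin

lemma thick_ideal_rules:
  assumes "thick_ideal K I"
  shows "triangulated_subcategory K I" "I \<subseteq> Ob K" "I \<noteq> {}"
    "\<And>A S. S \<in> I \<Longrightarrow> A \<in> Ob K \<Longrightarrow> direct_summand K A S \<Longrightarrow> A \<in> I"
    "\<And>A B. A \<in> I \<Longrightarrow> B \<in> Ob K \<Longrightarrow> TO K A B \<in> I" "\<And>A B. A \<in> I \<Longrightarrow> B \<in> Ob K \<Longrightarrow> TO K B A \<in> I"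
  using assms unfolding thick_ideal_def triangulated_subcategory_def by blast+

lemma thick_ideal_retract:
  assumes I: "thick_ideal K I" and S: "S \<in> I"
    and i: "i \<in> Hom K A S" and p: "p \<in> Hom K S A" "p \<cdot> i = Ide K A"
  shows "A \<in> I"
proof -
  obtain B j q where "is_biproduct2 K A B S i j p q"
    using split_mono_complement[OF i p] by blast
  then have "direct_summand K A S" unfolding direct_summand_def by blast
  then show ?thesis using thick_ideal_rules(4)[OF I S] Hom_Ob[OF i] by blast
qed

lemma thick_ideal_biproduct_iff:
  assumes I: "thick_ideal K I" and b: "is_biproduct2 K A B S i1 i2 p1 p2"
  shows "S \<in> I \<longleftrightarrow> A \<in> I \<and> B \<in> I"
proof
  note h = b[unfolded is_biproduct2_def]
  assume "S \<in> I"
  then show "A \<in> I \<and> B \<in> I"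
    using thick_ideal_retract[OF I, of S i1 A p1] thick_ideal_retract[OF I, of S i2 B p2] h by blast
next
  assume "A \<in> I \<and> B \<in> I"
  then show "S \<in> I"
    using triangulated_subcategory_biproduct[OF thick_ideal_rules(1)[OF I] b] by blast
qed

end

context mt_action
begin

lemma KG_thick_rules:
  assumes J: "thick_ideal KG J"
  shows KG_thick_EO: "J \<subseteq> EO" and KG_thick_nonempty: "J \<noteq> {}"
    and KG_thick_shift: "\<And>X. X \<in> EO \<Longrightarrow> shift X \<in> J \<longleftrightarrow> X \<in> J"
    and KG_thick_tensor: "\<And>X Y. X \<in> J \<Longrightarrow> Y \<in> EO \<Longrightarrow> tensor X Y \<in> J"
      "\<And>X Y. X \<in> J \<Longrightarrow> Y \<in> EO \<Longrightarrow> tensor Y X \<in> J"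
  using J unfolding thick_ideal_def triangulated_subcategory_def KG_simps by blast+

lemma KG_thick_retract:
  assumes J: "thick_ideal KG J" and Y: "Y \<in> J" and r: "eq_retract X Y"
  shows "X \<in> J"
proof -
  obtain i p where ip: "eq_arrow X Y i" "eq_arrow Y X p" "p \<odot> i = Ide K (fst X)"
    using r unfolding eq_retract_def by blast
  then have "direct_summand KG X Y" by (rule eq_retract_direct_summand)
  then show ?thesis
    using J Y eq_arrow_rules(1)[OF ip(1)] unfolding thick_ideal_def by simp
qed

lemma KG_thick_cone:
  assumes J: "thick_ideal KG J" and XY: "X \<in> J" "Y \<in> J"
    and f: "eq_arrow X Y f" and g: "eq_arrow Y Z g" and h: "eq_arrow Z (shift X) h"
    and tri: "(f, g, h) \<in> Tri K"
  shows "Z \<in> J"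
proof -
  have "((X, Y, f), (Y, Z, g), (Z, shift X, h)) \<in> Tri KG"
    using f g h tri by (simp add: Tri_KG)
  then have "Dom KG (X, Y, f) \<in> J \<longrightarrow> Cod KG (X, Y, f) \<in> J \<longrightarrow> Cod KG (Y, Z, g) \<in> J"
    using J unfolding thick_ideal_def triangulated_subcategory_def by blast
  then show ?thesis using XY by simp
qed

lemma Hom_KG_E:
  assumes "f' \<in> Hom KG X Y"
  obtains f where "f' = (X, Y, f)" "eq_arrow X Y f"
  using assms by (metis Hom_KG prod_cases3)

lemma mem_equivariant_ideal: "X \<in> E I \<longleftrightarrow> X \<in> EO \<and> fst X \<in> I"
  by (auto simp: equivariant_ideal_def)

lemma mem_restricted_ideal: "A \<in> R J \<longleftrightarrow> A \<in> Ob K \<and> Ind' A \<in> J"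
  by (auto simp: restricted_ideal_def)

lemma zero_equivariant_object:
  assumes Z: "is_zero K Z"
  shows "(Z, \<lambda>g \<in> carrier G. Zer K (act_ob g Z) Z) \<in> EO"
proof -
  have ZO: "Z \<in> Ob K" using Z by (rule is_zero_typing)
  show ?thesis
  proof (rule equivariant_objectI[OF ZO])
    show "Zer K (act_ob eG Z) Z = unit_ar Z"
      using is_zero_arrows(2)[OF Z, of "unit_ar Z"] ZO by simp
  qed (use ZO in \<open>simp_all add: Hom_def\<close>)
qed

theorem equivariant_ideal_thick:
  assumes I: "thick_ideal K I"
  shows "thick_ideal KG (E I)"
proof -
  let ?J = "E I"
  note tI = triangulated_subcategory_rules[OF thick_ideal_rules(1)[OF I]]
  have nonempty: "?J \<noteq> {}"
  proof -
    obtain Z where Z: "is_zero K Z" using zero_object by blast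
    have "(Z, \<lambda>g \<in> carrier G. Zer K (act_ob g Z) Z) \<in> ?J"
      using zero_equivariant_object[OF Z] tI(3)[OF Z] by (simp add: mem_equivariant_ideal)
    then show ?thesis by blast
  qed
  have iso: "Y \<in> ?J" if X: "X \<in> ?J" and Y: "Y \<in> EO" and XY: "isomorphic KG X Y" for X Y
  proof -
    obtain f' where f': "f' \<in> Hom KG X Y" "is_iso KG f'" using XY by (auto simp: isomorphic_def)
    obtain f where f: "f' = (X, Y, f)" "eq_arrow X Y f" using f'(1) by (rule Hom_KG_E)
    obtain g' where inv: "inverse_arrows KG f' g'" using f'(2) unfolding is_iso_def by blast
    have g': "g' \<in> Hom KG Y X" "Cmp KG g' f' = Ide KG X" "Cmp KG f' g' = Ide KG Y"
      using inv unfolding inverse_arrows_def f(1) KG_simps(3,4) by blast+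
    obtain g where g: "g' = (Y, X, g)" "eq_arrow Y X g" using g'(1) by (rule Hom_KG_E)
    have "f \<in> Hom K (fst X) (fst Y)" "g \<in> Hom K (fst Y) (fst X)" "g \<odot> f = Ide K (fst X)" "f \<odot> g = Ide K (fst Y)"
      using f g g'(2,3) by (auto simp: eq_arrow_def)
    then have "isomorphic K (fst X) (fst Y)"
      unfolding isomorphic_def using is_isoI by blast
    then show ?thesis using tI(2) X Y by (auto simp: mem_equivariant_ideal)
  qed
  have zero: "Z \<in> ?J" if Z: "is_zero KG Z" for Z
  proof -
    have ZE: "Z \<in> EO" using Z by (simp add: is_zero_def is_initial_def)
    have "\<exists>!f. f \<in> Hom KG Z Z" using Z ZE by (simp add: is_zero_def is_initial_def)
    moreover have "(Z, Z, Ide K (fst Z)) \<in> Hom KG Z Z" "(Z, Z, Zer K (fst Z) (fst Z)) \<in> Hom KG Z Z"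
      using eq_arrow_Ide[OF ZE] eq_arrow_Zer[OF ZE ZE] by simp_all
    ultimately have "Ide K (fst Z) = Zer K (fst Z) (fst Z)" by blast
    then have "is_zero K (fst Z)" using is_zero_iff ZE by simp
    then show ?thesis using tI(3) ZE by (simp add: mem_equivariant_ideal)
  qed
  have shift: "X \<in> ?J \<longleftrightarrow> shift X \<in> ?J" if "X \<in> EO" for X
    using that tI(4) by (simp add: mem_equivariant_ideal)
  have cone: "Cod KG g \<in> ?J" if t: "(f, g, h) \<in> Tri KG" and "Dom KG f \<in> ?J" "Cod KG f \<in> ?J" for f g h
  proof -
    obtain X Y f' Y' Z g' Z' W h' where e: "f = (X, Y, f')" "g = (Y', Z, g')" "h = (Z', W, h')"
      by (cases f; cases g; cases h) auto
    have k: "eq_arrow X Y f'" "eq_arrow Y Z g'" "(f', g', h') \<in> Tri K"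
      using t unfolding e Tri_KG by auto
    have "Cod K g' \<in> I"
      by (rule tI(5)[OF k(3)]) (use that(2,3) k(1) in \<open>auto simp: e mem_equivariant_ideal eq_arrow_def Hom_def\<close>)
    then show ?thesis using k(2) by (auto simp: e mem_equivariant_ideal eq_arrow_def Hom_def)
  qed
  have summand: "X \<in> ?J" if Y: "Y \<in> ?J" and X: "X \<in> EO" and s: "direct_summand KG X Y" for X Y
  proof -
    obtain B i1 i2 p1 p2 where b: "is_biproduct2 KG X B Y i1 i2 p1 p2"
      using s unfolding direct_summand_def by blast
    have h: "i1 \<in> Hom KG X Y" "p1 \<in> Hom KG Y X" and pi: "Cmp KG p1 i1 = Ide KG X"
      using b by (auto simp: is_biproduct2_def)
    obtain i where i: "i1 = (X, Y, i)" "eq_arrow X Y i" using h(1) by (rule Hom_KG_E)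
    obtain p where p: "p1 = (Y, X, p)" "eq_arrow Y X p" using h(2) by (rule Hom_KG_E)
    have "p \<odot> i = Ide K (fst X)" using pi i p by simp
    then have "fst X \<in> I"
      using thick_ideal_retract[OF I, of "fst Y" i "fst X" p] i p Y by (simp add: eq_arrow_def mem_equivariant_ideal)
    then show ?thesis using X by (simp add: mem_equivariant_ideal)
  qed
  have tensor: "tensor X Y \<in> ?J \<and> tensor Y X \<in> ?J" if "X \<in> ?J" "Y \<in> EO" for X Y
    using that thick_ideal_rules(5,6)[OF I] by (simp add: mem_equivariant_ideal)
  have triangulated: "triangulated_subcategory KG ?J"
    unfolding triangulated_subcategory_def KG_simps
  proof (intro conjI ballI allI impI)
    show "?J \<subseteq> EO" by (auto simp: mem_equivariant_ideal)
  qed (fact iso zero nonempty shift cone)+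
  show ?thesis
    unfolding thick_ideal_def KG_simps
  proof (intro conjI ballI impI)
    fix X Y assume "X \<in> ?J" "Y \<in> EO"
    then show "tensor X Y \<in> ?J" "tensor Y X \<in> ?J" using tensor by auto
  qed (fact triangulated summand)+
qed

section \<open>Restriction of ideals along induction\<close>

lemma induced_rules:
  assumes "induced A Y \<iota> \<pi>"
  shows "A \<in> Ob K" "Y \<in> EO" "is_direct_sum K (carrier G) (\<lambda>g. act_ob g A) (fst Y) \<iota> \<pi>"
    "family_from A Y \<iota>" "family_to A Y \<pi>" "orthonormal A \<iota> \<pi>"
  using assms by (auto simp: induced_def orthonormal_def is_direct_sum_def)

lemma EO_structure_Hom: "Y \<in> EO \<Longrightarrow> h \<in> carrier G \<Longrightarrow> snd Y h \<in> Hom K (act_ob h (fst Y)) (fst Y)"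
  by (simp add: Hom_def)

end

text \<open>Finiteness of \<open>G\<close> guarantees that the direct sums defining \<open>Ind\<close> exist.\<close>

locale finite_mt_action = mt_action +
  assumes finite_G: "finite (carrier G)"
begin

lemma restricted_idealI:
  assumes J: "thick_ideal KG J" and X: "X \<in> J" and A: "A \<in> Ob K"
    and c: "family_from A X \<iota>'" "family_to A X \<pi>'" "orthonormal A \<iota>' \<pi>'"
  shows "A \<in> R J"
proof -
  obtain \<iota> \<pi> where ind: "induced A (Ind' A) \<iota> \<pi>" using Ind_induced[OF finite_G A] by blast
  have "eq_retract (Ind' A) X"
    using induced_retract[OF ind _ c] KG_thick_EO[OF J] X by blast
  then show ?thesis using KG_thick_retract[OF J X] A by (simp add: mem_restricted_ideal)
qed

lemma restricted_idealE:
  assumes "A \<in> R J"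
  obtains \<iota> \<pi> where "induced A (Ind' A) \<iota> \<pi>" "Ind' A \<in> J"
  using assms Ind_induced[OF finite_G, of A] by (auto simp: mem_restricted_ideal)

lemma Ind_EO:
  assumes A: "A \<in> Ob K"
  shows "Ind' A \<in> EO"
proof -
  obtain \<iota> \<pi> where ind: "induced A (Ind' A) \<iota> \<pi>" using Ind_induced[OF finite_G A] by blast
  then show ?thesis by (rule induced_rules(2))
qed

lemma restricted_ideal_retract:
  assumes J: "thick_ideal KG J" and A: "A \<in> R J"
    and i: "i \<in> Hom K B A" and p: "p \<in> Hom K A B" "p \<odot> i = Ide K B"
  shows "B \<in> R J"
proof -
  obtain \<iota> \<pi> where ind: "induced A (Ind' A) \<iota> \<pi>" and IA: "Ind' A \<in> J" using A by (rule restricted_idealE)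
  have B: "B \<in> Ob K" using Hom_Ob[OF i] by blast
  obtain \<iota>' \<pi>' where ind': "induced B (Ind' B) \<iota>' \<pi>'" using Ind_induced[OF finite_G B] by blast
  note r = induced_rules[OF ind] and r' = induced_rules[OF ind']
  note ti = Hom_rules[OF i] and tp = Hom_rules[OF p(1)]
  obtain i' where i': "eq_arrow (Ind' B) (Ind' A) i'" "\<And>g. g \<in> carrier G \<Longrightarrow> i' \<odot> \<iota>' g = \<iota> g \<odot> act_ar g i"
    using induced_arrow_from[OF ind' r(2) family_from_precompose[OF r(4) ti EO_structure_Hom[OF r(2)]]] by blast
  obtain p' where p': "eq_arrow (Ind' A) (Ind' B) p'" "\<And>g. g \<in> carrier G \<Longrightarrow> p' \<odot> \<iota> g = \<iota>' g \<odot> act_ar g p"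
    using induced_arrow_from[OF ind r'(2) family_from_precompose[OF r'(4) tp EO_structure_Hom[OF r'(2)]]] by blast
  note ti' = eq_arrow_rules(3-5)[OF i'(1)] and tp' = eq_arrow_rules(3-5)[OF p'(1)]
  have "p' \<odot> i' = Ide K (fst (Ind' B))"
  proof (rule direct_sum_jointly_epic[OF r'(3)])
    show "p' \<odot> i' \<in> Hom K (fst (Ind' B)) (fst (Ind' B))" "Ide K (fst (Ind' B)) \<in> Hom K (fst (Ind' B)) (fst (Ind' B))"
      using ti' tp' r'(2) by (simp_all add: Hom_def)
    fix g assume g: "g \<in> carrier G"
    note t = direct_sum_typing[OF r(3) g] direct_sum_typing[OF r'(3) g]
    have "(p' \<odot> i') \<odot> \<iota>' g = \<iota>' g \<odot> act_ar g (p \<odot> i)"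
      using Cmp_rewrite[OF p'(2)[OF g], of "act_ar g i"] i'(2)[OF g] t ti tp ti' tp' g by simp
    then show "(p' \<odot> i') \<odot> \<iota>' g = Ide K (fst (Ind' B)) \<odot> \<iota>' g"
      using p(2) t B g by simp
  qed
  then have "eq_retract (Ind' B) (Ind' A)" using i'(1) p'(1) by (auto simp: eq_retract_def)
  then show ?thesis using KG_thick_retract[OF J IA] B by (simp add: mem_restricted_ideal)
qed

text \<open>With the structure \<open>\<phi>\<close> of \<open>X\<close> and its inverse as the first system, this is the projection
  formula: \<open>Ind (A \<otimes> B)\<close> is a direct summand of \<open>X \<otimes> Ind B\<close>. Orthogonality is inherited from the
  second factor, because a tensor product with a zero arrow is zero.\<close>

lemma restricted_ideal_tensor:
  assumes J: "thick_ideal KG J" and XY: "tensor X Y \<in> J" and X: "X \<in> EO" and Y: "Y \<in> EO"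
    and A: "A \<in> Ob K" "B \<in> Ob K"
    and c: "family_from A X \<iota>" "family_to A X \<pi>" "family_from B Y \<iota>'" "family_to B Y \<pi>'"
    and diagonal: "\<And>g. g \<in> carrier G \<Longrightarrow> \<pi> g \<odot> \<iota> g = Ide K (act_ob g A)"
    and orthonormal: "orthonormal B \<iota>' \<pi>'"
  shows "TO K A B \<in> R J"
proof -
  have "orthonormal (TO K A B) (\<lambda>g. TA K (\<iota> g) (\<iota>' g) \<odot> inv_ar K (mu \<T> g A B))
      (\<lambda>g. mu \<T> g A B \<odot> TA K (\<pi> g) (\<pi>' g))"
    unfolding orthonormal_def
  proof (intro ballI)
    fix g h assume g: "g \<in> carrier G" and h: "h \<in> carrier G"
    note t = family_from_rules(1-3)[OF c(1) g] family_to_rules(1-3)[OF c(2) h]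
      family_from_rules(1-3)[OF c(3) g] family_to_rules(1-3)[OF c(4) h]
    let ?x = "TA K (\<pi> h \<odot> \<iota> g) (\<pi>' h \<odot> \<iota>' g)"
    have "(mu \<T> h A B \<odot> TA K (\<pi> h) (\<pi>' h)) \<odot> (TA K (\<iota> g) (\<iota>' g) \<odot> inv_ar K (mu \<T> g A B)) =
        mu \<T> h A B \<odot> ((TA K (\<pi> h) (\<pi>' h) \<odot> TA K (\<iota> g) (\<iota>' g)) \<odot> inv_ar K (mu \<T> g A B))"
      using t A g h by simp
    also have "TA K (\<pi> h) (\<pi>' h) \<odot> TA K (\<iota> g) (\<iota>' g) = ?x" using t by (simp add: TA_merge)
    also have "mu \<T> h A B \<odot> (?x \<odot> inv_ar K (mu \<T> g A B)) =
        (if g = h then Ide K (act_ob g (TO K A B)) else Zer K (act_ob g (TO K A B)) (act_ob h (TO K A B)))"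
    proof (cases "g = h")
      case True
      then show ?thesis using diagonal[OF g] orthonormal A g by (simp add: orthonormal_def)
    next
      case False
      then have "\<pi>' h \<odot> \<iota>' g = Zer K (act_ob g B) (act_ob h B)" using orthonormal g h by (simp add: orthonormal_def)
      then have "?x = Zer K (TO K (act_ob g A) (act_ob g B)) (TO K (act_ob h A) (act_ob h B))"
        using TA_Zer[of "\<pi> h \<odot> \<iota> g"] t A g h by simp
      then show ?thesis using False A g h by simp
    qed
    finally show "(mu \<T> h A B \<odot> TA K (\<pi> h) (\<pi>' h)) \<odot> (TA K (\<iota> g) (\<iota>' g) \<odot> inv_ar K (mu \<T> g A B)) =
        (if g = h then Ide K (act_ob g (TO K A B)) else Zer K (act_ob g (TO K A B)) (act_ob h (TO K A B)))" .
  qed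
  then show ?thesis
    using restricted_idealI[OF J XY TO_Ob'[OF A] family_from_tensor[OF c(1,3) A X Y] family_to_tensor[OF c(2,4) A X Y]]
    by blast
qed

lemma induced_tensor:
  assumes J: "thick_ideal KG J" and A: "A \<in> Ob K" "B \<in> Ob K"
    and AB: "tensor (Ind' A) (Ind' B) \<in> J"
  shows "TO K A B \<in> R J"
proof -
  obtain \<iota> \<pi> where ind: "induced A (Ind' A) \<iota> \<pi>" using Ind_induced[OF finite_G A(1)] by blast
  obtain \<iota>' \<pi>' where ind': "induced B (Ind' B) \<iota>' \<pi>'" using Ind_induced[OF finite_G A(2)] by blast
  note r = induced_rules[OF ind] and r' = induced_rules[OF ind']
  show ?thesis
    by (rule restricted_ideal_tensor[OF J AB r(2) r'(2) A r(4,5) r'(4,5)])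
      (use r(6) r'(6) in \<open>simp_all add: orthonormal_def\<close>)
qed

lemma underlying_mem_restricted_ideal:
  assumes J: "thick_ideal KG J" and XJ: "X \<in> J"
  shows "fst X \<in> R J"
proof -
  have X: "X \<in> EO" using KG_thick_EO[OF J] XJ by blast
  let ?A = "fst X"
  obtain \<iota> \<pi> where ind: "induced (Unt K) (Ind' (Unt K)) \<iota> \<pi>" using Ind_induced[OF finite_G Unt_Ob] by blast
  note r = induced_rules[OF ind]
  have "TO K ?A (Unt K) \<in> R J"
    by (rule restricted_ideal_tensor[OF J KG_thick_tensor(1)[OF J XJ r(2)] X r(2) EO_Ob[OF X] Unt_Ob
          family_from_structure[OF X] family_to_structure[OF X] r(4,5)])
      (use X r(6) in \<open>simp_all add: orthonormal_def\<close>)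
  moreover have "Run K ?A \<in> Hom K (TO K ?A (Unt K)) ?A" "is_iso K (Run K ?A)" using Run_iso X by simp_all
  ultimately show ?thesis
    using restricted_ideal_retract[OF J, of _ "inv_ar K (Run K ?A)" ?A "Run K ?A"] by (simp add: Hom_def)
qed

lemma restricted_ideal_zero:
  assumes J: "thick_ideal KG J" and Z: "is_zero K Z"
  shows "Z \<in> R J"
proof -
  obtain X where X: "X \<in> J" using KG_thick_nonempty[OF J] by blast
  then have A: "fst X \<in> R J" "fst X \<in> Ob K"
    using underlying_mem_restricted_ideal[OF J] by (auto simp: mem_restricted_ideal)
  show ?thesis
    by (rule restricted_ideal_retract[OF J A(1), of "Zer K Z (fst X)" _ "Zer K (fst X) Z"])
      (use A(2) Z in \<open>simp_all add: is_zero_iff Hom_def\<close>)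
qed

lemma restricted_ideal_act:
  assumes J: "thick_ideal KG J" and A: "A \<in> R J" and k: "k \<in> carrier G"
  shows "act_ob k A \<in> R J"
proof -
  obtain \<iota> \<pi> where ind: "induced A (Ind' A) \<iota> \<pi>" and IA: "Ind' A \<in> J" using A by (rule restricted_idealE)
  note s = induced_rules(3)[OF ind]
  show ?thesis
    by (rule restricted_ideal_retract[OF J underlying_mem_restricted_ideal[OF J IA], of "\<iota> k" _ "\<pi> k"])
      (use direct_sum_typing[OF s k] direct_sum_rules(1)[OF s k] in \<open>simp_all add: Hom_def\<close>)
qed

lemma restricted_ideal_shift:
  assumes J: "thick_ideal KG J" and A: "A \<in> Ob K"
  shows "SO A \<in> R J \<longleftrightarrow> A \<in> R J"
proof -
  let ?\<Sigma>A = "SO A" and ?X = "shift (Ind' A)"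
  obtain \<iota> \<pi> where ind: "induced A (Ind' A) \<iota> \<pi>" using Ind_induced[OF finite_G A] by blast
  note r = induced_rules[OF ind] and t = direct_sum_typing[OF induced_rules(3)[OF ind]]
  obtain \<iota>' \<pi>' where ind': "induced ?\<Sigma>A (Ind' ?\<Sigma>A) \<iota>' \<pi>'" using Ind_induced[OF finite_G Sh_Ob[OF A]] by blast
  note r' = induced_rules[OF ind'] and t' = direct_sum_typing[OF induced_rules(3)[OF ind']]
  have X: "?X \<in> EO" using r(2) by simp
  have Sh_o: "SA (\<pi> h) \<odot> SA (\<iota> g) = (if g = h then Ide K (SO (act_ob g A))
      else Zer K (SO (act_ob g A)) (SO (act_ob h A)))"
    if "g \<in> carrier G" "h \<in> carrier G" for g h
    using that r(6) t A by (simp add: orthonormal_def del: Sh_Cmp add: Sh_Cmp[symmetric])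
  \<comment> \<open>the canonical arrow from \<open>Ind\<close> of the shift to the shift of \<open>Ind A\<close> is an isomorphism\<close>
  obtain e where e: "eq_arrow (Ind' ?\<Sigma>A) ?X e" "\<And>g. g \<in> carrier G \<Longrightarrow> e \<odot> \<iota>' g = SA (\<iota> g) \<odot> xi \<T> g A"
    using induced_arrow_from[OF ind' X family_from_shift[OF r(4) A r(2)]] by blast
  note te = eq_arrow_rules(3-5)[OF e(1)]
  have \<pi>e: "SA (\<pi> g) \<odot> e = xi \<T> g A \<odot> \<pi>' g" if g: "g \<in> carrier G" for g
    by (rule direct_sum_transpose[where B = "\<lambda>g. SO (act_ob g A)" and \<iota>' = "\<lambda>g. SA (\<iota> g)"
          and \<pi>' = "\<lambda>g. SA (\<pi> g)" and Y = "SO (fst (Ind' A))", OF r'(3) _ _ _ _ e(2) g])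
      (use t te A Sh_o in \<open>simp_all add: Hom_def\<close>)
  obtain p where p: "p \<in> Hom K (fst ?X) (fst (Ind' ?\<Sigma>A))"
    "\<And>g. g \<in> carrier G \<Longrightarrow> \<pi>' g \<odot> p = inv_ar K (xi \<T> g A) \<odot> SA (\<pi> g)"
    using direct_sum_pair[OF r'(3) EO_Ob[OF X], of "\<lambda>g. inv_ar K (xi \<T> g A) \<odot> SA (\<pi> g)"] t A
    by (auto simp: Hom_def)
  note tp = Hom_rules[OF p(1)]
  have ep: "e \<odot> p = Ide K (fst ?X)"
  proof (rule direct_sum_FA_jointly_monic[OF category_axioms shift_equivalence r(3)])
    show "e \<odot> p \<in> Hom K (fst ?X) (SO (fst (Ind' A)))" "Ide K (fst ?X) \<in> Hom K (fst ?X) (SO (fst (Ind' A)))"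
      using te tp r(2) by (simp_all add: Hom_def)
    fix g assume g: "g \<in> carrier G"
    have "SA (\<pi> g) \<odot> (e \<odot> p) = xi \<T> g A \<odot> (\<pi>' g \<odot> p)"
      using Cmp_rewrite[OF \<pi>e[OF g], of p] t[OF g] t'[OF g] te tp g A by simp
    then show "SA (\<pi> g) \<odot> (e \<odot> p) = SA (\<pi> g) \<odot> Ide K (fst ?X)"
      unfolding p(2)[OF g] using t[OF g] g A r(2) by simp
  qed
  have "p \<odot> e = Ide K (fst (Ind' ?\<Sigma>A))"
  proof (rule direct_sum_jointly_monic[OF r'(3)])
    show "p \<odot> e \<in> Hom K (fst (Ind' ?\<Sigma>A)) (fst (Ind' ?\<Sigma>A))"
      "Ide K (fst (Ind' ?\<Sigma>A)) \<in> Hom K (fst (Ind' ?\<Sigma>A)) (fst (Ind' ?\<Sigma>A))"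
      using te tp r'(2) by (simp_all add: Hom_def)
    fix g assume g: "g \<in> carrier G"
    show "\<pi>' g \<odot> (p \<odot> e) = \<pi>' g \<odot> Ide K (fst (Ind' ?\<Sigma>A))"
      using Cmp_rewrite[OF p(2)[OF g], of e] \<pi>e[OF g] t[OF g] t'[OF g] te tp g A by simp
  qed
  then have iso: "is_iso K e" using is_isoI[OF _ p(1) _ ep] te by (simp add: Hom_def)
  have "eq_retract (Ind' ?\<Sigma>A) ?X" "eq_retract ?X (Ind' ?\<Sigma>A)"
    using e(1) eq_arrow_inv[OF e(1) iso] inv_typing(4,5)[OF iso] te unfolding eq_retract_def by auto
  then have "Ind' ?\<Sigma>A \<in> J \<longleftrightarrow> ?X \<in> J" using KG_thick_retract[OF J] by blast
  then show ?thesis using KG_thick_shift[OF J r(2)] A by (simp add: mem_restricted_ideal)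
qed

text \<open>\<open>Ind\<close> is exact: it sends a triangle to the direct sum of its translates.\<close>

lemma restricted_ideal_cone:
  assumes J: "thick_ideal KG J" and tri: "(f, g, h) \<in> Tri K"
    and A: "Dom K f \<in> R J" and B: "Cod K f \<in> R J"
  shows "Cod K g \<in> R J"
proof -
  note ty = Tri_typing[OF tri]
  let ?A = "Dom K f" and ?B = "Cod K f" and ?C = "Cod K g"
  obtain \<iota>A \<pi>A where iA: "induced ?A (Ind' ?A) \<iota>A \<pi>A" and IA: "Ind' ?A \<in> J" using A by (rule restricted_idealE)
  obtain \<iota>B \<pi>B where iB: "induced ?B (Ind' ?B) \<iota>B \<pi>B" and IB: "Ind' ?B \<in> J" using B by (rule restricted_idealE)
  have C: "?C \<in> Ob K" using ty by simp
  obtain \<iota>C \<pi>C where iC: "induced ?C (Ind' ?C) \<iota>C \<pi>C" using Ind_induced[OF finite_G C] by blast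
  note rA = induced_rules[OF iA] and rB = induced_rules[OF iB] and rC = induced_rules[OF iC]
  let ?X = "shift (Ind' ?A)"
  have X: "?X \<in> EO" using rA(2) by simp
  have fF: "family_from ?A (Ind' ?B) (\<lambda>k. \<iota>B k \<odot> act_ar k f)"
    by (rule family_from_precompose[OF rB(4)]) (use ty EO_structure_Hom[OF rB(2)] in auto)
  have fG: "family_from ?B (Ind' ?C) (\<lambda>k. \<iota>C k \<odot> act_ar k g)"
    by (rule family_from_precompose[OF rC(4)]) (use ty EO_structure_Hom[OF rC(2)] in auto)
  have fH: "family_from ?C ?X (\<lambda>k. (SA (\<iota>A k) \<odot> xi \<T> k ?A) \<odot> act_ar k h)"
    by (rule family_from_precompose[OF family_from_shift[OF rA(4) rA(1) rA(2)]])
      (use ty EO_structure_Hom[OF X] in auto)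
  obtain F where F: "eq_arrow (Ind' ?A) (Ind' ?B) F" "\<And>k. k \<in> carrier G \<Longrightarrow> F \<odot> \<iota>A k = \<iota>B k \<odot> act_ar k f"
    using induced_arrow_from[OF iA rB(2) fF] by blast
  obtain F' where F': "eq_arrow (Ind' ?B) (Ind' ?C) F'" "\<And>k. k \<in> carrier G \<Longrightarrow> F' \<odot> \<iota>B k = \<iota>C k \<odot> act_ar k g"
    using induced_arrow_from[OF iB rC(2) fG] by blast
  obtain H where H: "eq_arrow (Ind' ?C) ?X H"
    "\<And>k. k \<in> carrier G \<Longrightarrow> H \<odot> \<iota>C k = (SA (\<iota>A k) \<odot> xi \<T> k ?A) \<odot> act_ar k h"
    using induced_arrow_from[OF iC X fH] by blast
  have "(F, F', H) \<in> Tri K"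
  proof (rule direct_sum_triangle[OF rA(3) rB(3) rC(3)])
    fix k assume k: "k \<in> carrier G"
    show "(act_ar k f, act_ar k g, xi \<T> k ?A \<odot> act_ar k h) \<in> Tri K"
      by (rule act_Tri[OF k tri])
    show "H \<odot> \<iota>C k = SA (\<iota>A k) \<odot> (xi \<T> k ?A \<odot> act_ar k h)"
      using H(2)[OF k] direct_sum_typing[OF rA(3) k] ty k by simp
    show "Dom K (act_ar k f) = act_ob k ?A \<and> Cod K (act_ar k f) = act_ob k ?B \<and> Cod K (act_ar k g) = act_ob k ?C"
      using ty k by simp
    show "F \<odot> \<iota>A k = \<iota>B k \<odot> act_ar k f" "F' \<odot> \<iota>B k = \<iota>C k \<odot> act_ar k g"
      using F(2) F'(2) k by auto
  qed (use F(1) F'(1) H(1) in \<open>simp_all add: eq_arrow_def\<close>)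
  then have "Ind' ?C \<in> J" by (rule KG_thick_cone[OF J IA IB F(1) F'(1) H(1)])
  then show ?thesis using C by (simp add: mem_restricted_ideal)
qed

theorem restricted_ideal_G_ideal:
  assumes J: "thick_ideal KG J"
  shows "G_ideal G K \<T> (R J)"
proof -
  have "B \<in> R J" if A: "A \<in> R J" and AB: "isomorphic K A B" for A B
  proof -
    obtain f where f: "f \<in> Hom K A B" "is_iso K f" using AB by (auto simp: isomorphic_def)
    then show ?thesis
      using restricted_ideal_retract[OF J A, of "inv_ar K f" B f] by (simp add: Hom_def)
  qed
  moreover have "R J \<noteq> {}" using zero_object restricted_ideal_zero[OF J] by blast
  moreover have "B \<in> R J" if "A \<in> R J" "direct_summand K B A" for A B
    using that restricted_ideal_retract[OF J that(1)] by (auto simp: direct_summand_def is_biproduct2_def)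
  moreover have "TO K A B \<in> R J \<and> TO K B A \<in> R J" if A: "A \<in> R J" and B: "B \<in> Ob K" for A B
  proof -
    have "Ind' A \<in> J" "A \<in> Ob K" using A by (auto simp: mem_restricted_ideal)
    moreover have "Ind' B \<in> EO" using B by (rule Ind_EO)
    ultimately show ?thesis using induced_tensor[OF J] KG_thick_tensor[OF J] B by blast
  qed
  moreover have "R J \<subseteq> Ob K" by (auto simp: mem_restricted_ideal)
  ultimately have "thick_ideal K (R J)"
    unfolding thick_ideal_def triangulated_subcategory_def
    using restricted_ideal_zero[OF J] restricted_ideal_shift[OF J] restricted_ideal_cone[OF J] by blast
  then show ?thesis using restricted_ideal_act[OF J] by (auto simp: G_ideal_def)
qed

section \<open>The bijection\<close>

lemma restricted_equivariant_ideal: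
  assumes I: "G_ideal G K \<T> I"
  shows "R (E I) = I"
proof -
  have th: "thick_ideal K I" and stable: "\<And>g A. g \<in> carrier G \<Longrightarrow> A \<in> I \<Longrightarrow> act_ob g A \<in> I"
    using I by (auto simp: G_ideal_def)
  note tI = triangulated_subcategory_rules[OF thick_ideal_rules(1)[OF th]]
  have "fst (Ind' A) \<in> I \<longleftrightarrow> A \<in> I" if A: "A \<in> Ob K" for A
  proof -
    obtain \<iota> \<pi> where ind: "induced A (Ind' A) \<iota> \<pi>" using Ind_induced[OF finite_G A] by blast
    note r = induced_rules[OF ind]
    show ?thesis
    proof
      assume S: "fst (Ind' A) \<in> I"
      obtain i p where "i \<in> Hom K A (fst (Ind' A))" "p \<in> Hom K (fst (Ind' A)) A" "p \<odot> i = Ide K A"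
        using induced_summand[OF ind] by blast
      then show "A \<in> I" by (rule thick_ideal_retract[OF th S])
    next
      assume "A \<in> I"
      have "\<exists>S \<iota>' \<pi>'. S \<in> I \<and> is_direct_sum K (carrier G) (\<lambda>g. act_ob g A) S \<iota>' \<pi>'"
      proof (rule direct_sum_exists[OF finite_G _ tI(1)])
        show "act_ob g A \<in> I" if "g \<in> carrier G" for g using stable[OF that \<open>A \<in> I\<close>] .
        show "S \<in> I" if "A \<in> I" "B \<in> I" "is_biproduct2 K A B S i1 i2 p1 p2" for A B S i1 i2 p1 p2
          using triangulated_subcategory_biproduct[OF thick_ideal_rules(1)[OF th] that(3,1,2)] .
      qed (rule tI(3))
      then obtain S \<iota>' \<pi>' where S: "S \<in> I" and "is_direct_sum K (carrier G) (\<lambda>g. act_ob g A) S \<iota>' \<pi>'"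
        by (elim exE conjE)
      then have "isomorphic K S (fst (Ind' A))" by (intro direct_sum_unique[OF _ r(3)])
      then show "fst (Ind' A) \<in> I" using tI(2)[OF S] EO_Ob[OF r(2)] by simp
    qed
  qed
  then show ?thesis
    using thick_ideal_rules(2)[OF th] by (auto simp: mem_restricted_ideal mem_equivariant_ideal Ind_EO)
qed

text \<open>Both \<open>\<epsilon> : Ind A \<rightarrow> X\<close> and \<open>\<eta> : X \<rightarrow> Ind A\<close> split in \<open>K\<close>. The cone of
  \<open>\<eta> \<epsilon>\<close> is the sum of the shifted kernel of \<open>\<epsilon>\<close> and the cokernel of \<open>\<eta>\<close>, equivariantly. So
  the kernel lies in every thick ideal that contains \<open>Ind A\<close>, and then so does \<open>X\<close>, a cone of the
  inclusion of the kernel.\<close>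

lemma mem_if_induced_mem:
  assumes J: "thick_ideal KG J" and X: "X \<in> EO" and Y: "Ind' (fst X) \<in> J"
  shows "X \<in> J"
proof -
  let ?A = "fst X" and ?Y = "Ind' (fst X)"
  obtain \<iota> \<pi> where ind: "induced ?A ?Y \<iota> \<pi>" using Ind_induced[OF finite_G EO_Ob[OF X]] by blast
  note r = induced_rules[OF ind] and t = direct_sum_typing[OF induced_rules(3)[OF ind] one_closed]
  obtain \<epsilon> where \<epsilon>: "eq_arrow ?Y X \<epsilon>" "\<And>g. g \<in> carrier G \<Longrightarrow> \<epsilon> \<odot> \<iota> g = snd X g"
    using induced_arrow_from[OF ind X family_from_structure[OF X]] by blast
  obtain \<eta> where \<eta>: "eq_arrow X ?Y \<eta>" "\<And>g. g \<in> carrier G \<Longrightarrow> \<pi> g \<odot> \<eta> = inv_ar K (snd X g)"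
    using induced_arrow_to[OF ind X family_to_structure[OF X]] by blast
  note t\<epsilon> = eq_arrow_rules(3-5)[OF \<epsilon>(1)] and t\<eta> = eq_arrow_rules(3-5)[OF \<eta>(1)]
  let ?\<phi> = "snd X eG"
  have \<phi>: "?\<phi> \<in> Ar K" "Dom K ?\<phi> = act_ob eG ?A" "Cod K ?\<phi> = ?A" "is_iso K ?\<phi>" using X by simp_all
  have "\<epsilon> \<odot> (\<iota> eG \<odot> inv_ar K ?\<phi>) = Ide K ?A"
    using Cmp_rewrite[OF \<epsilon>(2)[OF one_closed], of "inv_ar K ?\<phi>"] t t\<epsilon> \<phi> by simp
  moreover have "\<iota> eG \<odot> inv_ar K ?\<phi> \<in> Hom K ?A (fst ?Y)" "\<epsilon> \<in> Hom K (fst ?Y) ?A"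
    using t t\<epsilon> \<phi> by (simp_all add: Hom_def)
  ultimately obtain B j q where b: "is_biproduct2 K ?A B (fst ?Y) (\<iota> eG \<odot> inv_ar K ?\<phi>) j \<epsilon> q"
    using split_mono_complement by metis
  have "(?\<phi> \<odot> \<pi> eG) \<odot> \<eta> = Ide K ?A"
    using \<eta>(2)[OF one_closed] t t\<eta> \<phi> by simp
  moreover have "\<eta> \<in> Hom K ?A (fst ?Y)" "?\<phi> \<odot> \<pi> eG \<in> Hom K (fst ?Y) ?A"
    using t t\<eta> \<phi> by (simp_all add: Hom_def)
  ultimately obtain D k c where d: "is_biproduct2 K ?A D (fst ?Y) \<eta> k (?\<phi> \<odot> \<pi> eG) c"
    using split_mono_complement by metis
  define V where "V = retract_structure ?Y j q"
  define W where "W = retract_structure ?Y k c"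
  have j: "eq_arrow V ?Y j" unfolding V_def by (rule kernel_structure[OF \<epsilon>(1) b])
  have c: "eq_arrow ?Y W c" unfolding W_def by (rule cokernel_structure[OF \<eta>(1) d])
  have VW: "V \<in> EO" "W \<in> EO" "fst V = B" "fst W = D"
    using eq_arrow_rules(1)[OF j] eq_arrow_rules(2)[OF c] biproduct_typing[OF b] biproduct_typing[OF d]
    by (simp_all add: V_def W_def)
  let ?\<Sigma>V = "shift V"
  obtain Z i1 i2 p1 p2 where z: "is_biproduct2 K (SO B) D Z i1 i2 p1 p2"
    and tri: "(\<eta> \<odot> \<epsilon>, i2 \<odot> c, neg_ar K (SA j) \<odot> p1) \<in> Tri K"
    using split_factorization_triangle[OF b d] by metis
  have "is_biproduct2 K (fst ?\<Sigma>V) (fst W) Z i1 i2 p1 p2" using z VW by simp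
  then obtain Z' where Z': "Z' \<in> EO" "fst Z' = Z" "eq_arrow ?\<Sigma>V Z' i1" "eq_arrow W Z' i2" "eq_arrow Z' ?\<Sigma>V p1"
    using biproduct_structure[OF eq_shift_EO[OF VW(1)] VW(2)] by metis
  have "Z' \<in> J"
    by (rule KG_thick_cone[OF J Y Y eq_arrow_Cmp[OF \<epsilon>(1) \<eta>(1)] eq_arrow_Cmp[OF c Z'(4)]
          eq_arrow_Cmp[OF Z'(5) eq_arrow_neg[OF eq_arrow_shift[OF j]]] tri])
  moreover have "eq_retract ?\<Sigma>V Z'"
    unfolding eq_retract_def using Z'(3,5) biproduct_rules(1)[OF z] VW(3) by auto
  ultimately have "?\<Sigma>V \<in> J" using KG_thick_retract[OF J] by blast
  then have "V \<in> J" using KG_thick_shift[OF J VW(1)] by simp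
  then show "X \<in> J"
  proof (rule KG_thick_cone[OF J _ Y j \<epsilon>(1)])
    show "eq_arrow X ?\<Sigma>V (Zer K ?A (fst ?\<Sigma>V))" by (rule eq_arrow_Zer[OF X eq_shift_EO[OF VW(1)]])
    show "(j, \<epsilon>, Zer K ?A (fst ?\<Sigma>V)) \<in> Tri K"
      using biproduct_triangle[OF biproduct_swap[OF b]] VW(3) by simp
  qed
qed

lemma equivariant_restricted_ideal:
  assumes J: "thick_ideal KG J"
  shows "E (R J) = J"
  using KG_thick_EO[OF J] mem_if_induced_mem[OF J] underlying_mem_restricted_ideal[OF J]
  by (auto simp: mem_equivariant_ideal mem_restricted_ideal)

lemma equivariant_ideal_subset_iff:
  assumes I: "G_ideal G K \<T> I" and I': "G_ideal G K \<T> I'"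
  shows "E I \<subseteq> E I' \<longleftrightarrow> I \<subseteq> I'"
proof
  assume s: "E I \<subseteq> E I'"
  have "R (E I) \<subseteq> R (E I')"
    using s by (auto simp: mem_restricted_ideal)
  then show "I \<subseteq> I'" using restricted_equivariant_ideal I I' by simp
qed (auto simp: mem_equivariant_ideal)

lemma tensor_set_equivariant_ideal_subset_iff:
  assumes I: "G_ideal G K \<T> I" and I': "G_ideal G K \<T> I'" and P: "G_ideal G K \<T> P"
  shows "tensor_set KG (E I) (E I') \<subseteq> E P
    \<longleftrightarrow> tensor_set K I I' \<subseteq> P"
proof
  assume s: "tensor_set KG (E I) (E I') \<subseteq> E P"
  show "tensor_set K I I' \<subseteq> P"
  proof
    fix C assume "C \<in> tensor_set K I I'"
    then obtain A B where C: "C = TO K A B" and A: "A \<in> I" and B: "B \<in> I'" by (auto simp: tensor_set_def)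
    have IA: "Ind' A \<in> E I" "A \<in> Ob K"
      using A restricted_equivariant_ideal[OF I] mem_restricted_ideal by blast+
    have IB: "Ind' B \<in> E I'" "B \<in> Ob K"
      using B restricted_equivariant_ideal[OF I'] mem_restricted_ideal by blast+
    have "tensor (Ind' A) (Ind' B) \<in> E P"
      using s IA(1) IB(1) unfolding tensor_set_def KG_simps by blast
    then have "C \<in> R (E P)"
      using induced_tensor[OF equivariant_ideal_thick IA(2) IB(2)] P C by (simp add: G_ideal_def)
    then show "C \<in> P" using restricted_equivariant_ideal[OF P] by simp
  qed
next
  assume s: "tensor_set K I I' \<subseteq> P"
  show "tensor_set KG (E I) (E I') \<subseteq> E P"
  proof
    fix Z assume "Z \<in> tensor_set KG (E I) (E I')"
    then obtain X Y where Z: "Z = tensor X Y" and X: "X \<in> EO" "fst X \<in> I" and Y: "Y \<in> EO" "fst Y \<in> I'"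
      unfolding tensor_set_def KG_simps mem_equivariant_ideal by blast
    have "TO K (fst X) (fst Y) \<in> P" using s X(2) Y(2) unfolding tensor_set_def by blast
    then show "Z \<in> E P" using Z X(1) Y(1) by (simp add: mem_equivariant_ideal)
  qed
qed

lemma G_ideal_equivariant_thick: "G_ideal G K \<T> I \<Longrightarrow> thick_ideal KG (E I)"
  by (simp add: G_ideal_def equivariant_ideal_thick)

lemma G_prime_iff_prime:
  assumes P: "G_ideal G K \<T> P"
  shows "G_prime G K \<T> P \<longleftrightarrow> prime_ideal KG (E P)"
proof -
  have "E P = EO \<longleftrightarrow> P = Ob K"
  proof
    assume "E P = EO"
    then have "R (E P) = Ob K"
      by (auto simp: mem_restricted_ideal Ind_EO)
    then show "P = Ob K" using restricted_equivariant_ideal[OF P] by simp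
  next
    assume "P = Ob K"
    then show "E P = EO" using EO_Ob mem_equivariant_ideal by blast
  qed
  moreover have "(\<forall>J J'. thick_ideal KG J \<longrightarrow> thick_ideal KG J' \<longrightarrow> Q J J') \<longleftrightarrow>
      (\<forall>I I'. G_ideal G K \<T> I \<longrightarrow> G_ideal G K \<T> I' \<longrightarrow> Q (E I) (E I'))"
    for Q
    using equivariant_restricted_ideal restricted_ideal_G_ideal G_ideal_equivariant_thick by metis
  ultimately show ?thesis
    unfolding G_prime_def prime_ideal_def
    using P G_ideal_equivariant_thick[OF P] tensor_set_equivariant_ideal_subset_iff[OF _ _ P]
      equivariant_ideal_subset_iff[OF _ P] by simp
qed

section \<open>The spectra\<close>

lemma G_prime_sums:
  assumes A: "A \<in> Ob K" "B \<in> Ob K"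
  shows "\<exists>C \<in> Ob K. \<forall>P. G_ideal G K \<T> P \<longrightarrow> (C \<in> P \<longleftrightarrow> A \<in> P \<and> B \<in> P)"
proof -
  obtain S i1 i2 p1 p2 where b: "is_biproduct2 K A B S i1 i2 p1 p2" using biproducts[OF A] by blast
  show ?thesis
    using thick_ideal_biproduct_iff[OF _ b] biproduct_typing(3)[OF b] unfolding G_ideal_def by blast
qed

lemma mem_iff_fst_mem_restricted:
  "thick_ideal KG J \<Longrightarrow> X \<in> EO \<Longrightarrow> X \<in> J \<longleftrightarrow> fst X \<in> R J"
  using equivariant_restricted_ideal mem_equivariant_ideal by blast

text \<open>Membership of an object in \<open>J\<close> depends only on its underlying object, so the sum can be formed in
  \<open>K\<close> and then induced.\<close>

lemma KG_sums:
  assumes X: "X \<in> EO" "Y \<in> EO"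
  shows "\<exists>Z \<in> EO. \<forall>J. thick_ideal KG J \<longrightarrow> (Z \<in> J \<longleftrightarrow> X \<in> J \<and> Y \<in> J)"
proof -
  obtain C where C: "C \<in> Ob K" "\<And>P. G_ideal G K \<T> P \<Longrightarrow> C \<in> P \<longleftrightarrow> fst X \<in> P \<and> fst Y \<in> P"
    using G_prime_sums[OF EO_Ob[OF X(1)] EO_Ob[OF X(2)]] by blast
  have "Ind' C \<in> J \<longleftrightarrow> X \<in> J \<and> Y \<in> J" if J: "thick_ideal KG J" for J
    using C(2)[OF restricted_ideal_G_ideal[OF J]] mem_iff_fst_mem_restricted[OF J] X C(1)
    by (simp add: mem_restricted_ideal)
  then show ?thesis using Ind_EO[OF C(1)] by blast
qed

theorem spectra_homeomorphic:
  "homeomorphic_maps (Spc_topology KG) (G_Spc_topology G K \<T>) R (E)"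
proof -
  have thick: "thick_ideal KG P" if "P \<in> Spc KG" for P
    using that by (simp add: Spc_def prime_ideal_def)
  have Gid: "G_ideal G K \<T> P" if "P \<in> G_Spc G K \<T>" for P
    using that by (simp add: G_Spc_def G_prime_def)
  have e: "E P \<in> Spc KG" if "P \<in> G_Spc G K \<T>" for P
    using that G_prime_iff_prime[OF Gid[OF that]] by (simp add: Spc_def G_Spc_def)
  have r: "R P \<in> G_Spc G K \<T>" if "P \<in> Spc KG" for P
    using that G_prime_iff_prime[OF restricted_ideal_G_ideal[OF thick[OF that]]]
      equivariant_restricted_ideal[OF thick[OF that]] by (simp add: Spc_def G_Spc_def)
  have zKG: "zariski_space EO (Spc KG)"
  proof
    show "\<exists>C \<in> EO. \<forall>P \<in> Spc KG. C \<in> P \<longleftrightarrow> A \<in> P \<and> B \<in> P" if "A \<in> EO" "B \<in> EO" for A B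
      using KG_sums[OF that] thick by blast
    show "P \<inter> EO \<noteq> {}" if "P \<in> Spc KG" for P
      using KG_thick_EO[OF thick[OF that]] KG_thick_nonempty[OF thick[OF that]] by blast
  qed
  have zK: "zariski_space (Ob K) (G_Spc G K \<T>)"
  proof
    show "\<exists>C \<in> Ob K. \<forall>P \<in> G_Spc G K \<T>. C \<in> P \<longleftrightarrow> A \<in> P \<and> B \<in> P" if "A \<in> Ob K" "B \<in> Ob K" for A B
      using G_prime_sums[OF that] Gid by blast
    show "P \<inter> Ob K \<noteq> {}" if "P \<in> G_Spc G K \<T>" for P
      using Gid[OF that] thick_ideal_rules(2,3)[of P] unfolding G_ideal_def by blast
  qed
  have "continuous_map (Spc_topology KG) (G_Spc_topology G K \<T>) R"
    unfolding Spc_topology_def G_Spc_topology_def KG_simps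
    by (rule continuous_map_zariski[where t = Ind', OF zKG zK]) (simp_all add: mem_restricted_ideal Ind_EO r)
  moreover have "continuous_map (G_Spc_topology G K \<T>) (Spc_topology KG) (E)"
    unfolding Spc_topology_def G_Spc_topology_def KG_simps
    by (rule continuous_map_zariski[where t = fst, OF zK zKG]) (simp_all add: mem_equivariant_ideal e)
  moreover have "topspace (Spc_topology KG) = Spc KG"
    unfolding Spc_topology_def KG_simps by (rule zariski_space.topspace_zariski[OF zKG])
  moreover have "topspace (G_Spc_topology G K \<T>) = G_Spc G K \<T>"
    unfolding G_Spc_topology_def by (rule zariski_space.topspace_zariski[OF zK])
  ultimately show ?thesis
    using equivariant_restricted_ideal thick restricted_equivariant_ideal Gid
    by (simp add: homeomorphic_maps_def)
qed

end

theorem proposition6p5: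
  fixes G :: "'g monoid"
    and K :: "('o, 'm) mtcat"
    and \<T> :: "('g, 'o, 'm) act"
    and smul :: "'k::ring_1 \<Rightarrow> 'm \<Rightarrow> 'm"
  assumes "group G" and "finite (carrier G)"
    and "monoidal_triangulated_category K"
    and "mt_action G K \<T>"
    and "linear_category K smul" and "of_nat (card (carrier G)) \<noteq> (0 :: 'k)"
    and "(\<exists>M :: ('a, 'b) mcat. homotopy_category_of_stable_model_category K M) \<or>
         (\<exists>D :: ('c, 'd) dgcat. dg_enhancement K D)"
  shows "(\<forall>I. G_ideal G K \<T> I \<longrightarrow>
            thick_ideal (equivariantization G K \<T>) (equivariant_ideal G K \<T> I))
       \<and> (\<forall>J. thick_ideal (equivariantization G K \<T>) J \<longrightarrow>
            G_ideal G K \<T> (restricted_ideal G K \<T> J))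
       \<and> (bij_betw (equivariant_ideal G K \<T>)
              {I. G_ideal G K \<T> I} {J. thick_ideal (equivariantization G K \<T>) J}
          \<and> (\<forall>I. G_ideal G K \<T> I \<longrightarrow>
               restricted_ideal G K \<T> (equivariant_ideal G K \<T> I) = I)
          \<and> (\<forall>J. thick_ideal (equivariantization G K \<T>) J \<longrightarrow>
               equivariant_ideal G K \<T> (restricted_ideal G K \<T> J) = J))
       \<and> (\<forall>P. G_ideal G K \<T> P \<longrightarrow>
            (G_prime G K \<T> P \<longleftrightarrow>
             prime_ideal (equivariantization G K \<T>) (equivariant_ideal G K \<T> P)))
       \<and> homeomorphic_maps
            (Spc_topology (equivariantization G K \<T>)) (G_Spc_topology G K \<T>)
            (restricted_ideal G K \<T>) (equivariant_ideal G K \<T>)"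
proof -
  interpret finite_mt_action G K \<T>
    using assms(2,4) by (simp add: finite_mt_action_def finite_mt_action_axioms_def)
  have "bij_betw (equivariant_ideal G K \<T>) {I. G_ideal G K \<T> I} {J. thick_ideal KG J}"
    by (rule bij_betwI[of _ _ _ "restricted_ideal G K \<T>"])
      (auto simp: G_ideal_equivariant_thick restricted_ideal_G_ideal restricted_equivariant_ideal
        equivariant_restricted_ideal)
  then show ?thesis
    using G_ideal_equivariant_thick restricted_ideal_G_ideal restricted_equivariant_ideal
      equivariant_restricted_ideal G_prime_iff_prime spectra_homeomorphic by blast
qed

end
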